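(* Let $-1<q<1$, $q\neq0$, and $\beta\ge1$. Then $\widetilde{SU_q(2)}_{\mathbb C}={\rm Spec}\,{\rm Pol}(SU_q(2))\cong\mathbb C\setminus\{0\}$ as topological groups (via $\varphi\mapsto\varphi(a_q)$), and $${\rm Spec}\,A(SU_q(2),w_\beta)\cong\{\rho\in\mathbb C\setminus\{0\}: \tfrac1\beta\le|\rho|\le\beta\}\cong\Big\{V=\begin{bmatrix}\rho&0\\0&\rho^{-1}\end{bmatrix}\in M_2(\mathbb C): \|V\|_\infty\le\beta\Big\}$$ as topological spaces, where $w_\beta(s)=\beta^{2s}$, $s\in\frac12\mathbb Z_+$.
   Context: $C(SU_q(2))$ is the universal unital $C^*$-algebra generated by $a_q,c_q$ with $a_q^*a_q+c_q^*c_q=I=a_qa_q^*+q^2c_q^*c_q$, $c_q^*c_q=c_qc_q^*$, $a_qc_q=qc_qa_q$, $a_qc_q^*=qc_q^*a_q$, with coproduct $\Delta(a_q)=a_q\otimes a_q-qc_q^*\otimes c_q$, $\Delta(c_q)=c_q\otimes a_q+a_q^*\otimes c_q$; ${\rm Pol}(SU_q(2))$ is the $*$-algebra generated by $a_q,c_q$. Irreducible representations are indexed by $s\in\frac12\mathbb Z_+$, of dimension $2s+1$, $u^{(0)}=1$, $u^{(1/2)}=\begin{bmatrix}a_q&-qc_q^*\\c_q&a_q^*\end{bmatrix}$. ${\rm Spec}\,{\rm Pol}$ is the group of nonzero characters under convolution $(\varphi\otimes\psi)\circ\Delta$ with pointwise convergence topology. For a weight $w$, $A(SU_q(2),w)$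 is the completion of ${\rm Pol}(SU_q(2))$ for the norm $\sum_s w(s)\|A_s\|_{S^1_{2s+1}}$ where $a=\sum_s\sum_{i,j}(A_s)_{ij}u^{(s)}_{ij}$, a Banach algebra extending the product of ${\rm Pol}$; ${\rm Spec}\,A(SU_q(2),w)$ is its set of nonzero continuous characters with the Gelfand topology, identified by restriction with a subset of ${\rm Spec}\,{\rm Pol}(SU_q(2))$. *)

theory Defs
  imports "HOL-Analysis.Analysis"
begin

text \<open>Generators: a_q, a_q^*, c_q, c_q^*.  Elements of the free (non-commutative)
  unital complex algebra are finitely supported functions on words.\<close>

datatype gen = GA | GAs | GC | GCs

type_synonym fa = "gen list \<Rightarrow> complex"
type_synonym fa2 = "gen list \<times> gen list \<Rightarrow> complex"

definition FS :: "fa set" where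
  "FS = {f. finite {w. f w \<noteq> 0}}"

definition FS2 :: "fa2 set" where
  "FS2 = {X. finite {p. X p \<noteq> 0}}"

definition delta :: "gen list \<Rightarrow> fa" where
  "delta w = (\<lambda>v. if v = w then 1 else 0)"

definition fadd :: "fa \<Rightarrow> fa \<Rightarrow> fa" where
  "fadd f g = (\<lambda>w. f w + g w)"

definition fsub :: "fa \<Rightarrow> fa \<Rightarrow> fa" where
  "fsub f g = (\<lambda>w. f w - g w)"

definition fscale :: "complex \<Rightarrow> fa \<Rightarrow> fa" where
  "fscale z f = (\<lambda>w. z * f w)"

definition fsum :: "'i set \<Rightarrow> ('i \<Rightarrow> fa) \<Rightarrow> fa" where
  "fsum I F = (\<lambda>w. \<Sum>i\<in>I. F i w)"

definition fmul :: "fa \<Rightarrow> fa \<Rightarrow> fa" where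
  "fmul f g = (\<lambda>w. \<Sum>k\<in>{0..length w}. f (take k w) * g (drop k w))"

definition gstar :: "gen \<Rightarrow> gen" where
  "gstar x = (case x of GA \<Rightarrow> GAs | GAs \<Rightarrow> GA | GC \<Rightarrow> GCs | GCs \<Rightarrow> GC)"

definition fstar :: "fa \<Rightarrow> fa" where
  "fstar f = (\<lambda>w. cnj (f (rev (map gstar w))))"

definition relators :: "real \<Rightarrow> fa set" where
  "relators q = {
     \<comment> \<open>a^*a + c^*c - 1\<close>
     fsub (fadd (delta [GAs, GA]) (delta [GCs, GC])) (delta []),
     \<comment> \<open>a a^* + q^2 c^*c - 1\<close>
     fsub (fadd (delta [GA, GAs]) (fscale (complex_of_real (q^2)) (delta [GCs, GC]))) (delta []),
     \<comment> \<open>c^*c - c c^*\<close>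
     fsub (delta [GCs, GC]) (delta [GC, GCs]),
     \<comment> \<open>a c - q c a, and its adjoint c^* a^* - q a^* c^*\<close>
     fsub (delta [GA, GC]) (fscale (complex_of_real q) (delta [GC, GA])),
     fsub (delta [GCs, GAs]) (fscale (complex_of_real q) (delta [GAs, GCs])),
     \<comment> \<open>a c^* - q c^* a, and its adjoint c a^* - q a^* c\<close>
     fsub (delta [GA, GCs]) (fscale (complex_of_real q) (delta [GCs, GA])),
     fsub (delta [GC, GAs]) (fscale (complex_of_real q) (delta [GAs, GC]))}"

text \<open>The two-sided ideal generated by the relations; Pol(SU_q(2)) = FS / rel_ideal q.\<close>
inductive_set rel_ideal :: "real \<Rightarrow> fa set" for q :: real where
  zero: "(\<lambda>w. 0) \<in> rel_ideal q"
| add: "x \<in> rel_ideal q \<Longrightarrow> y \<in> rel_ideal q \<Longrightarrow> fadd x y \<in> rel_ideal q"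
| gen: "x \<in> FS \<Longrightarrow> y \<in> FS \<Longrightarrow> r \<in> relators q \<Longrightarrow> fmul (fmul x r) y \<in> rel_ideal q"

definition tens :: "fa \<Rightarrow> fa \<Rightarrow> fa2" where
  "tens x y = (\<lambda>(u, v). x u * y v)"

definition fmul2 :: "fa2 \<Rightarrow> fa2 \<Rightarrow> fa2" where
  "fmul2 X Y = (\<lambda>(u, v). \<Sum>k\<in>{0..length u}. \<Sum>l\<in>{0..length v}.
      X (take k u, take l v) * Y (drop k u, drop l v))"

definition fsub2 :: "fa2 \<Rightarrow> fa2 \<Rightarrow> fa2" where
  "fsub2 X Y = (\<lambda>p. X p - Y p)"

definition fadd2 :: "fa2 \<Rightarrow> fa2 \<Rightarrow> fa2" where
  "fadd2 X Y = (\<lambda>p. X p + Y p)"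

definition fsum2 :: "'i set \<Rightarrow> ('i \<Rightarrow> fa2) \<Rightarrow> fa2" where
  "fsum2 I F = (\<lambda>p. \<Sum>i\<in>I. F i p)"

text \<open>The ideal (Pol \<otimes> I) + (I \<otimes> Pol) of the algebraic tensor square, so that
  Pol \<otimes> Pol = FS2 / tens_ideal q.\<close>
inductive_set tens_ideal :: "real \<Rightarrow> fa2 set" for q :: real where
  zero: "(\<lambda>p. 0) \<in> tens_ideal q"
| add: "X \<in> tens_ideal q \<Longrightarrow> Y \<in> tens_ideal q \<Longrightarrow> fadd2 X Y \<in> tens_ideal q"
| left: "x \<in> rel_ideal q \<Longrightarrow> y \<in> FS \<Longrightarrow> tens x y \<in> tens_ideal q"
| right: "x \<in> FS \<Longrightarrow> y \<in> rel_ideal q \<Longrightarrow> tens x y \<in> tens_ideal q"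

text \<open>Coproduct on generators:
  Delta(a) = a\<otimes>a - q c^*\<otimes>c,  Delta(c) = c\<otimes>a + a^*\<otimes>c,
  and the adjoint formulas for a^*, c^* (Delta is a *-homomorphism).\<close>
definition Delta_gen :: "real \<Rightarrow> gen \<Rightarrow> fa2" where
  "Delta_gen q x = (case x of
      GA \<Rightarrow> fsub2 (tens (delta [GA]) (delta [GA])) (tens (fscale (complex_of_real q) (delta [GCs])) (delta [GC]))
    | GC \<Rightarrow> fadd2 (tens (delta [GC]) (delta [GA])) (tens (delta [GAs]) (delta [GC]))
    | GAs \<Rightarrow> fsub2 (tens (delta [GAs]) (delta [GAs])) (tens (fscale (complex_of_real q) (delta [GC])) (delta [GCs]))
    | GCs \<Rightarrow> fadd2 (tens (delta [GCs]) (delta [GAs])) (tens (delta [GA]) (delta [GCs])))"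

fun Delta_word :: "real \<Rightarrow> gen list \<Rightarrow> fa2" where
  "Delta_word q [] = tens (delta []) (delta [])"
| "Delta_word q (x # w) = fmul2 (Delta_gen q x) (Delta_word q w)"

definition Delta :: "real \<Rightarrow> fa \<Rightarrow> fa2" where
  "Delta q f = fsum2 {w. f w \<noteq> 0} (\<lambda>w. (\<lambda>p. f w * Delta_word q w p))"

text \<open>Nonzero characters of Pol(SU_q(2)) = nonzero multiplicative linear functionals on
  the free algebra vanishing on the relation ideal. They are taken extensional on FS
  (value undefined outside FS) so that they are exactly functions on Pol.\<close>
definition SpecPol :: "real \<Rightarrow> (fa \<Rightarrow> complex) set" where
  "SpecPol q = {\<phi>. \<phi> \<in> extensional FS \<and>
      (\<forall>f\<in>FS. \<forall>g\<in>FS. \<phi> (fadd f g) = \<phi> f + \<phi> g) \<and>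
      (\<forall>z. \<forall>f\<in>FS. \<phi> (fscale z f) = z * \<phi> f) \<and>
      (\<forall>f\<in>FS. \<forall>g\<in>FS. \<phi> (fmul f g) = \<phi> f * \<phi> g) \<and>
      (\<exists>f\<in>FS. \<phi> f \<noteq> 0) \<and>
      (\<forall>f\<in>rel_ideal q. \<phi> f = 0)}"

definition tens_functional :: "(fa \<Rightarrow> complex) \<Rightarrow> (fa \<Rightarrow> complex) \<Rightarrow> fa2 \<Rightarrow> complex" where
  "tens_functional \<phi> \<psi> X = (\<Sum>p\<in>{p. X p \<noteq> 0}. X p * \<phi> (delta (fst p)) * \<psi> (delta (snd p)))"

definition conv :: "real \<Rightarrow> (fa \<Rightarrow> complex) \<Rightarrow> (fa \<Rightarrow> complex) \<Rightarrow> fa \<Rightarrow> complex" where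
  "conv q \<phi> \<psi> = restrict (\<lambda>f. tens_functional \<phi> \<psi> (Delta q f)) FS"

definition SpecPol_top :: "real \<Rightarrow> (fa \<Rightarrow> complex) topology" where
  "SpecPol_top q = subtopology (product_topology (\<lambda>_. euclidean) FS) (SpecPol q)"

text \<open>Finite complex matrices are functions nat \<Rightarrow> nat \<Rightarrow> _ with indices < d.\<close>

definition unitary_mat :: "nat \<Rightarrow> (nat \<Rightarrow> nat \<Rightarrow> complex) \<Rightarrow> bool" where
  "unitary_mat d X \<longleftrightarrow> (\<forall>i<d. \<forall>j<d. (\<Sum>k<d. cnj (X k i) * X k j) = (if i = j then 1 else 0))"

text \<open>Trace-class (Schatten-1) norm: sum of the singular values, via a singular value
  decomposition A = X diag(\<sigma>) Y.\<close>
definition trace_norm :: "nat \<Rightarrow> (nat \<Rightarrow> nat \<Rightarrow> complex) \<Rightarrow> real" where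
  "trace_norm d A = (THE t. \<exists>X Y \<sigma>. unitary_mat d X \<and> unitary_mat d Y \<and> (\<forall>k<d. \<sigma> k \<ge> 0) \<and>
      (\<forall>i<d. \<forall>j<d. A i j = (\<Sum>k<d. X i k * complex_of_real (\<sigma> k) * Y k j)) \<and>
      t = (\<Sum>k<d. \<sigma> k))"

definition unitary_corep :: "real \<Rightarrow> nat \<Rightarrow> (nat \<Rightarrow> nat \<Rightarrow> fa) \<Rightarrow> bool" where
  "unitary_corep q d U \<longleftrightarrow>
     (\<forall>i<d. \<forall>j<d. U i j \<in> FS) \<and>
     (\<forall>i<d. \<forall>j<d. fsub2 (Delta q (U i j)) (fsum2 {..<d} (\<lambda>k. tens (U i k) (U k j))) \<in> tens_ideal q) \<and>
     (\<forall>i<d. \<forall>j<d. fsub (fsum {..<d} (\<lambda>k. fmul (fstar (U k i)) (U k j)))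
                        (if i = j then delta [] else (\<lambda>w. 0)) \<in> rel_ideal q) \<and>
     (\<forall>i<d. \<forall>j<d. fsub (fsum {..<d} (\<lambda>k. fmul (U i k) (fstar (U j k))))
                        (if i = j then delta [] else (\<lambda>w. 0)) \<in> rel_ideal q)"

text \<open>A subspace with orthogonal projection P is invariant iff ((1-P)\<otimes>1) U (P\<otimes>1) = 0 in M_d(Pol).\<close>
definition invariant_proj :: "real \<Rightarrow> nat \<Rightarrow> (nat \<Rightarrow> nat \<Rightarrow> fa) \<Rightarrow> (nat \<Rightarrow> nat \<Rightarrow> complex) \<Rightarrow> bool" where
  "invariant_proj q d U P \<longleftrightarrow>
     (\<forall>i<d. \<forall>j<d. fsum ({..<d} \<times> {..<d})
        (\<lambda>(k, l). fscale (((if i = k then 1 else 0) - P i k) * P l j) (U k l)) \<in> rel_ideal q)"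

definition orth_proj :: "nat \<Rightarrow> (nat \<Rightarrow> nat \<Rightarrow> complex) \<Rightarrow> bool" where
  "orth_proj d P \<longleftrightarrow> (\<forall>i<d. \<forall>j<d. P i j = cnj (P j i) \<and> (\<Sum>k<d. P i k * P k j) = P i j)"

definition irreducible_unitary_corep :: "real \<Rightarrow> nat \<Rightarrow> (nat \<Rightarrow> nat \<Rightarrow> fa) \<Rightarrow> bool" where
  "irreducible_unitary_corep q d U \<longleftrightarrow> d \<ge> 1 \<and> unitary_corep q d U \<and>
     (\<forall>P. orth_proj d P \<and> invariant_proj q d U P \<longrightarrow>
          (\<forall>i<d. \<forall>j<d. P i j = 0) \<or> (\<forall>i<d. \<forall>j<d. P i j = (if i = j then 1 else 0)))"

text \<open>u n is the irreducible corepresentation u^{(s)} with n = 2s, of dimension n+1;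
  w is given as a function of n = 2s.  The norm of (the class of) f is
  \<Sum>_s w(s) \<parallel>A_s\<parallel>_1 where f = \<Sum>_s \<Sum>_{ij} (A_s)_{ij} u^{(s)}_{ij} in Pol; since this
  expansion is unique, we write it as an infimum over all such expansions.\<close>
definition wnorm :: "real \<Rightarrow> (nat \<Rightarrow> nat \<Rightarrow> nat \<Rightarrow> fa) \<Rightarrow> (nat \<Rightarrow> real) \<Rightarrow> fa \<Rightarrow> real" where
  "wnorm q u w f = Inf {(\<Sum>n\<le>N. w n * trace_norm (n + 1) (A n)) | N A.
      fsub f (fsum (SIGMA n:{..N}. {..n} \<times> {..n}) (\<lambda>(n, i, j). fscale (A n i j) (u n i j)))
        \<in> rel_ideal q}"

text \<open>Nonzero continuous characters of the completion A(SU_q(2),w), identified by restriction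
  with the characters of Pol bounded for the norm (Pol is dense).\<close>
definition SpecA :: "real \<Rightarrow> (nat \<Rightarrow> nat \<Rightarrow> nat \<Rightarrow> fa) \<Rightarrow> (nat \<Rightarrow> real) \<Rightarrow> (fa \<Rightarrow> complex) set" where
  "SpecA q u w = {\<phi> \<in> SpecPol q. \<exists>C. \<forall>f\<in>FS. cmod (\<phi> f) \<le> C * wnorm q u w f}"

text \<open>Elements of the completion: Cauchy sequences in Pol for the norm.\<close>
definition wcauchy :: "real \<Rightarrow> (nat \<Rightarrow> nat \<Rightarrow> nat \<Rightarrow> fa) \<Rightarrow> (nat \<Rightarrow> real) \<Rightarrow> (nat \<Rightarrow> fa) set" where
  "wcauchy q u w = {\<sigma>. (\<forall>k. \<sigma> k \<in> FS) \<and>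
      (\<forall>\<epsilon>>0. \<exists>N. \<forall>m\<ge>N. \<forall>n\<ge>N. wnorm q u w (fsub (\<sigma> m) (\<sigma> n)) < \<epsilon>)}"

text \<open>Gelfand topology: the weakest topology making \<phi> \<mapsto> \<phi>(x) continuous for all x in
  the completion, where \<phi>(x) = lim \<phi>(\<sigma> k) for x = lim \<sigma> k.\<close>
definition SpecA_top :: "real \<Rightarrow> (nat \<Rightarrow> nat \<Rightarrow> nat \<Rightarrow> fa) \<Rightarrow> (nat \<Rightarrow> real) \<Rightarrow> (fa \<Rightarrow> complex) topology" where
  "SpecA_top q u w = pullback_topology (SpecA q u w)
      (\<lambda>\<phi>. restrict (\<lambda>\<sigma>. lim (\<lambda>k. \<phi> (\<sigma> k))) (wcauchy q u w))
      (product_topology (\<lambda>_. euclidean) (wcauchy q u w))"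

text \<open>The weight w_\<beta>(s) = \<beta>^{2s}, written as a function of n = 2s.\<close>
definition w_beta :: "real \<Rightarrow> nat \<Rightarrow> real" where
  "w_beta \<beta> n = \<beta> ^ n"

definition diag2 :: "complex \<Rightarrow> complex^2^2" where
  "diag2 \<rho> = (\<chi> i j. if i = j then (if i = 1 then \<rho> else inverse \<rho>) else 0)"

end

theory Submission
  imports Defs "HOL-Library.Function_Algebras"
begin

text \<open>
  Characters. The relations force a character \<open>\<phi>\<close> to kill \<open>c\<close> and \<open>c\<^sup>*\<close>, so it is
  determined by \<open>\<rho> = \<phi>(a) \<noteq> 0\<close>.

  Irreducible corepresentations. Let \<open>E\<close> and \<open>F\<close> be the functionals dual to \<open>c\<^sup>*\<close> and \<open>c\<close> with
  \<open>E(xy) = E(x) \<epsilon>(y) + K(x) E(y)\<close>, where \<open>K\<close> is the character \<open>\<rho> = q\<close>. Together with the torus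
  they satisfy the relations of \<open>U\<^sub>q(sl\<^sub>2)\<close>, and every corepresentation becomes a module over them.
  The functionals \<open>F\<^sup>i E\<^sup>N F\<^sup>j\<close> (\<open>i, j \<le> N\<close>) vanish on words shorter than \<open>N\<close> and are, up to nonzero
  scalars, dual to the normal monomials of degree \<open>N\<close>; hence they separate the points of the
  algebra. So a subspace invariant under \<open>E\<close> and \<open>F\<close> is a subcorepresentation, and highest weight
  theory shows that an irreducible unitary corepresentation of dimension \<open>n + 1\<close> has weights
  \<open>n, n - 2, \<dots>, -n\<close> in an orthonormal basis. The same functionals are dual to its matrix
  coefficients, so descending induction on the degree expands every element in matrix
  coefficients.

  Norm. Trace duality gives \<open>\<bar>\<phi>(f)\<bar> \<le> \<Sum> \<beta>\<^sup>n \<parallel>A\<^sub>n\<parallel>\<close> as soon as \<open>\<bar>\<rho>\<bar>\<^sup>m \<le> \<beta>\<^sup>n\<close> for all weights \<open>m\<close> of the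
  corepresentation of dimension \<open>n + 1\<close>; rank one matrices \<open>A\<^sub>n\<close> at the extreme weights \<open>n\<close> and \<open>-n\<close>
  show that \<open>1/\<beta> \<le> \<bar>\<rho>\<bar> \<le> \<beta>\<close> is also necessary.
\<close>

section \<open>Finitely supported functions\<close>

text \<open>The family \<open>u\<close> is arbitrary: only dimension, unitarity and irreducibility
  are given, and every identity holds modulo an ideal known by generators. No formula for matrix
  coefficients is available, so all information is drawn out by functionals on the free algebra that
  kill the relators. The shape \<open>F^i E^N F^j\<close> comes from weights: words of length
  \<open>N\<close> have weights between \<open>-N\<close> and \<open>N\<close>, and
  \<open>E^N\<close> raises weights by \<open>2 N\<close>, the full width. It therefore lets only
  the lowest weight through, and \<open>j\<close> and \<open>i\<close> then read off the right and
  the left weight of a word, which together determine a normal monomial of degree \<open>N\<close>.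
  The norm is an infimum over expansions in matrix coefficients. Spanning makes that infimum one
  over a nonempty set, and the upper estimate for characters is proved for each expansion
  separately. \<open>trace_norm\<close> is a definite description, so singular value decompositions
  have to exist and their sums have to agree before it can be evaluated.\<close>

lemma fun_sum_apply: "(sum F A) x = (\<Sum>a\<in>A. F a x)"
  by (induct A rule: infinite_finite_induct) auto

definition fsupp :: "('a \<Rightarrow> complex) set" where
  "fsupp = {x. finite {a. x a \<noteq> 0}}"

lemma FS_eq_fsupp: "FS = fsupp"
  by (simp add: FS_def fsupp_def)

lemma fsupp_add [intro]: "x \<in> fsupp \<Longrightarrow> y \<in> fsupp \<Longrightarrow> x + y \<in> fsupp"
  unfolding fsupp_def mem_Collect_eq
  by (rule finite_subset[of _ "{a. x a \<noteq> 0} \<union> {a. y a \<noteq> 0}"]) auto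

lemma fsupp_diff [intro]: "x \<in> fsupp \<Longrightarrow> y \<in> fsupp \<Longrightarrow> x - y \<in> fsupp"
  unfolding fsupp_def mem_Collect_eq
  by (rule finite_subset[of _ "{a. x a \<noteq> 0} \<union> {a. y a \<noteq> 0}"]) auto

lemma fsupp_zero [simp, intro]: "0 \<in> fsupp"
  by (simp add: fsupp_def)

lemma fsupp_scale [intro]: "x \<in> fsupp \<Longrightarrow> (\<lambda>a. z * x a) \<in> fsupp"
  unfolding fsupp_def mem_Collect_eq
  by (erule rev_finite_subset) auto

lemma fsupp_sum [intro]: "(\<And>i. i \<in> I \<Longrightarrow> F i \<in> fsupp) \<Longrightarrow> sum F I \<in> fsupp"
  by (induct I rule: infinite_finite_induct) auto

text \<open>The linear extension of a function given on basis elements, so that functionals are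
  plain functions on words. Outside \<open>fsupp\<close> the range of summation is infinite and the
  value is the default \<open>0\<close>.\<close>

definition ev :: "('a \<Rightarrow> complex) \<Rightarrow> ('a \<Rightarrow> complex) \<Rightarrow> complex" where
  "ev \<omega> x = (\<Sum>a | x a \<noteq> 0. x a * \<omega> a)"

lemma ev_superset:
  assumes "finite S" "\<And>a. x a \<noteq> 0 \<Longrightarrow> a \<in> S"
  shows "ev \<omega> x = (\<Sum>a\<in>S. x a * \<omega> a)"
  unfolding ev_def using assms by (intro sum.mono_neutral_left) auto

lemma ev_add:
  assumes "x \<in> fsupp" "y \<in> fsupp" shows "ev \<omega> (x + y) = ev \<omega> x + ev \<omega> y"
proof -
  let ?S = "{a. x a \<noteq> 0} \<union> {a. y a \<noteq> 0}"
  have f: "finite ?S" using assms by (simp add: fsupp_def)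
  show ?thesis
    by (subst (1 2 3) ev_superset[OF f]) (auto simp: sum.distrib distrib_right)
qed

lemma ev_scale: "ev \<omega> (\<lambda>a. z * x a) = z * ev \<omega> x"
proof (cases "z = 0")
  case False
  then show ?thesis by (simp add: ev_def sum_distrib_left mult.assoc)
qed (simp add: ev_def)

lemma ev_zero [simp]: "ev \<omega> 0 = 0" by (simp add: ev_def)

lemma ev_diff:
  assumes "x \<in> fsupp" "y \<in> fsupp" shows "ev \<omega> (x - y) = ev \<omega> x - ev \<omega> y"
proof -
  have "ev \<omega> (x - y) + ev \<omega> y = ev \<omega> (x - y + y)" using assms by (intro ev_add[symmetric]) auto
  then show ?thesis by (simp add: eq_diff_eq)
qed

lemma ev_sum:
  "(\<And>i. i \<in> I \<Longrightarrow> F i \<in> fsupp) \<Longrightarrow> ev \<omega> (sum F I) = (\<Sum>i\<in>I. ev \<omega> (F i))"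
  by (induct I rule: infinite_finite_induct) (auto simp: ev_add fsupp_sum)

lemma ev_single: "ev \<omega> (\<lambda>b. if b = a then 1 else 0) = \<omega> a"
  by (subst ev_superset[of "{a}"]) (auto split: if_splits)

lemma ev_indicator: "x \<in> fsupp \<Longrightarrow> ev (\<lambda>b. if b = a then 1 else 0) x = x a"
  by (subst ev_superset[of "insert a {b. x b \<noteq> 0}"])
     (auto simp: fsupp_def if_distrib cong: if_cong)

text \<open>The coordinate functionals are among the \<open>\<omega>\<close>. Identities between
  products, slices and derivations are reduced through this to identities between iterated
  \<open>ev\<close>.\<close>

lemma ev_eqI:
  assumes "x \<in> fsupp" "y \<in> fsupp" "\<And>\<omega>. ev \<omega> x = ev \<omega> y" shows "x = y"
proof
  fix a show "x a = y a"
    using assms(3)[of "\<lambda>b. if b = a then 1 else 0"] ev_indicator assms(1,2) by metis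
qed

lemma ev_functional_add: "ev (\<lambda>a. f a + g a) x = ev f x + ev g x"
  by (simp add: ev_def distrib_left sum.distrib)

lemma ev_functional_scale: "ev (\<lambda>a. z * f a) x = z * ev f x"
  by (simp add: ev_def sum_distrib_left mult_ac)

lemma ev_functional_diff: "ev (\<lambda>a. f a - g a) x = ev f x - ev g x"
  by (simp add: ev_def right_diff_distrib sum_subtractf)

lemma ev_functional_zero [simp]: "ev (\<lambda>a. 0) x = 0"
  by (simp add: ev_def)

lemma ev_cong: "(\<And>a. x a \<noteq> 0 \<Longrightarrow> f a = g a) \<Longrightarrow> ev f x = ev g x"
  by (simp add: ev_def)

definition lin :: "('a \<Rightarrow> 'b \<Rightarrow> complex) \<Rightarrow> ('a \<Rightarrow> complex) \<Rightarrow> 'b \<Rightarrow> complex" where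
  "lin T x = (\<lambda>b. ev (\<lambda>a. T a b) x)"

lemma lin_eq_sum: "lin T x = (\<Sum>a | x a \<noteq> 0. (\<lambda>b. x a * T a b))"
  by (auto simp: lin_def ev_def fun_sum_apply)

lemma lin_fsupp [intro]: "(\<And>a. T a \<in> fsupp) \<Longrightarrow> lin T x \<in> fsupp"
  unfolding lin_eq_sum by auto

text \<open>Transposition: testing the image with \<open>\<omega>\<close> is testing the argument
  with the pulled back functional.\<close>

lemma ev_lin: "(\<And>a. T a \<in> fsupp) \<Longrightarrow> ev \<omega> (lin T x) = ev (\<lambda>a. ev \<omega> (T a)) x"
  unfolding lin_eq_sum by (subst ev_sum) (auto simp: ev_scale, simp add: ev_def)

lemma lin_add: "x \<in> fsupp \<Longrightarrow> y \<in> fsupp \<Longrightarrow> lin T (x + y) = lin T x + lin T y"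
  by (auto simp: lin_def ev_add)
lemma lin_diff: "x \<in> fsupp \<Longrightarrow> y \<in> fsupp \<Longrightarrow> lin T (x - y) = lin T x - lin T y"
  by (auto simp: lin_def ev_diff)
lemma lin_scale: "lin T (\<lambda>a. z * x a) = (\<lambda>b. z * lin T x b)"
  by (auto simp: lin_def ev_scale)
lemma lin_sum: "(\<And>i. i \<in> I \<Longrightarrow> F i \<in> fsupp) \<Longrightarrow> lin T (sum F I) = (\<Sum>i\<in>I. lin T (F i))"
  by (auto simp: lin_def ev_sum fun_sum_apply)
lemma lin_zero [simp]: "lin T 0 = 0"
  by (auto simp: lin_def)

section \<open>The free algebra\<close>

interpretation fv: vector_space fscale
  by unfold_locales (auto simp: fscale_def algebra_simps)

lemma fadd_eq: "fadd = (+)" and fsub_eq: "fsub = (-)"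
  by (auto simp: fadd_def fsub_def fun_eq_iff)
lemma fsum_eq: "fsum I F = sum F I"
  by (auto simp: fsum_def fun_sum_apply)
lemma fadd2_eq: "fadd2 = (+)" and fsub2_eq: "fsub2 = (-)"
  by (auto simp: fadd2_def fsub2_def fun_eq_iff)
lemma fsum2_eq: "fsum2 I F = sum F I"
  by (auto simp: fsum2_def fun_sum_apply)

lemma delta_FS [simp, intro]: "delta w \<in> FS"
  by (auto simp: delta_def FS_def intro: finite_subset[of _ "{w}"])

lemma ev_delta [simp]: "ev \<omega> (delta w) = \<omega> w"
  unfolding delta_def by (rule ev_single)

lemma lin_delta [simp]: "lin T (delta w) = T w"
  by (auto simp: lin_def)

lemma ev_fscale: "ev \<omega> (fscale z x) = z * ev \<omega> x"
  unfolding fscale_def by (rule ev_scale)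

lemma lin_fscale: "lin T (fscale z x) = fscale z (lin T x)"
  unfolding fscale_def by (rule lin_scale)

lemma FS_closed [intro]:
  "x \<in> FS \<Longrightarrow> y \<in> FS \<Longrightarrow> x + y \<in> FS"
  "x \<in> FS \<Longrightarrow> y \<in> FS \<Longrightarrow> x - y \<in> FS"
  "x \<in> FS \<Longrightarrow> fscale z x \<in> FS"
  "0 \<in> FS"
  "(\<And>i. i \<in> I \<Longrightarrow> F i \<in> FS) \<Longrightarrow> sum F I \<in> FS"
  unfolding FS_eq_fsupp fscale_def by auto

lemma FS_expand: "x \<in> FS \<Longrightarrow> x = (\<Sum>w | x w \<noteq> 0. fscale (x w) (delta w))"
  by (auto simp: fun_eq_iff fun_sum_apply fscale_def delta_def FS_def if_distrib cong: if_cong)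

text \<open>\<open>fmul\<close> sums over the cuts of a word, the right-hand side over pairs of
  words. A word with a cut \<open>(w, k)\<close> is the same thing as the pair
  \<open>(take k w, drop k w)\<close>.\<close>

lemma ev_fmul:
  assumes "f \<in> FS" "g \<in> FS"
  shows "fmul f g \<in> FS" "ev \<omega> (fmul f g) = ev (\<lambda>u. ev (\<lambda>v. \<omega> (u @ v)) g) f"
proof -
  define A B where "A = {u. f u \<noteq> 0}" and "B = {v. g v \<noteq> 0}"
  define S where "S = (\<lambda>(u, v). u @ v) ` (A \<times> B)"
  have fin: "finite A" "finite B" "finite S" using assms by (auto simp: FS_def A_def B_def S_def)
  have supp: "w \<in> S" if "fmul f g w \<noteq> 0" for w
  proof -
    have "\<exists>k. f (take k w) * g (drop k w) \<noteq> 0"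
      using that unfolding fmul_def by (rule contrapos_np) (auto intro: sum.neutral)
    then obtain k where "f (take k w) * g (drop k w) \<noteq> 0" by blast
    then have "(take k w, drop k w) \<in> A \<times> B" by (auto simp: A_def B_def)
    then have "(\<lambda>(u, v). u @ v) (take k w, drop k w) \<in> S" unfolding S_def by (rule imageI)
    then show ?thesis by simp
  qed
  show "fmul f g \<in> FS" unfolding FS_def mem_Collect_eq
    by (rule finite_subset[OF _ fin(3)]) (use supp in auto)
  define P where "P = (SIGMA w:S. {0..length w})"
  have inj: "inj_on (\<lambda>(w, k). (take k w, drop k w)) P"
  proof (rule inj_onI)
    fix p p' assume "p \<in> P" "p' \<in> P"
      "(\<lambda>(w, k). (take k w, drop k w)) p = (\<lambda>(w, k). (take k w, drop k w)) p'"
    then obtain w k w' k' where *: "p = (w, k)" "p' = (w', k')" "k \<le> length w" "k' \<le> length w'"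
      "take k w = take k' w'" "drop k w = drop k' w'" by (auto simp: P_def)
    then have "w = w'" by (metis append_take_drop_id)
    moreover have "k = k'" using * by (metis length_take min.absorb2)
    ultimately show "p = p'" using * by simp
  qed
  \<comment> \<open>A cut of a word in \<open>S\<close> need not have its two parts in
    \<open>A\<close> and \<open>B\<close>; such terms are zero, so an inclusion suffices.\<close>
  have sub: "A \<times> B \<subseteq> (\<lambda>(w, k). (take k w, drop k w)) ` P"
  proof
    fix p assume "p \<in> A \<times> B"
    then obtain u v where p: "p = (u, v)" "u \<in> A" "v \<in> B" by auto
    then have "(u @ v, length u) \<in> P" by (auto simp: P_def S_def)
    then show "p \<in> (\<lambda>(w, k). (take k w, drop k w)) ` P" using p by (force intro!: rev_image_eqI)
  qed
  have "ev \<omega> (fmul f g) = (\<Sum>w\<in>S. \<Sum>k\<in>{0..length w}. f (take k w) * g (drop k w) * \<omega> w)"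
    by (subst ev_superset[OF fin(3) supp]) (auto simp: fmul_def sum_distrib_right)
  also have "\<dots> = (\<Sum>(w, k)\<in>P. f (take k w) * g (drop k w) * \<omega> w)"
    unfolding P_def using fin by (subst sum.Sigma) auto
  also have "\<dots> = (\<Sum>(u, v)\<in>(\<lambda>(w, k). (take k w, drop k w)) ` P. f u * g v * \<omega> (u @ v))"
    by (subst sum.reindex[OF inj]) (auto intro!: sum.cong)
  also have "\<dots> = (\<Sum>(u, v)\<in>A \<times> B. f u * g v * \<omega> (u @ v))"
    using fin by (intro sum.mono_neutral_right sub) (auto simp: P_def A_def B_def)
  also have "\<dots> = ev (\<lambda>u. ev (\<lambda>v. \<omega> (u @ v)) g) f"
    unfolding ev_def A_def B_def sum.cartesian_product[symmetric]
    by (simp add: sum_distrib_left mult.assoc)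
  finally show "ev \<omega> (fmul f g) = ev (\<lambda>u. ev (\<lambda>v. \<omega> (u @ v)) g) f" .
qed

lemma FS_eqI: "x \<in> FS \<Longrightarrow> y \<in> FS \<Longrightarrow> (\<And>\<omega>. ev \<omega> x = ev \<omega> y) \<Longrightarrow> x = y"
  unfolding FS_eq_fsupp by (rule ev_eqI)

lemmas fmul_FS [intro] = ev_fmul(1)

lemma ev_FS_add: "x \<in> FS \<Longrightarrow> y \<in> FS \<Longrightarrow> ev \<omega> (x + y) = ev \<omega> x + ev \<omega> y"
  and ev_FS_diff: "x \<in> FS \<Longrightarrow> y \<in> FS \<Longrightarrow> ev \<omega> (x - y) = ev \<omega> x - ev \<omega> y"
  and ev_FS_sum: "(\<And>i. i \<in> I \<Longrightarrow> F i \<in> FS) \<Longrightarrow> ev \<omega> (sum F I) = (\<Sum>i\<in>I. ev \<omega> (F i))"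
  unfolding FS_eq_fsupp by (simp_all add: ev_add ev_diff ev_sum)

lemma fmul_delta [simp]: "fmul (delta u) (delta v) = delta (u @ v)"
  by (rule FS_eqI) (auto simp: ev_fmul)

lemma fmul_assoc:
  "x \<in> FS \<Longrightarrow> y \<in> FS \<Longrightarrow> z \<in> FS \<Longrightarrow> fmul (fmul x y) z = fmul x (fmul y z)"
  by (rule FS_eqI) (auto simp: ev_fmul)

lemma fmul_delta_Nil [simp]:
  "x \<in> FS \<Longrightarrow> fmul (delta []) x = x" "x \<in> FS \<Longrightarrow> fmul x (delta []) = x"
  by (rule FS_eqI; auto simp: ev_fmul)+

lemma fmul_add_left: "fmul (x + y) z = fmul x z + fmul y z"
  and fmul_add_right: "fmul z (x + y) = fmul z x + fmul z y"
  and fmul_diff_left: "fmul (x - y) z = fmul x z - fmul y z"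
  and fmul_diff_right: "fmul z (x - y) = fmul z x - fmul z y"
  and fmul_scale_left: "fmul (fscale c x) z = fscale c (fmul x z)"
  and fmul_scale_right: "fmul z (fscale c x) = fscale c (fmul z x)"
  and fmul_zero_left [simp]: "fmul 0 x = 0"
  and fmul_zero_right [simp]: "fmul x 0 = 0"
  by (simp_all add: fmul_def fscale_def fun_eq_iff distrib_left distrib_right left_diff_distrib
      right_diff_distrib sum.distrib sum_subtractf sum_distrib_left mult_ac)

lemma fmul_sum_left: "fmul (sum F I) z = (\<Sum>i\<in>I. fmul (F i) z)"
  by (simp add: fun_eq_iff fmul_def fun_sum_apply sum_distrib_right) (intro allI sum.swap)

lemma fmul_sum_right: "fmul z (sum F I) = (\<Sum>i\<in>I. fmul z (F i))"
  by (simp add: fun_eq_iff fmul_def fun_sum_apply sum_distrib_left) (intro allI sum.swap)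

section \<open>The ideal of relations\<close>

lemma relators_FS: "r \<in> relators q \<Longrightarrow> r \<in> FS"
  by (auto simp: relators_def fsub_eq fadd_eq)

lemma rel_ideal_FS: "x \<in> rel_ideal q \<Longrightarrow> x \<in> FS"
proof (induct rule: rel_ideal.induct)
  case zero
  then show ?case by (simp add: FS_def)
next
  case (add x y)
  then show ?case unfolding fadd_eq by blast
next
  case (gen x y r)
  then show ?case using relators_FS by blast
qed

lemma subspace_rel_ideal: "fv.subspace (rel_ideal q)"
  unfolding fv.subspace_def
proof (intro conjI ballI allI)
  show "0 \<in> rel_ideal q" using rel_ideal.zero[of q] by (simp add: zero_fun_def)
  show "x + y \<in> rel_ideal q" if "x \<in> rel_ideal q" "y \<in> rel_ideal q" for x y
    using rel_ideal.add[OF that] by (simp add: fadd_eq)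
  show "fscale c x \<in> rel_ideal q" if "x \<in> rel_ideal q" for c x
    using that
  proof induct
    case zero
    show ?case using rel_ideal.zero[of q] by (simp add: fscale_def)
  next
    case (add x y)
    then show ?case using rel_ideal.add unfolding fadd_eq fv.scale_right_distrib by blast
  next
    case (gen x y r)
    then show ?case using rel_ideal.gen[of "fscale c x" y r q] by (auto simp: fmul_scale_left)
  qed
qed

lemmas rel_ideal_closed [intro] =
  fv.subspace_add[OF subspace_rel_ideal] fv.subspace_diff[OF subspace_rel_ideal]
  fv.subspace_scale[OF subspace_rel_ideal] fv.subspace_sum[OF subspace_rel_ideal]
  fv.subspace_0[OF subspace_rel_ideal]

lemma rel_ideal_mult:
  assumes "x \<in> rel_ideal q" "y \<in> FS"
  shows "fmul x y \<in> rel_ideal q" "fmul y x \<in> rel_ideal q"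
proof -
  have "fmul x y \<in> rel_ideal q \<and> fmul y x \<in> rel_ideal q"
    using assms(1)
  proof induct
    case zero
    show ?case using rel_ideal.zero[of q] by (simp add: zero_fun_def[symmetric])
  next
    case (add x y)
    then show ?case unfolding fadd_eq fmul_add_left fmul_add_right by blast
  next
    case (gen u v r)
    note r = relators_FS[OF gen(3)]
    have "fmul (fmul (fmul u r) v) y = fmul (fmul u r) (fmul v y)"
      "fmul y (fmul (fmul u r) v) = fmul (fmul (fmul y u) r) v"
      using gen r assms(2) by (simp_all add: fmul_assoc fmul_FS)
    then show ?case
      using rel_ideal.gen[of u "fmul v y" r q] rel_ideal.gen[of "fmul y u" v r q] gen assms(2) by auto
  qed
  then show "fmul x y \<in> rel_ideal q" "fmul y x \<in> rel_ideal q" by auto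
qed

lemma relator_in_ideal: "r \<in> relators q \<Longrightarrow> r \<in> rel_ideal q"
  using rel_ideal.gen[of "delta []" "delta []" r q] relators_FS by auto

text \<open>By bilinearity of the product it suffices to check a linear map on \<open>u r v\<close>
  with words \<open>u\<close>, \<open>v\<close> and a relator \<open>r\<close>. The scalar action
  \<open>sc\<close> of the target is a parameter, so that functionals and operators on the free
  algebra are both covered.\<close>

lemma rel_ideal_linear_induct:
  assumes "x \<in> rel_ideal q"
    and sub: "module.subspace sc W" and vs: "vector_space sc"
    and add: "\<And>x y. x \<in> FS \<Longrightarrow> y \<in> FS \<Longrightarrow> T (x + y) = T x + T y"
    and scale: "\<And>x c. T (fscale c x) = sc c (T x)"
    and words: "\<And>u v r. r \<in> relators q \<Longrightarrow> T (fmul (delta u) (fmul r (delta v))) \<in> W"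
  shows "T x \<in> W"
proof -
  interpret t: vector_space sc by (rule vs)
  have z: "T 0 = 0" using scale[of 0 0] by simp
  have Tsum: "T (sum F I) = (\<Sum>i\<in>I. T (F i))" if "\<And>i. i \<in> I \<Longrightarrow> F i \<in> FS" for F and I :: "gen list set"
    using that by (induct I rule: infinite_finite_induct) (auto simp: z add FS_closed(5))
  show ?thesis using assms(1)
  proof induct
    case zero
    then show ?case using z sub t.subspace_0 by (simp add: zero_fun_def)
  next
    case (add x y)
    then show ?case using assms(4) rel_ideal_FS sub t.subspace_add by (metis fadd_eq)
  next
    case (gen x y r)
    note r = relators_FS[OF gen(3)]
    have "fmul (fmul x r) y = (\<Sum>u | x u \<noteq> 0. \<Sum>v | y v \<noteq> 0.
        fscale (x u) (fscale (y v) (fmul (delta u) (fmul r (delta v)))))"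
      apply (subst fmul_assoc[OF gen(1) r gen(2)])
      apply (subst FS_expand[OF gen(1)], subst FS_expand[OF gen(2)])
      apply (simp add: fmul_sum_left fmul_sum_right fmul_scale_left fmul_scale_right fv.scale_sum_right)
      by (subst sum.swap) (simp add: mult.commute)
    moreover have "fscale c (fscale c' (fmul (delta u) (fmul r (delta v)))) \<in> FS" for c c' u v
      by (intro FS_closed fmul_FS delta_FS r)
    ultimately have "T (fmul (fmul x r) y) = (\<Sum>u | x u \<noteq> 0. \<Sum>v | y v \<noteq> 0.
        sc (x u) (sc (y v) (T (fmul (delta u) (fmul r (delta v))))))"
      by (simp only: Tsum FS_closed(5) scale)
    then show ?case
      using words[OF gen(3)] by (simp only:) (intro t.subspace_sum[OF sub] t.subspace_scale[OF sub])
  qed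
qed

text \<open>Pointwise rewriting would turn \<open>x + y\<close> into an abstraction whenever the simplifier
  meets an eta-expanded term, so from here on it is only used on demand.\<close>
declare plus_fun_apply [simp del] zero_fun_apply [simp del] minus_apply [simp del]
lemmas fun_ops = plus_fun_apply zero_fun_apply minus_apply fun_sum_apply

section \<open>Singular values and the trace norm\<close>

lemma sum_swap3: "(\<Sum>m\<in>K. \<Sum>i\<in>I. \<Sum>j\<in>J. f m i j) = (\<Sum>i\<in>I. \<Sum>j\<in>J. \<Sum>m\<in>K. f m i j)"
  by (subst sum.swap, rule sum.cong[OF refl], rule sum.swap)

lemma sum_swap4: "(\<Sum>i\<in>I. \<Sum>j\<in>J. \<Sum>l\<in>L. \<Sum>k\<in>K. f i j l k) = (\<Sum>l\<in>L. \<Sum>k\<in>K. \<Sum>i\<in>I. \<Sum>j\<in>J. f i j l k)"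
  by (subst sum_swap3[symmetric], rule sum.cong[OF refl], rule sum_swap3[symmetric])

text \<open>\<open>1 - X X\<^sup>*\<close> is an orthogonal projection of trace \<open>0\<close>, hence \<open>0\<close>.\<close>
lemma unitary_rows:
  assumes X: "unitary_mat d X" and ij: "i < d" "j < d"
  shows "(\<Sum>k<d. X i k * cnj (X j k)) = (if i = j then 1 else 0)"
proof -
  define P where "P i j = (\<Sum>k<d. X i k * cnj (X j k))" for i j
  define R where "R i j = (if i = j then 1 else 0) - P i j" for i j
  have cP: "cnj (P i j) = P j i" for i j by (simp add: P_def mult_ac)
  have PX: "(\<Sum>m<d. P i m * X m l) = X i l" if "l < d" for i l
  proof -
    have "(\<Sum>m<d. P i m * X m l) = (\<Sum>m<d. \<Sum>k<d. X i k * (cnj (X m k) * X m l))"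
      by (simp add: P_def sum_distrib_right mult.assoc)
    also have "\<dots> = (\<Sum>k<d. X i k * (\<Sum>m<d. cnj (X m k) * X m l))"
      unfolding sum_distrib_left by (rule sum.swap)
    also have "\<dots> = (\<Sum>k<d. if k = l then X i k else 0)"
      using X that by (intro sum.cong refl) (simp add: unitary_mat_def)
    finally show ?thesis using that by simp
  qed
  have PP: "(\<Sum>m<d. P i m * P m j) = P i j" for i j
  proof -
    have "(\<Sum>m<d. P i m * P m j) = (\<Sum>m<d. \<Sum>k<d. P i m * X m k * cnj (X j k))"
      by (simp add: P_def[of _ j] sum_distrib_left mult.assoc)
    also have "\<dots> = (\<Sum>k<d. (\<Sum>m<d. P i m * X m k) * cnj (X j k))"
      unfolding sum_distrib_right by (rule sum.swap)
    also have "\<dots> = P i j" unfolding P_def[of i j] by (intro sum.cong refl) (simp add: PX)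
    finally show ?thesis .
  qed
  have RR: "(\<Sum>m<d. R i m * R m i) = R i i" if "i < d" for i
  proof -
    have "(\<Sum>m<d. R i m * R m i) = (\<Sum>m<d. (if m = i then 1 - 2 * P i i else 0) + P i m * P m i)"
      by (intro sum.cong refl) (auto simp: R_def algebra_simps)
    also have "\<dots> = 1 - 2 * P i i + P i i" using that by (simp add: sum.distrib PP)
    finally show ?thesis by (simp add: R_def)
  qed
  have "(\<Sum>i<d. \<Sum>m<d. complex_of_real ((cmod (R i m))\<^sup>2)) = (\<Sum>i<d. \<Sum>m<d. R i m * R m i)"
  proof (intro sum.cong refl)
    fix i m
    have "cnj (R i m) = R m i" by (simp add: R_def cP)
    then show "complex_of_real ((cmod (R i m))\<^sup>2) = R i m * R m i"
      using complex_norm_square[of "R i m"] by simp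
  qed
  also have "\<dots> = (\<Sum>i<d. 1 - P i i)" by (intro sum.cong refl) (simp add: RR R_def[of i i for i])
  also have "\<dots> = of_nat d - (\<Sum>i<d. P i i)" by (simp add: sum_subtractf)
  also have "(\<Sum>i<d. P i i) = (\<Sum>k<d. \<Sum>i<d. cnj (X i k) * X i k)"
    unfolding P_def by (subst sum.swap) (simp add: mult.commute)
  also have "\<dots> = of_nat d" using X by (simp add: unitary_mat_def)
  finally have "complex_of_real (\<Sum>i<d. \<Sum>m<d. (cmod (R i m))\<^sup>2) = 0" by simp
  then have "(\<Sum>i<d. \<Sum>m<d. (cmod (R i m))\<^sup>2) = 0" by (simp only: of_real_eq_0_iff)
  then have "(cmod (R i j))\<^sup>2 = 0"
    using ij by (simp add: sum_nonneg_eq_0_iff sum_nonneg)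
  then show ?thesis by (simp add: R_def P_def)
qed

lemma unitary_mat_transpose: "unitary_mat d X \<Longrightarrow> unitary_mat d (\<lambda>i j. X j i)"
proof -
  assume X: "unitary_mat d X"
  show ?thesis unfolding unitary_mat_def
  proof (intro allI impI)
    fix i j assume "i < d" "j < d"
    then show "(\<Sum>k<d. cnj (X i k) * X j k) = (if i = j then 1 else 0)"
      using unitary_rows[OF X, of j i] by (simp add: mult.commute eq_commute)
  qed
qed

lemma unitary_mat_cnj: "unitary_mat d X \<Longrightarrow> unitary_mat d (\<lambda>i j. cnj (X i j))"
proof -
  assume X: "unitary_mat d X"
  show ?thesis unfolding unitary_mat_def
  proof (intro allI impI)
    fix i j assume ij: "i < d" "j < d"
    have "(\<Sum>k<d. cnj (cnj (X k i)) * cnj (X k j)) = cnj (\<Sum>k<d. cnj (X k i) * X k j)" by simp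
    also have "\<dots> = (if i = j then 1 else 0)" using X ij by (simp add: unitary_mat_def)
    finally show "(\<Sum>k<d. cnj (cnj (X k i)) * cnj (X k j)) = (if i = j then 1 else 0)" .
  qed
qed

lemma unitary_mat_id: "unitary_mat d (\<lambda>i j. if i = j then 1 else 0)"
  unfolding unitary_mat_def
proof (intro allI impI)
  fix i j assume "i < d" "j < d"
  have "(\<Sum>k<d. cnj (if k = i then 1 else 0) * (if k = j then 1 else 0)) = (\<Sum>k<d. if k = i then if i = j then 1 else 0 else (0::complex))"
    by (intro sum.cong refl) auto
  then show "(\<Sum>k<d. cnj (if k = i then 1 else 0) * (if k = j then 1 else 0)) = (if i = j then 1 else (0::complex))"
    using \<open>i < d\<close> by simp
qed

definition is_svd :: "nat \<Rightarrow> (nat \<Rightarrow> nat \<Rightarrow> complex) \<Rightarrow> (nat \<Rightarrow> nat \<Rightarrow> complex) \<Rightarrow> (nat \<Rightarrow> nat \<Rightarrow> complex) \<Rightarrow> (nat \<Rightarrow> real) \<Rightarrow> bool" where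
  "is_svd d A X Y \<sigma> \<longleftrightarrow> unitary_mat d X \<and> unitary_mat d Y \<and> (\<forall>k<d. \<sigma> k \<ge> 0) \<and>
      (\<forall>i<d. \<forall>j<d. A i j = (\<Sum>k<d. X i k * complex_of_real (\<sigma> k) * Y k j))"

text \<open>The inner sums are the coordinates of the transpose of \<open>V\<close> applied to
  column \<open>l\<close> of \<open>X\<close>, a unit vector moved by a unitary.\<close>

lemma unitary_combination_norm:
  assumes X: "unitary_mat d X" and V: "unitary_mat d V" and l: "l < d"
  shows "(\<Sum>k<d. (cmod (\<Sum>i<d. X i l * V i k))\<^sup>2) = 1"
proof -
  have "complex_of_real (\<Sum>k<d. (cmod (\<Sum>i<d. X i l * V i k))\<^sup>2)
      = (\<Sum>k<d. (\<Sum>i<d. X i l * V i k) * cnj (\<Sum>j<d. X j l * V j k))"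
    unfolding of_real_sum by (intro sum.cong refl) (rule complex_norm_square)
  also have "\<dots> = (\<Sum>k<d. \<Sum>i<d. \<Sum>j<d. X i l * cnj (X j l) * (V i k * cnj (V j k)))"
    by (simp add: sum_product mult_ac)
  also have "\<dots> = (\<Sum>i<d. \<Sum>j<d. X i l * cnj (X j l) * (\<Sum>k<d. V i k * cnj (V j k)))"
    unfolding sum_distrib_left by (subst sum.swap, rule sum.cong[OF refl], rule sum.swap)
  also have "\<dots> = (\<Sum>i<d. \<Sum>j<d. if i = j then X i l * cnj (X j l) else 0)"
    by (intro sum.cong refl) (simp add: unitary_rows[OF V])
  also have "\<dots> = (\<Sum>i<d. cnj (X i l) * X i l)" by (simp add: mult.commute)
  also have "\<dots> = 1" using X l by (simp add: unitary_mat_def)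
  finally show ?thesis by (simp only: of_real_eq_1_iff)
qed

text \<open>Trace duality: pairing with a matrix \<open>V D W\<close> of operator norm at most
  \<open>b\<close> costs at most \<open>b\<close> times the sum of the singular values. After
  inserting the decomposition of \<open>A\<close>, the factor at \<open>\<sigma> l\<close> pairs two
  unit vectors with weights \<open>D\<close>, and the arithmetic-geometric mean inequality bounds it
  by \<open>b\<close>.\<close>

lemma svd_pairing_bound:
  assumes A: "is_svd d A X Y \<sigma>" and V: "unitary_mat d V" and W: "unitary_mat d W"
    and D: "\<And>k. k < d \<Longrightarrow> cmod (D k) \<le> b"
  shows "cmod (\<Sum>i<d. \<Sum>j<d. A i j * (\<Sum>k<d. V i k * D k * W k j)) \<le> b * (\<Sum>k<d. \<sigma> k)"
proof -
  define \<alpha> where "\<alpha> l k = (\<Sum>i<d. X i l * V i k)" for l k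
  define \<gamma> where "\<gamma> l k = (\<Sum>j<d. Y l j * W k j)" for l k
  have X: "unitary_mat d X" and Y: "unitary_mat d Y" and \<sigma>: "\<And>k. k < d \<Longrightarrow> \<sigma> k \<ge> 0"
    and Aeq: "\<And>i j. i < d \<Longrightarrow> j < d \<Longrightarrow> A i j = (\<Sum>k<d. X i k * complex_of_real (\<sigma> k) * Y k j)"
    using A by (auto simp: is_svd_def)
  have a1: "(\<Sum>k<d. (cmod (\<alpha> l k))\<^sup>2) = 1" if "l < d" for l
    unfolding \<alpha>_def by (rule unitary_combination_norm[OF X V that])
  have g1: "(\<Sum>k<d. (cmod (\<gamma> l k))\<^sup>2) = 1" if "l < d" for l
    unfolding \<gamma>_def using unitary_combination_norm[OF unitary_mat_transpose[OF Y] unitary_mat_transpose[OF W] that] .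
  have "(\<Sum>i<d. \<Sum>j<d. A i j * (\<Sum>k<d. V i k * D k * W k j))
     = (\<Sum>i<d. \<Sum>j<d. \<Sum>l<d. \<Sum>k<d. complex_of_real (\<sigma> l) * (D k * ((X i l * V i k) * (Y l j * W k j))))"
  proof (intro sum.cong refl)
    fix i j assume "i \<in> {..<d}" "j \<in> {..<d}"
    then have "A i j = (\<Sum>k<d. X i k * complex_of_real (\<sigma> k) * Y k j)" by (simp add: Aeq)
    then show "A i j * (\<Sum>k<d. V i k * D k * W k j)
      = (\<Sum>l<d. \<Sum>k<d. complex_of_real (\<sigma> l) * (D k * ((X i l * V i k) * (Y l j * W k j))))"
      by (simp only: sum_product) (simp only: mult_ac)
  qed
  also have "\<dots> = (\<Sum>l<d. \<Sum>k<d. \<Sum>i<d. \<Sum>j<d. complex_of_real (\<sigma> l) * (D k * ((X i l * V i k) * (Y l j * W k j))))"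
    by (rule sum_swap4)
  also have "\<dots> = (\<Sum>l<d. complex_of_real (\<sigma> l) * (\<Sum>k<d. D k * (\<alpha> l k * \<gamma> l k)))"
    by (simp only: \<alpha>_def \<gamma>_def sum_product) (simp only: sum_distrib_left)
  finally have eq: "(\<Sum>i<d. \<Sum>j<d. A i j * (\<Sum>k<d. V i k * D k * W k j))
    = (\<Sum>l<d. complex_of_real (\<sigma> l) * (\<Sum>k<d. D k * (\<alpha> l k * \<gamma> l k)))" .
  have "cmod (\<Sum>l<d. complex_of_real (\<sigma> l) * (\<Sum>k<d. D k * (\<alpha> l k * \<gamma> l k))) \<le> (\<Sum>l<d. \<sigma> l * b)"
  proof (rule sum_norm_le)
    fix l assume l: "l \<in> {..<d}"
    have "cmod (\<Sum>k<d. D k * (\<alpha> l k * \<gamma> l k)) \<le> (\<Sum>k<d. b * (((cmod (\<alpha> l k))\<^sup>2 + (cmod (\<gamma> l k))\<^sup>2) / 2))"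
    proof (rule sum_norm_le)
      fix k assume k: "k \<in> {..<d}"
      have b0: "0 \<le> b" using D[of k] k norm_ge_zero order.trans by blast
      have "cmod (\<alpha> l k) * cmod (\<gamma> l k) \<le> ((cmod (\<alpha> l k))\<^sup>2 + (cmod (\<gamma> l k))\<^sup>2) / 2"
        using sum_squares_bound[of "cmod (\<alpha> l k)" "cmod (\<gamma> l k)"] by simp
      then show "cmod (D k * (\<alpha> l k * \<gamma> l k)) \<le> b * (((cmod (\<alpha> l k))\<^sup>2 + (cmod (\<gamma> l k))\<^sup>2) / 2)"
        unfolding norm_mult using D[of k] k b0 by (intro mult_mono) auto
    qed
    also have "\<dots> = b * (((\<Sum>k<d. (cmod (\<alpha> l k))\<^sup>2) + (\<Sum>k<d. (cmod (\<gamma> l k))\<^sup>2)) / 2)"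
      by (simp only: sum_distrib_left[symmetric] sum_divide_distrib[symmetric] sum.distrib)
    also have "\<dots> = b" using a1 g1 l by simp
    finally have "cmod (\<Sum>k<d. D k * (\<alpha> l k * \<gamma> l k)) \<le> b" .
    then show "cmod (complex_of_real (\<sigma> l) * (\<Sum>k<d. D k * (\<alpha> l k * \<gamma> l k))) \<le> \<sigma> l * b"
      unfolding norm_mult using \<sigma>[of l] l by (intro mult_mono) auto
  qed
  also have "\<dots> = b * (\<Sum>k<d. \<sigma> k)" by (simp add: sum_distrib_left mult.commute)
  finally show ?thesis unfolding eq .
qed

text \<open>Pairing \<open>A\<close> with the product of the conjugates of \<open>X\<close> and
  \<open>Y\<close> returns the whole sum of \<open>\<sigma>\<close>, and the pairing bound for the
  other decomposition caps it by the sum of \<open>\<sigma>'\<close>.\<close>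

lemma svd_sum_le:
  assumes A: "is_svd d A X Y \<sigma>" and A': "is_svd d A X' Y' \<sigma>'"
  shows "(\<Sum>k<d. \<sigma> k) \<le> (\<Sum>k<d. \<sigma>' k)"
proof -
  have X: "unitary_mat d X" and Y: "unitary_mat d Y" and \<sigma>: "\<And>k. k < d \<Longrightarrow> \<sigma> k \<ge> 0"
    and Aeq: "\<And>i j. i < d \<Longrightarrow> j < d \<Longrightarrow> A i j = (\<Sum>k<d. X i k * complex_of_real (\<sigma> k) * Y k j)"
    using A by (auto simp: is_svd_def)
  have "(\<Sum>i<d. \<Sum>j<d. A i j * (\<Sum>k<d. cnj (X i k) * 1 * cnj (Y k j)))
     = (\<Sum>i<d. \<Sum>j<d. \<Sum>k<d. A i j * (cnj (X i k) * cnj (Y k j)))"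
    by (simp add: sum_distrib_left)
  also have "\<dots> = (\<Sum>k<d. \<Sum>i<d. \<Sum>j<d. A i j * (cnj (X i k) * cnj (Y k j)))"
    by (rule trans[OF sum.cong[OF refl sum.swap] sum.swap])
  also have "\<dots> = (\<Sum>k<d. complex_of_real (\<sigma> k))"
  proof (intro sum.cong refl)
    fix k assume k: "k \<in> {..<d}"
    have "(\<Sum>i<d. \<Sum>j<d. A i j * (cnj (X i k) * cnj (Y k j)))
      = (\<Sum>i<d. \<Sum>j<d. \<Sum>l<d. complex_of_real (\<sigma> l) * ((cnj (X i k) * X i l) * (Y l j * cnj (Y k j))))"
      by (intro sum.cong refl) (simp add: Aeq sum_distrib_left sum_distrib_right mult_ac)
    also have "\<dots> = (\<Sum>l<d. \<Sum>i<d. \<Sum>j<d. complex_of_real (\<sigma> l) * ((cnj (X i k) * X i l) * (Y l j * cnj (Y k j))))"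
      by (rule trans[OF sum.cong[OF refl sum.swap] sum.swap])
    also have "\<dots> = (\<Sum>l<d. complex_of_real (\<sigma> l) * ((\<Sum>i<d. cnj (X i k) * X i l) * (\<Sum>j<d. Y l j * cnj (Y k j))))"
      by (simp only: sum_product) (simp only: sum_distrib_left)
    also have "\<dots> = (\<Sum>l<d. if l = k then complex_of_real (\<sigma> l) else 0)"
      using X k by (intro sum.cong refl) (auto simp: unitary_mat_def unitary_rows[OF Y])
    also have "\<dots> = complex_of_real (\<sigma> k)" using k by simp
    finally show "(\<Sum>i<d. \<Sum>j<d. A i j * (cnj (X i k) * cnj (Y k j))) = complex_of_real (\<sigma> k)" .
  qed
  finally have "cmod (complex_of_real (\<Sum>k<d. \<sigma> k)) \<le> 1 * (\<Sum>k<d. \<sigma>' k)"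
    using svd_pairing_bound[OF A' unitary_mat_cnj[OF X] unitary_mat_cnj[OF Y], of "\<lambda>k. 1" 1] by simp
  then have "\<bar>\<Sum>k<d. \<sigma> k\<bar> \<le> (\<Sum>k<d. \<sigma>' k)" by (simp only: norm_of_real mult_1)
  then show ?thesis by simp
qed

text \<open>\<open>svd_sum_le\<close> in both directions gives the uniqueness that the definite
  description asks for; \<open>ex_svd\<close> supplies existence.\<close>

lemma trace_norm_eq:
  assumes "is_svd d A X Y \<sigma>" shows "trace_norm d A = (\<Sum>k<d. \<sigma> k)"
proof -
  have "trace_norm d A = (THE t. \<exists>X Y \<sigma>. is_svd d A X Y \<sigma> \<and> t = (\<Sum>k<d. \<sigma> k))"
    unfolding trace_norm_def is_svd_def by (simp only: conj_assoc)
  also have "\<dots> = (\<Sum>k<d. \<sigma> k)"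
  proof (rule the_equality)
    show "\<exists>X Y \<sigma>'. is_svd d A X Y \<sigma>' \<and> (\<Sum>k<d. \<sigma> k) = (\<Sum>k<d. \<sigma>' k)" using assms by blast
    fix t assume "\<exists>X Y \<sigma>. is_svd d A X Y \<sigma> \<and> t = (\<Sum>k<d. \<sigma> k)"
    then obtain X' Y' \<sigma>' where "is_svd d A X' Y' \<sigma>'" "t = (\<Sum>k<d. \<sigma>' k)" by blast
    then show "t = (\<Sum>k<d. \<sigma> k)" using svd_sum_le assms by (metis order.antisym)
  qed
  finally show ?thesis .
qed

section \<open>Existence of singular value decompositions\<close>

definition rot :: "nat \<Rightarrow> nat \<Rightarrow> complex \<Rightarrow> complex \<Rightarrow> (nat \<Rightarrow> nat \<Rightarrow> complex) \<Rightarrow> nat \<Rightarrow> nat \<Rightarrow> complex" where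
  "rot p r c s X = X(p := (\<lambda>j. c * X p j - s * X r j), r := (\<lambda>j. cnj s * X p j + c * X r j))"

lemma sum_remove_two:
  fixes g :: "nat \<Rightarrow> 'a :: comm_monoid_add"
  assumes "p < d" "r < d" "p \<noteq> r"
  shows "(\<Sum>k<d. g k) = g p + g r + (\<Sum>k\<in>{..<d} - {p, r}. g k)"
proof -
  have "{..<d} - {p, r} = {..<d} - {p} - {r}" by blast
  then show ?thesis
    using sum.remove[of "{..<d}" p g] sum.remove[of "{..<d} - {p}" r g] assms by (simp add: add.assoc)
qed

lemma unitary_rot:
  assumes X: "unitary_mat d X" and pr: "p < d" "r < d" "p \<noteq> r"
    and cs: "cnj c = c" "c * c + s * cnj s = 1"
  shows "unitary_mat d (rot p r c s X)"
  unfolding unitary_mat_def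
proof (intro allI impI)
  fix i j assume ij: "i < d" "j < d"
  let ?X = "rot p r c s X"
  have "cnj (?X p i) * ?X p j + cnj (?X r i) * ?X r j
    = (c * c + s * cnj s) * (cnj (X p i) * X p j + cnj (X r i) * X r j)"
    using pr cs(1) by (simp add: rot_def algebra_simps)
  then have 1: "cnj (?X p i) * ?X p j + cnj (?X r i) * ?X r j = cnj (X p i) * X p j + cnj (X r i) * X r j"
    using cs by simp
  have "(\<Sum>k<d. cnj (?X k i) * ?X k j) = (\<Sum>k<d. cnj (X k i) * X k j)"
    unfolding sum_remove_two[OF pr] 1 by (intro arg_cong2[of _ _ _ _ "(+)"] sum.cong) (auto simp: rot_def)
  then show "(\<Sum>k<d. cnj (?X k i) * ?X k j) = (if i = j then 1 else 0)"
    using X ij by (simp add: unitary_mat_def)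
qed

definition bil :: "nat \<Rightarrow> (nat \<Rightarrow> nat \<Rightarrow> complex) \<Rightarrow> (nat \<Rightarrow> nat \<Rightarrow> complex) \<Rightarrow> (nat \<Rightarrow> nat \<Rightarrow> complex) \<Rightarrow> nat \<Rightarrow> nat \<Rightarrow> complex" where
  "bil d A X Z k l = (\<Sum>i<d. \<Sum>j<d. X k i * A i j * Z l j)"

text \<open>A trace with pairwise distinct weights \<open>Suc k\<close>. With equal weights the
  first-order conditions would only make the matrix hermitian.\<close>

definition wre :: "nat \<Rightarrow> (nat \<Rightarrow> nat \<Rightarrow> complex) \<Rightarrow> (nat \<Rightarrow> nat \<Rightarrow> complex) \<Rightarrow> (nat \<Rightarrow> nat \<Rightarrow> complex) \<Rightarrow> real" where
  "wre d A X Z = (\<Sum>k<d. real (Suc k) * Re (bil d A X Z k k))"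

lemma bil_transpose: "bil d (\<lambda>i j. A j i) Z X l k = bil d A X Z k l"
  unfolding bil_def by (subst sum.swap) (simp add: mult_ac)

lemma bil_rot:
  assumes "p \<noteq> r"
  shows "bil d A (rot p r c s X) Z p l = c * bil d A X Z p l - s * bil d A X Z r l"
    "bil d A (rot p r c s X) Z r l = cnj s * bil d A X Z p l + c * bil d A X Z r l"
    "k \<noteq> p \<Longrightarrow> k \<noteq> r \<Longrightarrow> bil d A (rot p r c s X) Z k l = bil d A X Z k l"
  using assms
  by (simp_all add: bil_def rot_def distrib_right left_diff_distrib sum.distrib sum_subtractf sum_distrib_left mult.assoc)

text \<open>First-order condition at a maximum. Let \<open>\<kappa>\<close> be the difference of the
  two sides; rotating rows \<open>p\<close> and \<open>r\<close> by a small angle with a suitable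
  phase increases \<open>wre\<close> to first order by a positive multiple of
  \<open>cmod \<kappa>\<close>.\<close>

lemma maximal_rot:
  assumes X: "unitary_mat d X" and pr: "p < d" "r < d" "p \<noteq> r"
    and mx: "\<And>X'. unitary_mat d X' \<Longrightarrow> wre d A X' Z \<le> wre d A X Z"
  shows "of_nat (Suc r) * cnj (bil d A X Z p r) = of_nat (Suc p) * bil d A X Z r p"
proof (rule ccontr)
  define B where "B = bil d A X Z"
  define \<kappa> where "\<kappa> = of_nat (Suc r) * cnj (B p r) - of_nat (Suc p) * B r p"
  define \<alpha> where "\<alpha> = real (Suc p) * Re (B p p) + real (Suc r) * Re (B r r)"
  assume "\<not> ?thesis"
  then have m: "cmod \<kappa> > 0" by (simp add: \<kappa>_def B_def)
  \<comment> \<open>The phase that makes the first-order term real and positive.\<close>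
  define u where "u = cnj \<kappa> / cmod \<kappa>"
  have u: "u * \<kappa> = cmod \<kappa>" "cmod u = 1"
    using m complex_norm_square[of \<kappa>] by (simp_all add: u_def norm_divide power2_eq_square mult.commute divide_eq_eq)
  have key: "cmod \<kappa> \<le> t * \<alpha>" if t: "t > 0" for t
  proof -
    \<comment> \<open>Rational parametrisation of the circle. It turns maximality into
      \<open>2 * t * (cmod \<kappa> - t * \<alpha>) \<le> 0\<close>, and a small \<open>t\<close>
      then gives the contradiction.\<close>
    define c where "c = (1 - t\<^sup>2) / (1 + t\<^sup>2)"
    define e where "e = 2 * t / (1 + t\<^sup>2)"
    have t1: "1 + t\<^sup>2 > 0" by (simp add: add_pos_nonneg)
    have "c * c + e * e = ((1 - t\<^sup>2) * (1 - t\<^sup>2) + (2 * t) * (2 * t)) / ((1 + t\<^sup>2) * (1 + t\<^sup>2))"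
      by (simp add: c_def e_def add_divide_distrib)
    also have "(1 - t\<^sup>2) * (1 - t\<^sup>2) + (2 * t) * (2 * t) = (1 + t\<^sup>2) * (1 + t\<^sup>2)"
      by (simp add: algebra_simps power2_eq_square)
    finally have ce: "c * c + e * e = 1" using t1 by simp
    define s where "s = complex_of_real e * u"
    have uu: "u * cnj u = 1" using u(2) complex_norm_square[of u] by simp
    have "complex_of_real c * complex_of_real c + s * cnj s = complex_of_real (c * c + e * e)"
      using uu by (simp add: s_def algebra_simps)
    then have "complex_of_real c * complex_of_real c + s * cnj s = 1" using ce by simp
    then have "unitary_mat d (rot p r (complex_of_real c) s X)"
      by (intro unitary_rot X pr) auto
    from mx[OF this] have le: "wre d A (rot p r (complex_of_real c) s X) Z \<le> wre d A X Z" .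
    have "wre d A (rot p r (complex_of_real c) s X) Z - wre d A X Z
      = real (Suc p) * Re (c * B p p - s * B r p) + real (Suc r) * Re (cnj s * B p r + c * B r r) - \<alpha>"
      unfolding wre_def sum_remove_two[OF pr] using pr(3)
      by (simp add: bil_rot B_def \<alpha>_def del: minus_complex.sel plus_complex.sel of_nat_Suc)
    also have "\<dots> = (c - 1) * \<alpha> + Re (s * \<kappa>)"
      by (simp add: \<alpha>_def \<kappa>_def algebra_simps)
    also have "Re (s * \<kappa>) = e * cmod \<kappa>" using u(1) by (simp add: s_def mult.assoc)
    finally have "(c - 1) * \<alpha> + e * cmod \<kappa> \<le> 0" using le by simp
    then have "((c - 1) * \<alpha> + e * cmod \<kappa>) * (1 + t\<^sup>2) \<le> 0" using t1 by (simp add: mult_nonpos_nonneg)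
    also have "((c - 1) * \<alpha> + e * cmod \<kappa>) * (1 + t\<^sup>2) = 2 * t * (cmod \<kappa> - t * \<alpha>)"
    proof -
      have ce1: "c * (1 + t\<^sup>2) = 1 - t\<^sup>2" "e * (1 + t\<^sup>2) = 2 * t" using t1 by (simp_all add: c_def e_def)
      have eq: "((c - 1) * \<alpha> + e * cmod \<kappa>) * (1 + t\<^sup>2)
          = (c * (1 + t\<^sup>2) - (1 + t\<^sup>2)) * \<alpha> + e * (1 + t\<^sup>2) * cmod \<kappa>"
        by (simp only: algebra_simps)
      show ?thesis unfolding eq ce1 by (simp add: algebra_simps power2_eq_square)
    qed
    finally show ?thesis using t by (simp add: mult_le_0_iff)
  qed
  show False
  proof (cases "\<alpha> \<le> 0")
    case True
    then show False using key[of 1] m by simp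
  next
    case False
    then show False using key[of "cmod \<kappa> / (2 * \<alpha>)"] m by (simp add: field_simps)
  qed
qed

text \<open>Multiplying one row by a phase keeps \<open>X\<close> unitary, so at a maximum the real
  part of a diagonal entry already equals its modulus.\<close>

lemma maximal_phase:
  assumes X: "unitary_mat d X" and p: "p < d"
    and mx: "\<And>X'. unitary_mat d X' \<Longrightarrow> wre d A X' Z \<le> wre d A X Z"
  shows "bil d A X Z p p = complex_of_real (cmod (bil d A X Z p p))"
proof -
  define b where "b = bil d A X Z p p"
  define u where "u = (if b = 0 then 1 else cnj b / cmod b)"
  have u: "u * b = cmod b" "u * cnj u = 1"
    using complex_norm_square[of b] by (auto simp: u_def power2_eq_square mult.commute divide_eq_eq)
  let ?X = "X(p := (\<lambda>j. u * X p j))"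
  have "unitary_mat d ?X" unfolding unitary_mat_def
  proof (intro allI impI)
    fix i j assume ij: "i < d" "j < d"
    have "(\<Sum>k<d. cnj (?X k i) * ?X k j) = (\<Sum>k<d. cnj (X k i) * X k j)"
    proof (intro sum.cong refl)
      fix k
      have "cnj (u * X p i) * (u * X p j) = (u * cnj u) * (cnj (X p i) * X p j)" by (simp add: mult_ac)
      then show "cnj (?X k i) * ?X k j = cnj (X k i) * X k j" using u(2) by simp
    qed
    then show "(\<Sum>k<d. cnj (?X k i) * ?X k j) = (if i = j then 1 else 0)"
      using X ij by (simp add: unitary_mat_def)
  qed
  from mx[OF this] have "wre d A ?X Z \<le> wre d A X Z" .
  moreover have "bil d A ?X Z k k = (if k = p then u * b else bil d A X Z k k)" for k
    by (auto simp: bil_def b_def sum_distrib_left mult.assoc)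
  then have "wre d A ?X Z = real (Suc p) * cmod b + (\<Sum>k\<in>{..<d} - {p}. real (Suc k) * Re (bil d A X Z k k))"
    unfolding wre_def using p u(1) by (subst sum.remove[of _ p]) auto
  moreover have "wre d A X Z = real (Suc p) * Re b + (\<Sum>k\<in>{..<d} - {p}. real (Suc k) * Re (bil d A X Z k k))"
    unfolding wre_def using p by (subst sum.remove[of _ p]) (auto simp: b_def)
  ultimately have "real (Suc p) * cmod b \<le> real (Suc p) * Re b" by simp
  then have "cmod b \<le> Re b" by (simp add: mult_le_cancel_left_pos del: of_nat_Suc)
  then have "Re b = cmod b" using complex_Re_le_cmod[of b] by simp
  moreover from this have "Im b = 0" using cmod_power2[of b] by simp
  ultimately show ?thesis unfolding b_def[symmetric] by (simp add: complex_eq_iff)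
qed

lemma compact_Pi_UNIV:
  fixes S :: "'i \<Rightarrow> 'b :: topological_space set"
  assumes "\<And>i. compact (S i)" shows "compact (Pi UNIV S)"
proof -
  have "compactin (product_topology (\<lambda>_. euclidean) UNIV) (PiE UNIV S)"
    using assms by (subst compactin_PiE) auto
  then show ?thesis by (simp add: euclidean_product_topology PiE_UNIV_domain)
qed

lemma continuous_entry: "continuous_on UNIV (\<lambda>X :: nat \<Rightarrow> nat \<Rightarrow> complex. X i j)"
  by (rule continuous_on_compose2[OF continuous_on_product_coordinates[of j] continuous_on_product_coordinates[of i]]) auto

text \<open>Maximise \<open>\<Sum>k. (k + 1) Re B\<^sub>k\<^sub>k\<close> for \<open>B = X A Z\<^sup>T\<close> over unitary \<open>X\<close>, \<open>Z\<close>. Plane rotations of the rows of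
  \<open>X\<close> and of \<open>Z\<close> give two linear equations for \<open>B\<^sub>r\<^sub>s\<close> and the conjugate of \<open>B\<^sub>s\<^sub>r\<close>; because the weights are
  distinct, both entries vanish.\<close>
lemma ex_svd: "\<exists>X Y \<sigma>. is_svd d A X Y \<sigma>"
proof -
  \<comment> \<open>\<open>unitary_mat\<close> constrains only indices below \<open>d\<close>. For
    compactness all entries are confined to the unit disc; \<open>cut\<close> brings any unitary
    matrix into \<open>S\<close> by zeroing the entries outside the block, which leaves
    \<open>wre\<close> unchanged.\<close>
  define S where "S = Pi UNIV (\<lambda>i::nat. Pi UNIV (\<lambda>j::nat. cball (0::complex) 1)) \<inter> {X. unitary_mat d X}"
  have "closed {X :: nat \<Rightarrow> nat \<Rightarrow> complex. unitary_mat d X}"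
    unfolding unitary_mat_def
    by (intro closed_Collect_all closed_Collect_imp closed_Collect_eq open_Collect_const continuous_intros continuous_entry)
  then have cS: "compact S" unfolding S_def
    by (intro compact_Int_closed compact_Pi_UNIV compact_cball)
  have small: "cmod (X k i) \<le> 1" if X: "unitary_mat d X" and ki: "k < d" "i < d" for X :: "nat \<Rightarrow> nat \<Rightarrow> complex" and k i
  proof -
    have "complex_of_real (\<Sum>k<d. (cmod (X k i))\<^sup>2) = (\<Sum>k<d. cnj (X k i) * X k i)"
      unfolding of_real_sum by (intro sum.cong refl) (metis complex_norm_square mult.commute)
    also have "\<dots> = 1" using X ki by (simp add: unitary_mat_def)
    finally have "(\<Sum>k<d. (cmod (X k i))\<^sup>2) = 1" by (simp only: of_real_eq_1_iff)
    then have "(cmod (X k i))\<^sup>2 \<le> 1"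
      using member_le_sum[of k "{..<d}" "\<lambda>k. (cmod (X k i))\<^sup>2"] ki by simp
    then show ?thesis by (simp add: power_le_one_iff abs_square_le_1)
  qed
  define cut where "cut X = (\<lambda>i j. if i < d \<and> j < d then X i j else 0)" for X :: "nat \<Rightarrow> nat \<Rightarrow> complex"
  have cutS: "cut X \<in> S" if "unitary_mat d X" for X
    using that small[OF that] unfolding S_def by (auto simp: cut_def unitary_mat_def)
  have wcut: "wre d A (cut X) (cut Z) = wre d A X Z" for X Z
    unfolding wre_def bil_def by (intro sum.cong refl arg_cong2[of _ _ _ _ "(*)"] arg_cong[of _ _ Re]) (auto simp: cut_def)
  have ne: "S \<noteq> {}" using cutS[OF unitary_mat_id] by blast
  have cont: "continuous_on (S \<times> S) (\<lambda>p. wre d A (fst p) (snd p))"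
    unfolding wre_def bil_def
    by (intro continuous_intros continuous_on_compose2[OF continuous_entry]) auto
  have "S \<times> S \<noteq> {}" using ne by simp
  from continuous_attains_sup[OF compact_Times[OF cS cS] this cont]
  obtain p where p: "p \<in> S \<times> S" "\<And>p'. p' \<in> S \<times> S \<Longrightarrow> wre d A (fst p') (snd p') \<le> wre d A (fst p) (snd p)"
    by blast
  define X Z where "X = fst p" and "Z = snd p"
  have X: "unitary_mat d X" and Z: "unitary_mat d Z" using p(1) by (auto simp: S_def X_def Z_def)
  have mx: "wre d A X' Z' \<le> wre d A X Z" if "unitary_mat d X'" "unitary_mat d Z'" for X' Z'
    using p(2)[of "(cut X', cut Z')"] cutS that by (simp add: wcut X_def Z_def)
  define B where "B = bil d A X Z"
  have off: "B r s = 0" if rs: "r < d" "s < d" "r \<noteq> s" for r s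
  proof -
    have 1: "of_nat (Suc r) * cnj (B s r) = of_nat (Suc s) * B r s"
      unfolding B_def using rs by (intro maximal_rot X mx Z) auto
    have "of_nat (Suc r) * cnj (bil d (\<lambda>i j. A j i) Z X s r) = of_nat (Suc s) * bil d (\<lambda>i j. A j i) Z X r s"
    proof (rule maximal_rot[OF Z])
      fix Z' assume "unitary_mat d Z'"
      then have "wre d A X Z' \<le> wre d A X Z" by (intro mx X)
      then show "wre d (\<lambda>i j. A j i) Z' X \<le> wre d (\<lambda>i j. A j i) Z X"
        by (simp add: wre_def bil_transpose[of d A])
    qed (use rs in auto)
    then have 2: "of_nat (Suc r) * cnj (B r s) = of_nat (Suc s) * B s r"
      by (simp add: bil_transpose[of d A] B_def)
    have "of_nat (Suc s) * cnj (B s r) = of_nat (Suc r) * B r s"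
      using arg_cong[OF 2, of cnj] by simp
    then have "of_nat (Suc r) * (of_nat (Suc r) * B r s) = of_nat (Suc s) * (of_nat (Suc r) * cnj (B s r))"
      by (simp only: mult_ac)
    also have "\<dots> = of_nat (Suc s) * (of_nat (Suc s) * B r s)" by (simp only: 1)
    finally have "(of_nat (Suc r * Suc r) - of_nat (Suc s * Suc s)) * B r s = 0"
      by (simp only: of_nat_mult left_diff_distrib mult.assoc) simp
    moreover have "Suc r * Suc r \<noteq> Suc s * Suc s"
      using rs(3) by (metis Suc_inject nat_power_eq_Suc_0_iff power2_eq_iff_nonneg power2_eq_square zero_le)
    then have "(of_nat (Suc r * Suc r) - of_nat (Suc s * Suc s) :: complex) \<noteq> 0"
      by (simp only: right_minus_eq of_nat_eq_iff not_False_eq_True)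
    ultimately show ?thesis by (simp only: mult_eq_0_iff) simp
  qed
  have diag: "B k k = complex_of_real (cmod (B k k))" if "k < d" for k
    unfolding B_def using that by (intro maximal_phase X mx Z) auto
  define \<sigma> where "\<sigma> k = cmod (B k k)" for k
  have Beq: "B k l = (if k = l then complex_of_real (\<sigma> k) else 0)" if "k < d" "l < d" for k l
    using off diag that by (auto simp: \<sigma>_def)
  have "is_svd d A (\<lambda>i k. cnj (X k i)) (\<lambda>k j. cnj (Z k j)) \<sigma>"
    unfolding is_svd_def
  proof (intro conjI allI impI)
    show "unitary_mat d (\<lambda>i k. cnj (X k i))" by (rule unitary_mat_cnj[OF unitary_mat_transpose[OF X]])
    show "unitary_mat d (\<lambda>k j. cnj (Z k j))" by (rule unitary_mat_cnj[OF Z])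
    show "0 \<le> \<sigma> k" for k by (simp add: \<sigma>_def)
    fix i j assume ij: "i < d" "j < d"
    have "(\<Sum>k<d. cnj (X k i) * complex_of_real (\<sigma> k) * cnj (Z k j)) = (\<Sum>k<d. \<Sum>l<d. cnj (X k i) * B k l * cnj (Z l j))"
    proof (intro sum.cong refl)
      fix k assume k: "k \<in> {..<d}"
      have "(\<Sum>l<d. cnj (X k i) * B k l * cnj (Z l j)) = (\<Sum>l<d. if l = k then cnj (X k i) * complex_of_real (\<sigma> k) * cnj (Z k j) else 0)"
        using k by (intro sum.cong refl) (auto simp: Beq)
      then show "cnj (X k i) * complex_of_real (\<sigma> k) * cnj (Z k j) = (\<Sum>l<d. cnj (X k i) * B k l * cnj (Z l j))"
        using k by simp
    qed
    also have "\<dots> = (\<Sum>k<d. \<Sum>l<d. \<Sum>a<d. \<Sum>b<d. A a b * ((cnj (X k i) * X k a) * (cnj (Z l j) * Z l b)))"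
      unfolding B_def bil_def by (simp add: sum_distrib_left sum_distrib_right mult_ac)
    also have "\<dots> = (\<Sum>a<d. \<Sum>b<d. \<Sum>k<d. \<Sum>l<d. A a b * ((cnj (X k i) * X k a) * (cnj (Z l j) * Z l b)))"
      by (rule sum_swap4)
    also have "\<dots> = (\<Sum>a<d. \<Sum>b<d. A a b * ((\<Sum>k<d. cnj (X k i) * X k a) * (\<Sum>l<d. cnj (Z l j) * Z l b)))"
      by (simp only: sum_product) (simp only: sum_distrib_left)
    also have "\<dots> = (\<Sum>a<d. \<Sum>b<d. if b = j then (if a = i then A a b else 0) else 0)"
      using X Z ij by (intro sum.cong refl) (auto simp: unitary_mat_def)
    also have "\<dots> = A i j" using ij by simp
    finally show "A i j = (\<Sum>k<d. cnj (X k i) * complex_of_real (\<sigma> k) * cnj (Z k j))" by simp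
  qed
  then show ?thesis by blast
qed

section \<open>Torus functionals and skew derivations\<close>

lemma ev_swap: "ev (\<lambda>a. ev (\<lambda>b. f a b) y) x = ev (\<lambda>b. ev (\<lambda>a. f a b) x) y"
  unfolding ev_def sum_distrib_left by (subst sum.swap) (simp add: mult_ac)

lemma lin_FS [intro]: "(\<And>a. T a \<in> FS) \<Longrightarrow> lin T x \<in> FS"
  unfolding FS_eq_fsupp by (rule lin_fsupp)

lemma lin_FS_add: "x \<in> FS \<Longrightarrow> y \<in> FS \<Longrightarrow> lin T (x + y) = lin T x + lin T y"
  and lin_FS_diff: "x \<in> FS \<Longrightarrow> y \<in> FS \<Longrightarrow> lin T (x - y) = lin T x - lin T y"
  and lin_FS_sum: "(\<And>i. i \<in> I \<Longrightarrow> F i \<in> FS) \<Longrightarrow> lin T (sum F I) = (\<Sum>i\<in>I. lin T (F i))"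
  unfolding FS_eq_fsupp by (simp_all only: lin_add lin_diff lin_sum)

fun wt1 :: "gen \<Rightarrow> int" where
  "wt1 GA = 1" | "wt1 GC = 1" | "wt1 GAs = -1" | "wt1 GCs = -1"

text \<open>Exchanges the two letters in each row of the fundamental corepresentation, which is what
  convolution on the right with \<open>E\<close> or \<open>F\<close> does up to scalars.\<close>

fun flip :: "gen \<Rightarrow> gen" where
  "flip GA = GCs" | "flip GC = GAs" | "flip GAs = GC" | "flip GCs = GA"

text \<open>Right weight, i.e. the grading given by right convolution with the diagonal torus.\<close>
definition wt :: "gen list \<Rightarrow> int" where
  "wt w = sum_list (map wt1 w)"

lemma wt_simps [simp]: "wt [] = 0" "wt (x # w) = wt1 x + wt w" "wt (u @ v) = wt u + wt v"
  by (simp_all add: wt_def)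

text \<open>Functionals that factor through restriction to the diagonal torus: \<open>GC\<close> and
  \<open>GCs\<close> go to \<open>0\<close>, \<open>GA\<close> to the coordinate \<open>z\<close>,
  and \<open>h k\<close> is the value on \<open>z^k\<close>. Powers of \<open>\<rho>\<close> give
  characters, the constant \<open>1\<close> the counit, and the indicator of an integer a weight
  projection.\<close>

definition tor :: "(int \<Rightarrow> complex) \<Rightarrow> gen list \<Rightarrow> complex" where
  "tor h w = (if set w \<subseteq> {GA, GAs} then h (wt w) else 0)"

abbreviation eps :: "gen list \<Rightarrow> complex" where
  "eps \<equiv> tor (\<lambda>k. 1)"

lemma tor_Nil [simp]: "tor h [] = h 0"
  and tor_Cons: "tor h (x # w) = (if x \<in> {GA, GAs} then tor (\<lambda>k. h (wt1 x + k)) w else 0)"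
  by (simp_all add: tor_def)

text \<open>Once \<open>GC\<close> and \<open>GCs\<close> are set to \<open>0\<close>, the relators
  only identify words of equal weight, so \<open>h\<close> can be arbitrary.\<close>

lemma tor_kills:
  assumes "x \<in> rel_ideal q" shows "ev (tor h) x = 0"
proof -
  have "ev (tor h) x \<in> {0}"
  proof (rule rel_ideal_linear_induct[OF assms, where sc = "(*)"])
    show vs: "vector_space ((*) :: complex \<Rightarrow> complex \<Rightarrow> complex)"
      by unfold_locales (auto simp: algebra_simps)
    then show "module.subspace ((*) :: complex \<Rightarrow> complex \<Rightarrow> complex) {0}"
      by (intro module.subspace_single_0) (simp add: vector_space_def module_def)
  next
    fix u v r assume r: "r \<in> relators q"
    have "ev (tor h) (fmul (delta u) (fmul r (delta v))) = ev (\<lambda>w. tor h (u @ w @ v)) r"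
      using relators_FS[OF r] by (simp add: ev_fmul fmul_FS)
    also have "\<dots> = 0"
      using r unfolding relators_def fsub_eq fadd_eq
      by (auto simp: ev_FS_diff ev_FS_add FS_closed ev_fscale tor_def)
    finally show "ev (tor h) (fmul (delta u) (fmul r (delta v))) \<in> {0}" by simp
  qed (simp_all add: ev_FS_add ev_fscale)
  then show ?thesis by simp
qed

text \<open>Right translation by the character \<open>K\<close> of the twisted Leibniz rule
  multiplies the letter \<open>x\<close> by \<open>kap q x\<close>.\<close>

definition kap :: "real \<Rightarrow> gen \<Rightarrow> complex" where
  "kap q x = (if wt1 x = 1 then complex_of_real q else 1 / complex_of_real q)"

definition kapw :: "real \<Rightarrow> gen list \<Rightarrow> complex" where
  "kapw q w = prod_list (map (kap q) w)"

lemma kap_simps [simp]: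
  "kap q GA = q" "kap q GC = q" "kap q GAs = 1 / q" "kap q GCs = 1 / q"
  by (simp_all add: kap_def)

lemma kapw_simps [simp]: "kapw q [] = 1" "kapw q (x # w) = kap q x * kapw q w"
  "kapw q (u @ v) = kapw q u * kapw q v"
  by (simp_all add: kapw_def)

text \<open>The operator \<open>(id \<otimes> E)\<Delta>\<close> for a functional \<open>E\<close> with
  \<open>E(xy) = E(x) \<epsilon>(y) + K(x) E(y)\<close>; it sends a letter \<open>x\<close> to \<open>s x\<close> times \<open>flip x\<close>.\<close>
fun skw :: "real \<Rightarrow> (gen \<Rightarrow> complex) \<Rightarrow> gen list \<Rightarrow> fa" where
  "skw q s [] = 0"
| "skw q s (x # w) = fscale (s x) (delta (flip x # w)) + fscale (kap q x) (fmul (delta [x]) (skw q s w))"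

definition RS :: "real \<Rightarrow> (gen \<Rightarrow> complex) \<Rightarrow> fa \<Rightarrow> fa" where
  "RS q s = lin (skw q s)"

text \<open>Read off the coproduct: the second tensor factor \<open>GCs\<close> occurs in the
  coproduct of \<open>GAs\<close> with first factor \<open>-q GC\<close>, and in that of
  \<open>GCs\<close> with first factor \<open>GA\<close>. \<open>sF\<close> is obtained in the same
  way from the second factor \<open>GC\<close>.\<close>

definition sE :: "real \<Rightarrow> gen \<Rightarrow> complex" where
  "sE q x = (case x of GAs \<Rightarrow> - complex_of_real q | GCs \<Rightarrow> 1 | _ \<Rightarrow> 0)"

definition sF :: "real \<Rightarrow> gen \<Rightarrow> complex" where
  "sF q x = (case x of GA \<Rightarrow> - complex_of_real q | GC \<Rightarrow> 1 | _ \<Rightarrow> 0)"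

lemma sE_simps [simp]: "sE q GA = 0" "sE q GC = 0" "sE q GAs = - q" "sE q GCs = 1"
  and sF_simps [simp]: "sF q GA = - q" "sF q GC = 1" "sF q GAs = 0" "sF q GCs = 0"
  by (simp_all add: sE_def sF_def)

lemma skw_FS [intro, simp]: "skw q s w \<in> FS"
  by (induct w) (auto intro!: FS_closed fmul_FS)

lemma RS_FS [intro, simp]: "RS q s x \<in> FS"
  unfolding RS_def by auto

lemma ev_skw_Cons:
  "ev \<omega> (skw q s (x # w)) = s x * \<omega> (flip x # w) + kap q x * ev (\<lambda>v. \<omega> (x # v)) (skw q s w)"
  by (simp add: ev_FS_add FS_closed fmul_FS ev_fscale ev_fmul)

lemma skw_append:
  "skw q s (u @ v) = fmul (skw q s u) (delta v) + fscale (kapw q u) (fmul (delta u) (skw q s v))"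
proof (induct u)
  case (Cons x u)
  have "fmul (delta [x]) (fmul (skw q s u) (delta v)) = fmul (fmul (delta [x]) (skw q s u)) (delta v)"
    "fmul (delta [x]) (fmul (delta u) (skw q s v)) = fmul (delta (x # u)) (skw q s v)"
    by (simp_all add: fmul_assoc[symmetric])
  then show ?case using Cons
    by (simp add: fmul_add_left fmul_add_right fmul_scale_left fmul_scale_right
        fv.scale_right_distrib add.assoc)
qed simp

definition TK :: "real \<Rightarrow> fa \<Rightarrow> fa" where
  "TK q = lin (\<lambda>w. fscale (kapw q w) (delta w))"

lemma TK_FS [intro, simp]: "TK q x \<in> FS"
  unfolding TK_def by auto

lemma ev_RS: "ev \<omega> (RS q s x) = ev (\<lambda>w. ev \<omega> (skw q s w)) x"
  unfolding RS_def by (rule ev_lin) (use skw_FS in \<open>auto simp: FS_eq_fsupp\<close>)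

lemma ev_TK: "ev \<omega> (TK q x) = ev (\<lambda>w. kapw q w * \<omega> w) x"
  unfolding TK_def using FS_closed(3)[OF delta_FS]
  by (subst ev_lin) (auto simp: FS_eq_fsupp ev_fscale)

lemma RS_fmul:
  assumes "x \<in> FS" "y \<in> FS"
  shows "RS q s (fmul x y) = fmul (RS q s x) y + fmul (TK q x) (RS q s y)"
proof (rule FS_eqI)
  fix \<omega>
  have *: "ev \<omega> (skw q s (u @ v)) = ev (\<lambda>u'. \<omega> (u' @ v)) (skw q s u)
      + kapw q u * ev (\<lambda>v'. \<omega> (u @ v')) (skw q s v)" for u v
    by (simp add: skw_append ev_FS_add FS_closed fmul_FS ev_fscale ev_fmul)
  have sw: "ev (\<lambda>v. ev (\<lambda>u'. \<omega> (u' @ v)) (skw q s u)) y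
      = ev (\<lambda>u'. ev (\<lambda>v. \<omega> (u' @ v)) y) (skw q s u)" for u
    by (rule ev_swap)
  show "ev \<omega> (RS q s (fmul x y)) = ev \<omega> (fmul (RS q s x) y + fmul (TK q x) (RS q s y))"
    using assms
    by (simp add: ev_FS_add fmul_FS ev_RS ev_fmul ev_TK * ev_functional_add ev_functional_scale sw)
qed (use assms in auto)

lemma TK_delta [simp]: "TK q (delta w) = fscale (kapw q w) (delta w)"
  and RS_delta [simp]: "RS q s (delta w) = skw q s w"
  by (simp_all add: TK_def RS_def)

lemma RS_add: "x \<in> FS \<Longrightarrow> y \<in> FS \<Longrightarrow> RS q s (x + y) = RS q s x + RS q s y"
  and RS_diff: "x \<in> FS \<Longrightarrow> y \<in> FS \<Longrightarrow> RS q s (x - y) = RS q s x - RS q s y"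
  and RS_scale: "RS q s (fscale c x) = fscale c (RS q s x)"
  and RS_sum: "(\<And>i. i \<in> I \<Longrightarrow> F i \<in> FS) \<Longrightarrow> RS q s (sum F I) = (\<Sum>i\<in>I. RS q s (F i))"
  unfolding RS_def by (simp_all only: lin_FS_add lin_FS_diff lin_fscale lin_FS_sum)

lemma TK_add: "x \<in> FS \<Longrightarrow> y \<in> FS \<Longrightarrow> TK q (x + y) = TK q x + TK q y"
  and TK_diff: "x \<in> FS \<Longrightarrow> y \<in> FS \<Longrightarrow> TK q (x - y) = TK q x - TK q y"
  and TK_scale: "TK q (fscale c x) = fscale c (TK q x)"
  unfolding TK_def by (simp_all only: lin_FS_add lin_FS_diff lin_fscale)

text \<open>Every relator is homogeneous for the right weight. The term of the Leibniz rule in which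
  the derivation passes over a relator therefore stays in the ideal.\<close>

lemma TK_relator:
  assumes "q \<noteq> 0" "r \<in> relators q" shows "\<exists>c. TK q r = fscale c r"
proof -
  consider "r \<in> {fsub (fadd (delta [GAs, GA]) (delta [GCs, GC])) (delta []),
     fsub (fadd (delta [GA, GAs]) (fscale (complex_of_real (q^2)) (delta [GCs, GC]))) (delta []),
     fsub (delta [GCs, GC]) (delta [GC, GCs]),
     fsub (delta [GA, GCs]) (fscale (complex_of_real q) (delta [GCs, GA])),
     fsub (delta [GC, GAs]) (fscale (complex_of_real q) (delta [GAs, GC]))}"
    | "r = fsub (delta [GA, GC]) (fscale (complex_of_real q) (delta [GC, GA]))"
    | "r = fsub (delta [GCs, GAs]) (fscale (complex_of_real q) (delta [GAs, GCs]))"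
    using assms(2) unfolding relators_def by blast
  then show ?thesis
  proof cases
    case 1
    then show ?thesis using assms(1)
      by (intro exI[of _ 1]) (auto simp: fsub_eq fadd_eq TK_diff TK_add TK_scale FS_closed)
  next
    case 2
    show ?thesis unfolding 2
      by (rule exI[of _ "complex_of_real q * complex_of_real q"])
         (simp add: fsub_eq fadd_eq TK_diff TK_add TK_scale FS_closed fv.scale_right_diff_distrib mult_ac)
  next
    case 3
    show ?thesis unfolding 3
      by (rule exI[of _ "1 / complex_of_real q * (1 / complex_of_real q)"])
         (simp add: fsub_eq fadd_eq TK_diff TK_add TK_scale FS_closed fv.scale_right_diff_distrib mult_ac)
  qed
qed

lemma fmul_minus_right: "fmul x (- y) = - fmul x y"
  by (simp add: fun_eq_iff fmul_def sum_negf)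

lemma relator_mem:
  "delta [GAs, GA] + delta [GCs, GC] - delta [] \<in> rel_ideal q"
  "delta [GA, GAs] + fscale (complex_of_real (q^2)) (delta [GCs, GC]) - delta [] \<in> rel_ideal q"
  "delta [GCs, GC] - delta [GC, GCs] \<in> rel_ideal q"
  "delta [GA, GC] - fscale (complex_of_real q) (delta [GC, GA]) \<in> rel_ideal q"
  "delta [GCs, GAs] - fscale (complex_of_real q) (delta [GAs, GCs]) \<in> rel_ideal q"
  "delta [GA, GCs] - fscale (complex_of_real q) (delta [GCs, GA]) \<in> rel_ideal q"
  "delta [GC, GAs] - fscale (complex_of_real q) (delta [GAs, GC]) \<in> rel_ideal q"
  by (rule relator_in_ideal, simp add: relators_def fsub_eq fadd_eq)+

text \<open>The value of the operator of \<open>E\<close> on the relator between \<open>GCs\<close>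
  and \<open>GAs\<close>. It is the second relator minus the first, corrected by a multiple of the
  third.\<close>

lemma commutator_relator:
  "delta [GA, GAs] - delta [GAs, GA] - delta [GCs, GC] + fscale (complex_of_real (q^2)) (delta [GC, GCs])
    \<in> rel_ideal q"
proof -
  have "delta [GA, GAs] - delta [GAs, GA] - delta [GCs, GC] + fscale (complex_of_real (q^2)) (delta [GC, GCs])
    = (delta [GA, GAs] + fscale (complex_of_real (q^2)) (delta [GCs, GC]) - delta [])
      - (delta [GAs, GA] + delta [GCs, GC] - delta [])
      - fscale (complex_of_real (q^2)) (delta [GCs, GC] - delta [GC, GCs])"
    by (simp add: fun_eq_iff fun_ops fscale_def algebra_simps)
  also have "\<dots> \<in> rel_ideal q" by (intro rel_ideal_closed relator_mem)
  finally show ?thesis .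
qed

lemma RS_relator:
  assumes q: "q \<noteq> 0" and r: "r \<in> relators q" and s: "s = sE q \<or> s = sF q"
  shows "RS q s r \<in> rel_ideal q"
proof -
  note mem = relator_mem[of q] commutator_relator[of q] rel_ideal_closed(5)[of q]
  note mem' = mem fv.subspace_scale[OF subspace_rel_ideal, OF mem(5), of "1 / complex_of_real q"]
    fv.subspace_scale[OF subspace_rel_ideal, OF mem(8), of "complex_of_real q"]
  \<comment> \<open>Every value of the two operators on the seven relators is in this list.\<close>
  let ?ys = "[0, delta [GA, GC] - fscale (complex_of_real q) (delta [GC, GA]),
      delta [GA, GAs] - delta [GAs, GA] - delta [GCs, GC] + fscale (complex_of_real (q^2)) (delta [GC, GCs]),
      fscale (1 / complex_of_real q) (delta [GCs, GAs] - fscale (complex_of_real q) (delta [GAs, GCs])),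
      fscale (complex_of_real q) (delta [GA, GAs] - delta [GAs, GA] - delta [GCs, GC]
         + fscale (complex_of_real (q^2)) (delta [GC, GCs]))]"
  have mys: "\<forall>y\<in>set ?ys. y \<in> rel_ideal q" using mem' by simp
  note simps = fsub_eq fadd_eq RS_diff RS_add RS_scale FS_closed fmul_add_right fmul_scale_right
    fmul_minus_right
  have pw: "x \<in> rel_ideal q" if "y \<in> set ?ys" "\<And>w. x w = y w" for x y
    using that mys by (metis ext)
  note pws = fun_ops fscale_def q power2_eq_square algebra_simps
  from s r[unfolded relators_def] show ?thesis
    by (elim disjE insertE emptyE; simp only:)
      ((rule pw[of "?ys ! 0"], simp, (simp add: simps; (simp add: pws)?; fail)) |
       (rule pw[of "?ys ! 1"], simp, (simp add: simps; (simp add: pws)?; fail)) |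
       (rule pw[of "?ys ! 2"], simp, (simp add: simps; (simp add: pws)?; fail)) |
       (rule pw[of "?ys ! 3"], simp, (simp add: simps; (simp add: pws)?; fail)) |
       (rule pw[of "?ys ! 4"], simp, (simp add: simps; (simp add: pws)?; fail)))+
qed

lemma RS_ideal:
  assumes q: "q \<noteq> 0" and s: "s = sE q \<or> s = sF q" and x: "x \<in> rel_ideal q"
  shows "RS q s x \<in> rel_ideal q"
proof (rule rel_ideal_linear_induct[OF x subspace_rel_ideal fv.vector_space_axioms])
  fix u v r assume r: "r \<in> relators q"
  note rF = relators_FS[OF r]
  have rI: "r \<in> rel_ideal q" by (rule relator_in_ideal[OF r])
  obtain c where c: "TK q r = fscale c r" using TK_relator[OF q r] by blast
  have "RS q s (fmul (delta u) (fmul r (delta v))) =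
     fmul (skw q s u) (fmul r (delta v)) + fscale (kapw q u) (fmul (delta u)
        (fmul (RS q s r) (delta v) + fscale c (fmul r (skw q s v))))"
    using rF by (simp add: RS_fmul fmul_FS c fmul_scale_left)
  also have "\<dots> \<in> rel_ideal q"
    by (intro rel_ideal_closed rel_ideal_mult rI RS_relator[OF q r s] delta_FS skw_FS)
  finally show "RS q s (fmul (delta u) (fmul r (delta v))) \<in> rel_ideal q" .
qed (simp_all add: RS_add RS_scale)

section \<open>Slices of the coproduct\<close>

text \<open>The slice map \<open>id\<close> tensor \<open>\<omega>\<close>; applied to
  \<open>Delta q x\<close> it is convolution with \<open>\<omega>\<close> on the right.\<close>

definition sl :: "(gen list \<Rightarrow> complex) \<Rightarrow> fa2 \<Rightarrow> fa" where
  "sl \<omega> X = lin (\<lambda>p. fscale (\<omega> (snd p)) (delta (fst p))) X"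

lemma sl_FS [intro, simp]: "sl \<omega> X \<in> FS"
  unfolding sl_def by auto

lemma ev_sl: "ev \<eta> (sl \<omega> X) = ev (\<lambda>p. \<omega> (snd p) * \<eta> (fst p)) X"
  unfolding sl_def using FS_closed(3)[OF delta_FS]
  by (subst ev_lin) (auto simp: FS_eq_fsupp ev_fscale)

lemma ev_tens:
  assumes "x \<in> FS" "y \<in> FS"
  shows "tens x y \<in> fsupp" "ev f (tens x y) = ev (\<lambda>u. ev (\<lambda>v. f (u, v)) y) x"
proof -
  let ?S = "{u. x u \<noteq> 0} \<times> {v. y v \<noteq> 0}"
  have fin: "finite ?S" using assms by (simp add: FS_def)
  have sub: "p \<in> ?S" if "tens x y p \<noteq> 0" for p using that by (auto simp: tens_def split: prod.splits)
  show "tens x y \<in> fsupp" unfolding fsupp_def mem_Collect_eq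
    by (rule finite_subset[OF _ fin]) (use sub in auto)
  show "ev f (tens x y) = ev (\<lambda>u. ev (\<lambda>v. f (u, v)) y) x"
    by (subst ev_superset[OF fin sub])
       (auto simp: ev_def tens_def sum_distrib_left mult.assoc sum.cartesian_product intro!: sum.cong)
qed

lemma ev_functional_scale_right: "ev (\<lambda>a. f a * z) x = ev f x * z"
  by (simp add: ev_functional_scale mult.commute[of _ z])

lemma ev_functional_divide: "ev (\<lambda>a. f a / z) x = ev f x / z"
  using ev_functional_scale_right[of f "1 / z" x] by simp

lemma sl_tens:
  assumes "x \<in> FS" "y \<in> FS" shows "sl \<omega> (tens x y) = fscale (ev \<omega> y) x"
proof (rule FS_eqI)
  fix \<eta>
  show "ev \<eta> (sl \<omega> (tens x y)) = ev \<eta> (fscale (ev \<omega> y) x)"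
    using assms by (simp add: ev_sl ev_tens ev_fscale ev_functional_scale ev_functional_scale_right)
qed (use assms in auto)

lemma sl_add: "X \<in> fsupp \<Longrightarrow> Y \<in> fsupp \<Longrightarrow> sl \<omega> (X + Y) = sl \<omega> X + sl \<omega> Y"
  and sl_diff: "X \<in> fsupp \<Longrightarrow> Y \<in> fsupp \<Longrightarrow> sl \<omega> (X - Y) = sl \<omega> X - sl \<omega> Y"
  and sl_sum: "(\<And>i. i \<in> I \<Longrightarrow> F i \<in> fsupp) \<Longrightarrow> sl \<omega> (sum F I) = (\<Sum>i\<in>I. sl \<omega> (F i))"
  unfolding sl_def by (simp_all only: lin_add lin_diff lin_sum)

lemma tens_ideal_fsupp: "X \<in> tens_ideal q \<Longrightarrow> X \<in> fsupp"
proof (induct rule: tens_ideal.induct)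
  case zero
  then show ?case by (simp add: fsupp_def)
next
  case (add X Y)
  then show ?case unfolding fadd2_eq by blast
qed (auto intro: ev_tens rel_ideal_FS)

lemma sl_tens_ideal:
  assumes kills: "\<And>x. x \<in> rel_ideal q \<Longrightarrow> ev \<omega> x = 0" and X: "X \<in> tens_ideal q"
  shows "sl \<omega> X \<in> rel_ideal q"
  using X
proof (induct rule: tens_ideal.induct)
  case zero
  have "sl \<omega> (\<lambda>p. 0) = 0" unfolding sl_def zero_fun_def[symmetric] by simp
  then show ?case using rel_ideal_closed(5) by metis
next
  case (add X Y)
  then show ?case unfolding fadd2_eq by (simp add: sl_add tens_ideal_fsupp rel_ideal_closed(1))
next
  case (left x y)
  then show ?case by (simp add: sl_tens rel_ideal_FS rel_ideal_closed(3))
next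
  case (right x y)
  then show ?case by (simp add: sl_tens rel_ideal_FS kills fv.subspace_0[OF subspace_rel_ideal])
qed

lemma take_eq_single: "k \<le> length u \<Longrightarrow> take k u = [g] \<longleftrightarrow> k = 1 \<and> u \<noteq> [] \<and> hd u = g"
  by (cases u; cases k) auto

lemma fmul2_single:
  "fmul2 (tens (delta [g]) (delta [h])) Y (u, v) =
    (if u \<noteq> [] \<and> v \<noteq> [] \<and> hd u = g \<and> hd v = h then Y (tl u, tl v) else 0)"
proof -
  have "fmul2 (tens (delta [g]) (delta [h])) Y (u, v) =
     (\<Sum>k\<in>{0..length u}. \<Sum>l\<in>{0..length v}. if k = 1 then (if l = 1 then
        (if u \<noteq> [] \<and> v \<noteq> [] \<and> hd u = g \<and> hd v = h then Y (tl u, tl v) else 0) else 0) else 0)"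
    unfolding fmul2_def prod.case
    by (intro sum.cong refl) (auto simp: tens_def delta_def take_eq_single drop_Suc)
  also have "\<dots> = (\<Sum>k\<in>{0..length u}. if k = 1 then (\<Sum>l\<in>{0..length v}. if l = 1 then
        (if u \<noteq> [] \<and> v \<noteq> [] \<and> hd u = g \<and> hd v = h then Y (tl u, tl v) else 0) else 0) else 0)"
    by (intro sum.cong refl) auto
  also have "\<dots> = (if u \<noteq> [] \<and> v \<noteq> [] \<and> hd u = g \<and> hd v = h then Y (tl u, tl v) else 0)"
    by (auto simp: sum.delta Suc_le_eq)
  finally show ?thesis .
qed

lemma ev_fmul2_single:
  assumes "Y \<in> fsupp"
  shows "fmul2 (tens (delta [g]) (delta [h])) Y \<in> fsupp" (is "?X \<in> _")
    "ev f (fmul2 (tens (delta [g]) (delta [h])) Y) = ev (\<lambda>p. f (g # fst p, h # snd p)) Y"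
proof -
  let ?j = "\<lambda>p. (g # fst p, h # snd p)"
  have sub: "p \<in> ?j ` {p. Y p \<noteq> 0}" if "?X p \<noteq> 0" for p
    using that by (cases p) (auto simp: fmul2_single neq_Nil_conv image_iff split: if_splits)
  have fin: "finite {p. Y p \<noteq> 0}" using assms by (simp add: fsupp_def)
  show "?X \<in> fsupp" unfolding fsupp_def mem_Collect_eq
    by (rule finite_subset[of _ "?j ` {p. Y p \<noteq> 0}"]) (use sub fin in auto)
  have inj: "inj_on ?j {p. Y p \<noteq> 0}" by (auto simp: inj_on_def)
  show "ev f ?X = ev (\<lambda>p. f (?j p)) Y"
    by (subst ev_superset[OF finite_imageI[OF fin] sub])
       (simp_all add: sum.reindex[OF inj] ev_def fmul2_single)
qed

lemma fmul2_linear: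
  "fmul2 (X + X') Y = fmul2 X Y + fmul2 X' Y"
  "fmul2 (X - X') Y = fmul2 X Y - fmul2 X' Y"
  "fmul2 (\<lambda>p. z * X p) Y = (\<lambda>p. z * fmul2 X Y p)"
  by (auto simp: fmul2_def fun_eq_iff fun_ops distrib_right left_diff_distrib sum.distrib
      sum_subtractf sum_distrib_left mult.assoc)

lemma tens_fscale: "tens (fscale z x) y = (\<lambda>p. z * tens x y p)"
  by (auto simp: tens_def fscale_def)

lemma ev_Delta_word_Cons:
  assumes Y: "Delta_word q w \<in> fsupp"
  shows "Delta_word q (x # w) \<in> fsupp"
    "ev f (Delta_word q (GA # w)) = ev (\<lambda>p. f (GA # fst p, GA # snd p)) (Delta_word q w)
       - q * ev (\<lambda>p. f (GCs # fst p, GC # snd p)) (Delta_word q w)"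
    "ev f (Delta_word q (GC # w)) = ev (\<lambda>p. f (GC # fst p, GA # snd p)) (Delta_word q w)
       + ev (\<lambda>p. f (GAs # fst p, GC # snd p)) (Delta_word q w)"
    "ev f (Delta_word q (GAs # w)) = ev (\<lambda>p. f (GAs # fst p, GAs # snd p)) (Delta_word q w)
       - q * ev (\<lambda>p. f (GC # fst p, GCs # snd p)) (Delta_word q w)"
    "ev f (Delta_word q (GCs # w)) = ev (\<lambda>p. f (GCs # fst p, GAs # snd p)) (Delta_word q w)
       + ev (\<lambda>p. f (GA # fst p, GCs # snd p)) (Delta_word q w)"
  by (cases x)
     (simp_all add: Delta_gen_def fsub2_eq fadd2_eq tens_fscale fmul2_linear ev_diff ev_add ev_scale
       ev_fmul2_single[OF Y] fsupp_scale fsupp_add fsupp_diff)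

lemma Delta_word_fsupp [simp]: "Delta_word q w \<in> fsupp"
proof (induct w)
  case Nil
  then show ?case by (simp add: ev_tens(1))
next
  case (Cons x w)
  then show ?case by (rule ev_Delta_word_Cons(1))
qed

text \<open>True in the free algebra, before dividing by the relations: second tensor factors
  \<open>GC\<close> and \<open>GCs\<close> are killed, and from the coproduct of a letter there
  remains that letter with a torus letter of the same weight. \<open>\<eta>\<close> is arbitrary so
  that the induction can absorb a leading letter.\<close>

lemma ev_tor_Delta_word:
  "ev (\<lambda>p. tor h (snd p) * \<eta> (fst p)) (Delta_word q w) = h (wt w) * \<eta> w"
proof (induct w arbitrary: h \<eta>)
  case Nil
  then show ?case by (simp add: ev_tens)
next
  case (Cons x w)
  have "ev (\<lambda>p. tor (\<lambda>k. h (c + k)) (snd p) * \<eta> (y # fst p)) (Delta_word q w)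
     = h (c + wt w) * \<eta> (y # w)" for c y
    using Cons[of "\<lambda>k. h (c + k)" "\<lambda>u. \<eta> (y # u)"] by simp
  from this[of 1] this[of "-1"] show ?case
    by (cases x) (simp_all only: ev_Delta_word_Cons(2-5)[OF Delta_word_fsupp] tor_Cons
       fst_conv snd_conv, simp_all)
qed

definition skf :: "real \<Rightarrow> (gen \<Rightarrow> complex) \<Rightarrow> gen list \<Rightarrow> complex" where
  "skf q s w = ev eps (skw q s w)"

lemma skf_Nil [simp]: "skf q s [] = 0"
  by (simp add: skf_def)

lemma skf_Cons:
  "skf q s (x # w) = (if x \<in> {GA, GAs} then kap q x * skf q s w else s x * eps w)"
  unfolding skf_def by (cases x) (simp_all only: ev_skw_Cons tor_Cons, simp_all)

text \<open>The hypotheses say that \<open>s\<close> comes from its values on \<open>GC\<close> and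
  \<open>GCs\<close> by the coproduct; then slicing with the functional gives back the
  operator.\<close>

lemma ev_skf_Delta_word:
  assumes s: "s GA = - complex_of_real q * s GC" "s GAs = - complex_of_real q * s GCs"
  shows "ev (\<lambda>p. skf q s (snd p) * \<eta> (fst p)) (Delta_word q w) = ev \<eta> (skw q s w)"
proof (induct w arbitrary: \<eta>)
  case Nil
  then show ?case by (simp add: ev_tens)
next
  case (Cons x w)
  have 1: "ev (\<lambda>p. skf q s (snd p) * \<eta> (y # fst p)) (Delta_word q w) = ev (\<lambda>u. \<eta> (y # u)) (skw q s w)" for y
    using Cons[of "\<lambda>u. \<eta> (y # u)"] by simp
  have 2: "ev (\<lambda>p. eps (snd p) * \<eta> (y # fst p)) (Delta_word q w) = \<eta> (y # w)" for y
    using ev_tor_Delta_word[of "\<lambda>k. 1" "\<lambda>u. \<eta> (y # u)"] by simp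
  show ?case
    by (cases x) (simp_all add: ev_Delta_word_Cons(2-5)[OF Delta_word_fsupp] skf_Cons
       ev_skw_Cons mult.assoc ev_functional_scale ev_functional_divide 1 2 s del: skw.simps Delta_word.simps)
qed

lemma Delta_eq_lin: "Delta q x = lin (Delta_word q) x"
  by (simp add: Delta_def fsum2_eq lin_eq_sum)

lemma Delta_fsupp [simp, intro]: "Delta q x \<in> fsupp"
  unfolding Delta_eq_lin by auto

lemma ev_Delta: "ev f (Delta q x) = ev (\<lambda>w. ev f (Delta_word q w)) x"
  unfolding Delta_eq_lin by (rule ev_lin) simp

lemma ev_sl_Delta_tor: "ev \<eta> (sl (tor h) (Delta q x)) = ev (\<lambda>w. h (wt w) * \<eta> w) x"
  by (simp add: ev_sl ev_Delta ev_tor_Delta_word)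

lemma sl_Delta_skf:
  assumes "s = sE q \<or> s = sF q" shows "sl (skf q s) (Delta q x) = RS q s x"
proof (rule FS_eqI)
  fix \<eta>
  show "ev \<eta> (sl (skf q s) (Delta q x)) = ev \<eta> (RS q s x)"
    using assms by (auto simp: ev_sl ev_Delta ev_skf_Delta_word ev_RS)
qed auto

lemma skf_kills:
  assumes "q \<noteq> 0" "s = sE q \<or> s = sF q" "x \<in> rel_ideal q" shows "ev (skf q s) x = 0"
proof -
  have "ev (skf q s) x = ev eps (RS q s x)" by (simp add: ev_RS skf_def[abs_def])
  also have "\<dots> = 0" by (rule tor_kills[OF RS_ideal[OF assms]])
  finally show ?thesis .
qed

section \<open>Relations between the functionals\<close>

lemma skw_support:
  "skw q s w v \<noteq> 0 \<Longrightarrow> \<exists>u x u'. w = u @ x # u' \<and> v = u @ flip x # u' \<and> s x \<noteq> 0"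
proof (induct w arbitrary: v)
  case (Cons y w)
  have "skw q s (y # w) v = s y * delta (flip y # w) v + kap q y * fmul (delta [y]) (skw q s w) v"
    by (simp add: fun_ops fscale_def)
  then consider "s y \<noteq> 0" "delta (flip y # w) v \<noteq> 0" | "fmul (delta [y]) (skw q s w) v \<noteq> 0"
    using Cons.prems by fastforce
  then show ?case
  proof cases
    case 1
    then have "v = flip y # w" by (simp add: delta_def split: if_splits)
    with 1 show ?thesis by (metis append_Nil)
  next
    case 2
    have "\<exists>k\<in>{0..length v}. delta [y] (take k v) * skw q s w (drop k v) \<noteq> 0"
      using 2 unfolding fmul_def by (metis (mono_tags, lifting) sum.neutral)
    then obtain k where k: "k \<le> length v" "take k v = [y]" "skw q s w (drop k v) \<noteq> 0"
      by (auto simp: delta_def split: if_splits)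
    then obtain u x u' where *: "w = u @ x # u'" "drop k v = u @ flip x # u'" "s x \<noteq> 0"
      using Cons.hyps by blast
    have "v = (y # u) @ flip x # u'" using k(2) *(2) append_take_drop_id[of k v] by simp
    with * show ?thesis by (metis append_Cons)
  qed
qed (simp add: fun_ops)

lemma wt1_flip [simp]: "wt1 (flip x) = - wt1 x" by (cases x) auto

lemma skw_sE_wt: "skw q (sE q) w v \<noteq> 0 \<Longrightarrow> wt v = wt w + 2"
proof -
  assume "skw q (sE q) w v \<noteq> 0"
  then obtain u x u' where "w = u @ x # u'" "v = u @ flip x # u'" "sE q x \<noteq> 0"
    using skw_support by blast
  then show ?thesis by (cases x) auto
qed

lemma skw_sF_wt: "skw q (sF q) w v \<noteq> 0 \<Longrightarrow> wt v = wt w - 2"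
proof -
  assume "skw q (sF q) w v \<noteq> 0"
  then obtain u x u' where "w = u @ x # u'" "v = u @ flip x # u'" "sF q x \<noteq> 0"
    using skw_support by blast
  then show ?thesis by (cases x) auto
qed

lemma tor_eq_eps: "tor h w = h (wt w) * eps w"
  by (simp add: tor_def)

lemma ev_tor_skw:
  "ev (tor h) (skw q (sE q) w) = h (wt w + 2) * skf q (sE q) w"
  "ev (tor h) (skw q (sF q) w) = h (wt w - 2) * skf q (sF q) w"
  unfolding skf_def ev_functional_scale[symmetric]
  by (rule ev_cong, simp add: tor_eq_eps[of h] skw_sE_wt skw_sF_wt)+

text \<open>The relation \<open>E F - q^(-2) F E = q / (1 - q^2) (K^2 - 1)\<close> of
  \<open>U_q(sl_2)\<close> for convolution of functionals, where \<open>1\<close> is the counit and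
  \<open>K^2\<close> the torus character at \<open>q^2\<close>.\<close>

lemma skf_commutation:
  assumes q: "q \<noteq> 0" "q\<^sup>2 \<noteq> 1"
  shows "ev (skf q (sE q)) (skw q (sF q) w) - ev (skf q (sF q)) (skw q (sE q) w) / q\<^sup>2
    = q / (1 - q\<^sup>2) * (tor (\<lambda>k. complex_of_real (q\<^sup>2) powi k) w - eps w)"
proof (induct w)
  case (Cons x w)
  have ne: "complex_of_real q \<noteq> 0" "1 - (complex_of_real q)\<^sup>2 \<noteq> 0"
    using q by (auto simp flip: of_real_power)
  have sc: "ev (\<lambda>v. skf q s (y # v)) (skw q s' w) = (if y \<in> {GA, GAs} then kap q y * ev (skf q s) (skw q s' w)
       else s y * skf q s' w)" for s s' y
    by (simp add: skf_Cons ev_functional_scale skf_def[of q s'])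
  have tq: "tor (\<lambda>k. complex_of_real (q\<^sup>2) powi (c + k)) w
      = complex_of_real (q\<^sup>2) powi c * tor (\<lambda>k. complex_of_real (q\<^sup>2) powi k) w" for c
    using q by (simp add: tor_def power_int_add)
  define X Y Z where "X = ev (skf q (sE q)) (skw q (sF q) w)" and "Y = ev (skf q (sF q)) (skw q (sE q) w)"
    and "Z = tor (\<lambda>k. complex_of_real (q\<^sup>2) powi k) w"
  have IH: "X = Y / q\<^sup>2 + q / (1 - q\<^sup>2) * (Z - eps w)" using Cons by (simp add: X_def Y_def Z_def algebra_simps)
  show ?case
  proof (cases x)
    case GA
    show ?thesis unfolding GA
      apply (simp only: ev_skw_Cons sc tq tor_Cons X_def[symmetric] Y_def[symmetric] Z_def[symmetric])
      apply (simp add: skf_Cons X_def[symmetric] Y_def[symmetric] Z_def[symmetric] IH tq)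
      using ne by (simp add: divide_simps) (simp add: algebra_simps power2_eq_square)
  next
    case GAs
    show ?thesis unfolding GAs
      apply (simp only: ev_skw_Cons sc tq tor_Cons X_def[symmetric] Y_def[symmetric] Z_def[symmetric])
      apply (simp add: skf_Cons X_def[symmetric] Y_def[symmetric] Z_def[symmetric] IH power_int_minus)
      using ne by (simp add: divide_simps) (simp add: algebra_simps power2_eq_square)
  next
    case GC
    show ?thesis unfolding GC using ne
      by (simp only: ev_skw_Cons sc tq tor_Cons) (simp add: skf_Cons field_simps power2_eq_square)
  next
    case GCs
    show ?thesis unfolding GCs using ne
      by (simp only: ev_skw_Cons sc tq tor_Cons) (simp add: skf_Cons field_simps power2_eq_square)
  qed
qed simp

section \<open>A filtration of the algebra and separating functionals\<close>

text \<open>The length bound is strict, so that \<open>Gr q 0\<close> is the ideal itself and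
  descent along the filtration ends there.\<close>

definition Gr :: "real \<Rightarrow> nat \<Rightarrow> fa set" where
  "Gr q N = {x. \<exists>y z. x = y + z \<and> y \<in> FS \<and> (\<forall>w. y w \<noteq> 0 \<longrightarrow> length w < N) \<and> z \<in> rel_ideal q}"

lemma GrI:
  "x = y + z \<Longrightarrow> y \<in> FS \<Longrightarrow> (\<And>w. y w \<noteq> 0 \<Longrightarrow> length w < N) \<Longrightarrow> z \<in> rel_ideal q \<Longrightarrow> x \<in> Gr q N"
  unfolding Gr_def by blast

lemma subspace_Gr: "fv.subspace (Gr q N)"
  unfolding fv.subspace_def
proof (intro conjI ballI allI)
  show "0 \<in> Gr q N"
    by (rule GrI[of _ 0 0]) (auto simp: fun_ops rel_ideal_closed(5) FS_closed)
next
  fix x x' assume "x \<in> Gr q N" "x' \<in> Gr q N"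
  then obtain y z y' z' where *: "x = y + z" "y \<in> FS" "\<forall>w. y w \<noteq> 0 \<longrightarrow> length w < N" "z \<in> rel_ideal q"
    "x' = y' + z'" "y' \<in> FS" "\<forall>w. y' w \<noteq> 0 \<longrightarrow> length w < N" "z' \<in> rel_ideal q"
    unfolding Gr_def by blast
  have "x + x' = (y + y') + (z + z')" using * by (simp add: algebra_simps)
  moreover have "length w < N" if "(y + y') w \<noteq> 0" for w
  proof -
    have "y w \<noteq> 0 \<or> y' w \<noteq> 0" using that by (auto simp: fun_ops)
    then show ?thesis using * by blast
  qed
  ultimately show "x + x' \<in> Gr q N" unfolding Gr_def using * by blast
next
  fix c x assume "x \<in> Gr q N"
  then obtain y z where *: "x = y + z" "y \<in> FS" "\<forall>w. y w \<noteq> 0 \<longrightarrow> length w < N" "z \<in> rel_ideal q"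
    unfolding Gr_def by blast
  have "fscale c x = fscale c y + fscale c z" using * by (simp add: fv.scale_right_distrib)
  moreover have "\<forall>w. fscale c y w \<noteq> 0 \<longrightarrow> length w < N" using * by (simp add: fscale_def)
  ultimately show "fscale c x \<in> Gr q N" unfolding Gr_def using * by blast
qed

lemmas Gr_closed = fv.subspace_add[OF subspace_Gr] fv.subspace_diff[OF subspace_Gr]
  fv.subspace_scale[OF subspace_Gr] fv.subspace_sum[OF subspace_Gr] fv.subspace_0[OF subspace_Gr]

lemma rel_ideal_Gr: "x \<in> rel_ideal q \<Longrightarrow> x \<in> Gr q N"
  by (rule GrI[of _ 0 x]) (auto simp: FS_closed fun_ops)

lemma Gr_FS: "x \<in> Gr q N \<Longrightarrow> x \<in> FS"
  unfolding Gr_def using rel_ideal_FS by blast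

lemma Gr_0: "Gr q 0 = rel_ideal q"
proof
  show "Gr q 0 \<subseteq> rel_ideal q"
  proof
    fix x assume "x \<in> Gr q 0"
    then obtain y z where *: "x = y + z" "\<forall>w. y w = 0" "z \<in> rel_ideal q" unfolding Gr_def by auto
    then have "x = z" by (simp add: fun_eq_iff fun_ops)
    then show "x \<in> rel_ideal q" using * by simp
  qed
qed (use rel_ideal_Gr in blast)

lemma FS_Gr: "x \<in> FS \<Longrightarrow> (\<And>w. x w \<noteq> 0 \<Longrightarrow> length w < N) \<Longrightarrow> x \<in> Gr q N"
  by (rule GrI[of _ x 0]) (auto simp: rel_ideal_closed(5))

lemma delta_Gr: "length w < N \<Longrightarrow> delta w \<in> Gr q N"
  by (rule FS_Gr[OF delta_FS]) (auto simp: delta_def split: if_splits)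

lemma Gr_mono: "N \<le> N' \<Longrightarrow> x \<in> Gr q N \<Longrightarrow> x \<in> Gr q N'"
  unfolding Gr_def by (blast intro: less_le_trans)

lemma FS_in_some_Gr:
  assumes "x \<in> FS" shows "\<exists>N. x \<in> Gr q N"
proof -
  have "finite (length ` {w. x w \<noteq> 0})" using assms by (simp add: FS_def)
  then obtain N where "\<forall>n \<in> length ` {w. x w \<noteq> 0}. n < N"
    by (meson finite_nat_set_iff_bounded)
  then show ?thesis using assms by (intro exI[of _ N] FS_Gr) auto
qed

lemma Gr_Cons:
  assumes "x \<in> Gr q N" shows "fmul (delta [g]) x \<in> Gr q (Suc N)"
proof -
  obtain y z where *: "x = y + z" "y \<in> FS" "\<forall>w. y w \<noteq> 0 \<longrightarrow> length w < N" "z \<in> rel_ideal q"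
    using assms unfolding Gr_def by blast
  have "fmul (delta [g]) y = (\<Sum>w | y w \<noteq> 0. fscale (y w) (delta (g # w)))"
    by (subst FS_expand[OF *(2)]) (simp add: fmul_sum_right fmul_scale_right)
  also have "\<dots> \<in> Gr q (Suc N)" using * by (intro Gr_closed delta_Gr) auto
  finally have "fmul (delta [g]) y \<in> Gr q (Suc N)" .
  moreover have "fmul (delta [g]) z \<in> Gr q (Suc N)"
    using * rel_ideal_mult(2) delta_FS rel_ideal_Gr by blast
  ultimately show ?thesis using * by (simp add: fmul_add_right Gr_closed)
qed

lemma ideal_subst_word:
  assumes "delta s - fscale z (delta t) \<in> rel_ideal q"
  shows "delta (u @ s @ v) - fscale z (delta (u @ t @ v)) \<in> rel_ideal q"
proof -
  have "fmul (fmul (delta u) (delta s - fscale z (delta t))) (delta v) \<in> rel_ideal q"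
    by (intro rel_ideal_mult assms delta_FS)
  then show ?thesis
    by (simp add: fmul_diff_left fmul_diff_right fmul_scale_left fmul_scale_right)
qed

lemma ideal_scale_trans:
  assumes "x - fscale z y \<in> rel_ideal q" "y - fscale z' y' \<in> rel_ideal q"
  shows "x - fscale (z * z') y' \<in> rel_ideal q"
proof -
  have "x - fscale (z * z') y' = (x - fscale z y) + fscale z (y - fscale z' y')"
    by (simp add: fv.scale_right_diff_distrib)
  then show ?thesis using assms rel_ideal_closed by metis
qed

lemma ideal_move_letter:
  assumes "delta [y, g] - fscale z (delta [g, y]) \<in> rel_ideal q"
  shows "delta (u @ y # replicate m g @ v) - fscale (z ^ m) (delta (u @ replicate m g @ y # v)) \<in> rel_ideal q"
proof (induct m arbitrary: u)
  case 0
  then show ?case by (simp add: rel_ideal_closed(5))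
next
  case (Suc m)
  have "delta (u @ [y, g] @ replicate m g @ v) - fscale z (delta (u @ [g, y] @ replicate m g @ v)) \<in> rel_ideal q"
    by (rule ideal_subst_word[OF assms])
  from ideal_scale_trans[OF this, of "z ^ m" "delta (u @ replicate (Suc m) g @ y # v)"] Suc[of "u @ [g]"]
  show ?case by simp
qed

lemma commute_letters:
  assumes q: "q \<noteq> 0"
  shows "y \<in> {GC, GCs} \<Longrightarrow> g \<in> {GA, GAs} \<Longrightarrow> \<exists>z. delta [y, g] - fscale z (delta [g, y]) \<in> rel_ideal q"
    "delta [GCs, GC] - fscale 1 (delta [GC, GCs]) \<in> rel_ideal q"
proof -
  have inv: "delta [y, GA] - fscale (1 / complex_of_real q) (delta [GA, y]) \<in> rel_ideal q"
    if "delta [GA, y] - fscale (complex_of_real q) (delta [y, GA]) \<in> rel_ideal q" for y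
  proof -
    have "delta [y, GA] - fscale (1 / complex_of_real q) (delta [GA, y])
      = fscale (- 1 / complex_of_real q) (delta [GA, y] - fscale (complex_of_real q) (delta [y, GA]))"
      using q by (simp add: fun_eq_iff fun_ops fscale_def field_simps)
    then show ?thesis using that rel_ideal_closed by metis
  qed
  show "y \<in> {GC, GCs} \<Longrightarrow> g \<in> {GA, GAs} \<Longrightarrow> \<exists>z. delta [y, g] - fscale z (delta [g, y]) \<in> rel_ideal q"
    using relator_mem[of q] inv by blast
  show "delta [GCs, GC] - fscale 1 (delta [GC, GCs]) \<in> rel_ideal q"
    using relator_mem(3)[of q] by simp
qed

section \<open>Normal monomials\<close>

definition NF :: "nat \<Rightarrow> gen list set" where
  "NF N = {replicate m g @ replicate j GC @ replicate k GCs | m j k g. g \<in> {GA, GAs} \<and> m + j + k = N}"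

lemma NF_I: "w = replicate m g @ replicate j GC @ replicate k GCs \<Longrightarrow> g \<in> {GA, GAs} \<Longrightarrow> m + j + k = N \<Longrightarrow> w \<in> NF N"
  unfolding NF_def by blast

lemma NF_length: "w \<in> NF N \<Longrightarrow> length w = N"
  by (auto simp: NF_def)

lemma finite_NF: "finite (NF N)"
proof (rule finite_subset)
  show "NF N \<subseteq> (\<lambda>(m, j, k, g). replicate m g @ replicate j GC @ replicate k GCs)
     ` ({..N} \<times> {..N} \<times> {..N} \<times> {GA, GAs})"
  proof
    fix w assume "w \<in> NF N"
    then obtain m j k g where "w = replicate m g @ replicate j GC @ replicate k GCs" "g \<in> {GA, GAs}" "m + j + k = N"
      unfolding NF_def by blast
    then show "w \<in> (\<lambda>(m, j, k, g). replicate m g @ replicate j GC @ replicate k GCs)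
     ` ({..N} \<times> {..N} \<times> {..N} \<times> {GA, GAs})"
      by (intro image_eqI[of _ _ "(m, j, k, g)"]) auto
  qed
qed auto

text \<open>Moving \<open>GC\<close> or \<open>GCs\<close> to its place costs only scalars, so no
  terms of lower degree arise.\<close>

lemma NF_Cons_c:
  assumes q: "q \<noteq> 0" and w: "w \<in> NF N" and y: "y \<in> {GC, GCs}"
  shows "\<exists>z. \<exists>w'\<in>NF (Suc N). delta (y # w) - fscale z (delta w') \<in> rel_ideal q"
proof -
  obtain m j k g where w: "w = replicate m g @ replicate j GC @ replicate k GCs" "g \<in> {GA, GAs}" "m + j + k = N"
    using w by (auto simp: NF_def)
  obtain z where z: "delta [y, g] - fscale z (delta [g, y]) \<in> rel_ideal q"
    using commute_letters(1)[OF q y w(2)] by blast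
  have 1: "delta (y # w) - fscale (z ^ m) (delta (replicate m g @ y # replicate j GC @ replicate k GCs)) \<in> rel_ideal q"
    using ideal_move_letter[OF z, of "[]" m "replicate j GC @ replicate k GCs"] w by simp
  show ?thesis
  proof (cases "y = GC")
    case True
    have "replicate m g @ y # replicate j GC @ replicate k GCs \<in> NF (Suc N)"
      using w True by (intro NF_I[of _ m g "Suc j" k]) auto
    then show ?thesis using 1 by blast
  next
    case False
    then have y: "y = GCs" using y by auto
    have "replicate m g @ replicate j GC @ y # replicate k GCs \<in> NF (Suc N)"
      using w y by (intro NF_I[of _ m g j "Suc k"]) auto
    moreover have "delta (replicate m g @ y # replicate j GC @ replicate k GCs)
       - fscale (1 ^ j) (delta (replicate m g @ replicate j GC @ y # replicate k GCs)) \<in> rel_ideal q"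
      using ideal_move_letter[OF commute_letters(2)[OF q]] y by simp
    ultimately show ?thesis using ideal_scale_trans[OF 1] by blast
  qed
qed

lemma NF_Cons_cc:
  assumes q: "q \<noteq> 0" and w: "w \<in> NF N"
  shows "\<exists>z. \<exists>w'\<in>NF (Suc (Suc N)). delta (GCs # GC # w) - fscale z (delta w') \<in> rel_ideal q"
proof -
  obtain z w' where 1: "w' \<in> NF (Suc N)" "delta (GC # w) - fscale z (delta w') \<in> rel_ideal q"
    using NF_Cons_c[OF q w, of GC] by blast
  obtain z' w'' where 2: "w'' \<in> NF (Suc (Suc N))" "delta (GCs # w') - fscale z' (delta w'') \<in> rel_ideal q"
    using NF_Cons_c[OF q 1(1), of GCs] by blast
  have "delta (GCs # GC # w) - fscale z (delta (GCs # w')) \<in> rel_ideal q"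
    using ideal_subst_word[OF 1(2), of "[GCs]" "[]"] by simp
  from ideal_scale_trans[OF this 2(2)] show ?thesis using 2(1) by blast
qed

text \<open>The essential case is \<open>y\<close> meeting the opposite torus letter
  \<open>g\<close>. The relation replaces \<open>y g\<close> by \<open>1\<close> minus a multiple of
  \<open>GCs GC\<close>: the constant shortens the word by two and disappears in the filtration, and
  the quadratic term is again normal after scalar commutations.\<close>

lemma NF_Cons:
  assumes q: "q \<noteq> 0" and w: "w \<in> NF N"
  shows "\<exists>z. \<exists>w'\<in>NF (Suc N). delta (y # w) - fscale z (delta w') \<in> Gr q (Suc N)"
proof -
  have key: "\<exists>z. \<exists>w'\<in>NF (Suc N). delta (y # w) - fscale z (delta w') \<in> Gr q (Suc N)"
    if v: "v \<in> NF M" "w = g # v" "Suc M = N"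
      and rel: "delta [y, g] + fscale c (delta [GCs, GC]) - delta [] \<in> rel_ideal q" for v M g c
  proof -
    obtain z w' where 1: "w' \<in> NF (Suc N)" "delta (GCs # GC # v) - fscale z (delta w') \<in> rel_ideal q"
      using NF_Cons_cc[OF q v(1)] v(3) by blast
    have "fmul (delta [y, g] + fscale c (delta [GCs, GC]) - delta []) (delta v) \<in> rel_ideal q"
      by (intro rel_ideal_mult rel delta_FS)
    then have 2: "delta (y # w) + fscale c (delta (GCs # GC # v)) - delta v \<in> rel_ideal q"
      using v by (simp add: fmul_diff_left fmul_add_left fmul_scale_left)
    have "delta (y # w) - fscale (- c * z) (delta w') =
       (delta (y # w) + fscale c (delta (GCs # GC # v)) - delta v)
       - fscale c (delta (GCs # GC # v) - fscale z (delta w')) + delta v"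
      by (simp add: fun_eq_iff fun_ops fscale_def algebra_simps)
    also have "\<dots> \<in> Gr q (Suc N)"
      using NF_length[OF v(1)] v(3) by (intro Gr_closed rel_ideal_Gr[OF 1(2)] rel_ideal_Gr[OF 2] delta_Gr) auto
    finally show ?thesis using 1(1) by blast
  qed
  obtain m j k g where w': "w = replicate m g @ replicate j GC @ replicate k GCs" "g \<in> {GA, GAs}" "m + j + k = N"
    using w by (auto simp: NF_def)
  have triv: ?thesis if "y # w \<in> NF (Suc N)"
    using that by (intro exI[of _ 1] bexI[of _ "y # w"]) (auto simp: Gr_closed)
  show ?thesis
  proof (cases "y \<in> {GC, GCs}")
    case True
    then show ?thesis using NF_Cons_c[OF q w True] rel_ideal_Gr by blast
  next
    case False
    then have y: "y \<in> {GA, GAs}" by (cases y) auto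
    show ?thesis
    proof (cases "m = 0 \<or> g = y")
      case True
      then have "y # w = replicate (Suc m) y @ replicate j GC @ replicate k GCs" using w' by auto
      then have "y # w \<in> NF (Suc N)" using w' y by (intro NF_I[of _ "Suc m" y j k]) auto
      then show ?thesis by (rule triv)
    next
      case False
      then obtain m' where m: "m = Suc m'" by (cases m) auto
      define v where "v = replicate m' g @ replicate j GC @ replicate k GCs"
      have v: "v \<in> NF (m' + j + k)" "w = g # v" "Suc (m' + j + k) = N"
        using w' m unfolding v_def by (auto intro: NF_I)
      consider "y = GA" "g = GAs" | "y = GAs" "g = GA" using False y w'(2) by auto
      then show ?thesis
      proof cases
        case 1
        then show ?thesis using key[OF v, of "complex_of_real (q\<^sup>2)"] relator_mem(2)[of q] by simp
      next
        case 2
        then show ?thesis using key[OF v, of 1] relator_mem(1)[of q] by simp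
      qed
    qed
  qed
qed

lemma word_NF:
  assumes q: "q \<noteq> 0"
  shows "\<exists>z. \<exists>w'\<in>NF (length w). delta w - fscale z (delta w') \<in> Gr q (length w)"
proof (induct w)
  case Nil
  show ?case by (rule exI[of _ 1], rule bexI[of _ "[]"]) (auto simp: Gr_closed NF_def)
next
  case (Cons y w)
  then obtain z w' where 1: "w' \<in> NF (length w)" "delta w - fscale z (delta w') \<in> Gr q (length w)" by blast
  obtain z' w'' where 2: "w'' \<in> NF (Suc (length w))" "delta (y # w') - fscale z' (delta w'') \<in> Gr q (Suc (length w))"
    using NF_Cons[OF q 1(1)] by blast
  have "fmul (delta [y]) (delta w - fscale z (delta w')) \<in> Gr q (Suc (length w))"
    by (rule Gr_Cons[OF 1(2)])
  then have 3: "delta (y # w) - fscale z (delta (y # w')) \<in> Gr q (Suc (length w))"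
    by (simp add: fmul_diff_right fmul_scale_right)
  have "delta (y # w) - fscale (z * z') (delta w'') =
    (delta (y # w) - fscale z (delta (y # w'))) + fscale z (delta (y # w') - fscale z' (delta w''))"
    by (simp add: fv.scale_right_diff_distrib)
  also have "\<dots> \<in> Gr q (Suc (length w))" by (intro Gr_closed 2 3)
  finally show ?case using 2(1) by auto
qed

lemma Gr_Suc_NF:
  assumes q: "q \<noteq> 0" and x: "x \<in> Gr q (Suc N)"
  shows "\<exists>t. x - (\<Sum>w\<in>NF N. fscale (t w) (delta w)) \<in> Gr q N"
proof -
  define W where "W = {x. \<exists>t. x - (\<Sum>w\<in>NF N. fscale (t w) (delta w)) \<in> Gr q N}"
  have "fv.subspace W"
    unfolding fv.subspace_def W_def mem_Collect_eq
  proof (intro conjI ballI allI)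
    show "\<exists>t. 0 - (\<Sum>w\<in>NF N. fscale (t w) (delta w)) \<in> Gr q N"
      by (rule exI[of _ "\<lambda>w. 0"]) (simp add: Gr_closed)
  next
    fix x y assume "x \<in> {x. \<exists>t. x - (\<Sum>w\<in>NF N. fscale (t w) (delta w)) \<in> Gr q N}"
      "y \<in> {x. \<exists>t. x - (\<Sum>w\<in>NF N. fscale (t w) (delta w)) \<in> Gr q N}"
    then obtain s t where "x - (\<Sum>w\<in>NF N. fscale (s w) (delta w)) \<in> Gr q N"
      "y - (\<Sum>w\<in>NF N. fscale (t w) (delta w)) \<in> Gr q N" by blast
    from Gr_closed(1)[OF this]
    show "\<exists>t. x + y - (\<Sum>w\<in>NF N. fscale (t w) (delta w)) \<in> Gr q N"
      by (intro exI[of _ "\<lambda>w. s w + t w"])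
         (simp add: fv.scale_left_distrib sum.distrib algebra_simps)
  next
    fix c x assume "x \<in> {x. \<exists>t. x - (\<Sum>w\<in>NF N. fscale (t w) (delta w)) \<in> Gr q N}"
    then obtain s where "x - (\<Sum>w\<in>NF N. fscale (s w) (delta w)) \<in> Gr q N" by blast
    from Gr_closed(3)[OF this, of c]
    show "\<exists>t. fscale c x - (\<Sum>w\<in>NF N. fscale (t w) (delta w)) \<in> Gr q N"
      by (intro exI[of _ "\<lambda>w. c * s w"]) (simp add: fv.scale_right_diff_distrib fv.scale_sum_right)
  qed
  note subW = this
  have GW: "x \<in> W" if "x \<in> Gr q N" for x
    using that unfolding W_def by (auto intro!: exI[of _ "\<lambda>w. 0"])
  have dW: "delta w \<in> W" if "length w \<le> N" for w
  proof (cases "length w = N")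
    case True
    then obtain z w' where *: "w' \<in> NF N" "delta w - fscale z (delta w') \<in> Gr q N"
      using word_NF[OF q, of w] by auto
    have "(\<Sum>v\<in>NF N. fscale (if v = w' then z else 0) (delta v)) = (\<Sum>v\<in>{w'}. fscale (if v = w' then z else 0) (delta v))"
      using *(1) finite_NF by (intro sum.mono_neutral_right) auto
    then have "delta w - (\<Sum>v\<in>NF N. fscale (if v = w' then z else 0) (delta v)) \<in> Gr q N"
      using * by simp
    then show ?thesis unfolding W_def mem_Collect_eq by (rule exI[of _ "\<lambda>v. if v = w' then z else 0"])
  next
    case False
    then show ?thesis using that by (intro GW delta_Gr) auto
  qed
  obtain y z where *: "x = y + z" "y \<in> FS" "\<forall>w. y w \<noteq> 0 \<longrightarrow> length w < Suc N" "z \<in> rel_ideal q"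
    using x unfolding Gr_def by blast
  have "y \<in> W"
    by (subst FS_expand[OF *(2)]) (use * in \<open>auto intro!: fv.subspace_sum[OF subW] fv.subspace_scale[OF subW] dW\<close>)
  moreover have "z \<in> W" using * rel_ideal_Gr GW by blast
  ultimately have "x \<in> W" using * fv.subspace_add[OF subW] by blast
  then show ?thesis by (simp add: W_def)
qed

section \<open>The separating functionals\<close>

abbreviation RP :: "real \<Rightarrow> (gen \<Rightarrow> complex) \<Rightarrow> nat \<Rightarrow> fa \<Rightarrow> fa" where
  "RP q s k \<equiv> (RS q s) ^^ k"

lemma RP_FS [simp, intro]: "x \<in> FS \<Longrightarrow> RP q s k x \<in> FS"
  by (induct k) auto

lemma RP_add: "x \<in> FS \<Longrightarrow> y \<in> FS \<Longrightarrow> RP q s k (x + y) = RP q s k x + RP q s k y"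
  by (induct k) (simp_all add: RS_add)
lemma RP_diff: "x \<in> FS \<Longrightarrow> y \<in> FS \<Longrightarrow> RP q s k (x - y) = RP q s k x - RP q s k y"
  by (induct k) (simp_all add: RS_diff)
lemma RP_scale: "RP q s k (fscale c x) = fscale c (RP q s k x)"
  by (induct k) (simp_all add: RS_scale)
lemma RP_sum: "(\<And>i. i \<in> I \<Longrightarrow> F i \<in> FS) \<Longrightarrow> RP q s k (sum F I) = (\<Sum>i\<in>I. RP q s k (F i))"
  by (induct k) (simp_all add: RS_sum)
lemma RP_ideal:
  "q \<noteq> 0 \<Longrightarrow> s = sE q \<or> s = sF q \<Longrightarrow> x \<in> rel_ideal q \<Longrightarrow> RP q s k x \<in> rel_ideal q"
  by (induct k) (simp_all add: RS_ideal)

definition om :: "real \<Rightarrow> nat \<Rightarrow> nat \<Rightarrow> nat \<Rightarrow> fa \<Rightarrow> complex" where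
  "om q N i j x = ev eps (RP q (sF q) i (RP q (sE q) N (RP q (sF q) j x)))"

lemma om_add: "x \<in> FS \<Longrightarrow> y \<in> FS \<Longrightarrow> om q N i j (x + y) = om q N i j x + om q N i j y"
  and om_diff: "x \<in> FS \<Longrightarrow> y \<in> FS \<Longrightarrow> om q N i j (x - y) = om q N i j x - om q N i j y"
  and om_scale: "om q N i j (fscale c x) = c * om q N i j x"
  and om_sum: "(\<And>l. l \<in> I \<Longrightarrow> F l \<in> FS) \<Longrightarrow> om q N i j (sum F I) = (\<Sum>l\<in>I. om q N i j (F l))"
  unfolding om_def by (simp_all add: RP_add RP_diff RP_scale RP_sum ev_FS_add ev_FS_diff ev_fscale ev_FS_sum)

lemma om_ideal: "q \<noteq> 0 \<Longrightarrow> x \<in> rel_ideal q \<Longrightarrow> om q N i j x = 0"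
  unfolding om_def by (intro tor_kills[of _ q] RP_ideal) auto

lemma RS_support: "RS q s x v \<noteq> 0 \<Longrightarrow> \<exists>w. x w \<noteq> 0 \<and> skw q s w v \<noteq> 0"
proof (rule ccontr)
  assume *: "RS q s x v \<noteq> 0" "\<nexists>w. x w \<noteq> 0 \<and> skw q s w v \<noteq> 0"
  have "RS q s x v = ev (\<lambda>w. skw q s w v) x" by (simp add: RS_def lin_def)
  also have "\<dots> = ev (\<lambda>w. 0) x" by (rule ev_cong) (use * in auto)
  finally show False using * by simp
qed

text \<open>Left weight, invariant under the right operators.\<close>
definition lw :: "gen list \<Rightarrow> int" where
  "lw w = sum_list (map (\<lambda>x. if x \<in> {GA, GCs} then 1 else - 1) w)"

lemma lw_simps [simp]: "lw [] = 0" "lw (x # w) = (if x \<in> {GA, GCs} then 1 else - 1) + lw w"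
  "lw (u @ v) = lw u + lw v"
  by (simp_all add: lw_def)

lemma skw_lw: "skw q s w v \<noteq> 0 \<Longrightarrow> lw v = lw w \<and> length v = length w"
proof -
  assume "skw q s w v \<noteq> 0"
  then obtain u x u' where "w = u @ x # u'" "v = u @ flip x # u'" using skw_support by blast
  then show ?thesis by (cases x) auto
qed

lemma RP_support:
  "RP q (sE q) k x v \<noteq> 0 \<Longrightarrow> \<exists>w. x w \<noteq> 0 \<and> lw v = lw w \<and> length v = length w \<and> wt v = wt w + 2 * int k"
  "RP q (sF q) k x v \<noteq> 0 \<Longrightarrow> \<exists>w. x w \<noteq> 0 \<and> lw v = lw w \<and> length v = length w \<and> wt v = wt w - 2 * int k"
proof (induct k arbitrary: v)
  case (Suc k)
  {
    case 1
    then obtain u where u: "RP q (sE q) k x u \<noteq> 0" "skw q (sE q) u v \<noteq> 0"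
      using RS_support[of q "sE q" "RP q (sE q) k x" v] by auto
    show ?case using Suc(1)[OF u(1)] skw_lw[OF u(2)] skw_sE_wt[OF u(2)] by auto
  next
    case 2
    then obtain u where u: "RP q (sF q) k x u \<noteq> 0" "skw q (sF q) u v \<noteq> 0"
      using RS_support[of q "sF q" "RP q (sF q) k x" v] by auto
    show ?case using Suc(2)[OF u(1)] skw_lw[OF u(2)] skw_sF_wt[OF u(2)] by auto
  }
qed auto

lemma abs_wt_le: "\<bar>wt w\<bar> \<le> int (length w)"
proof (induct w)
  case (Cons x w)
  then show ?case by (cases x) auto
qed simp

lemma eps_lw: "eps w \<noteq> 0 \<Longrightarrow> lw w = wt w"
  by (induct w) (auto simp: tor_Cons split: if_splits)

text \<open>The bound on the weights forces length at least \<open>N\<close>, and at length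
  \<open>N\<close> it fixes the right weight as \<open>-N\<close> before \<open>E^N\<close> and
  \<open>N\<close> after it. The operators preserve the left weight, and the counit sees only words
  whose two weights agree; so the final right weight \<open>N - 2 i\<close> is the left weight of
  \<open>w\<close>.\<close>

lemma om_support:
  assumes "om q N i j x \<noteq> 0"
  shows "\<exists>w. x w \<noteq> 0 \<and> N \<le> length w \<and> (length w = N \<longrightarrow> wt w = 2 * int j - int N \<and> lw w = int N - 2 * int i)"
proof -
  have "\<exists>v3. RP q (sF q) i (RP q (sE q) N (RP q (sF q) j x)) v3 \<noteq> 0 \<and> eps v3 \<noteq> 0"
  proof (rule ccontr)
    assume "\<not> ?thesis"
    then have "om q N i j x = ev (\<lambda>v. 0) (RP q (sF q) i (RP q (sE q) N (RP q (sF q) j x)))"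
      unfolding om_def by (intro ev_cong) auto
    then show False using assms by simp
  qed
  then obtain v3 where v3: "RP q (sF q) i (RP q (sE q) N (RP q (sF q) j x)) v3 \<noteq> 0" "eps v3 \<noteq> 0" by blast
  obtain v2 where v2: "RP q (sE q) N (RP q (sF q) j x) v2 \<noteq> 0" "lw v3 = lw v2" "length v3 = length v2"
    "wt v3 = wt v2 - 2 * int i" using RP_support(2)[OF v3(1)] by blast
  obtain v1 where v1: "RP q (sF q) j x v1 \<noteq> 0" "lw v2 = lw v1" "length v2 = length v1"
    "wt v2 = wt v1 + 2 * int N" using RP_support(1)[OF v2(1)] by blast
  obtain w where w: "x w \<noteq> 0" "lw v1 = lw w" "length v1 = length w" "wt v1 = wt w - 2 * int j"
    using RP_support(2)[OF v1(1)] by blast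
  show ?thesis using w v1 v2 eps_lw[OF v3(2)] abs_wt_le[of v1] abs_wt_le[of v2] by (intro exI[of _ w]) auto
qed

lemma om_Gr:
  assumes q: "q \<noteq> 0" and x: "x \<in> Gr q N" shows "om q N i j x = 0"
proof -
  obtain y z where *: "x = y + z" "y \<in> FS" "\<forall>w. y w \<noteq> 0 \<longrightarrow> length w < N" "z \<in> rel_ideal q"
    using x unfolding Gr_def by blast
  have "om q N i j y = 0" using om_support[of q N i j y] *(3) by fastforce
  then show ?thesis using * om_ideal[OF q] rel_ideal_FS by (simp add: om_add)
qed

text \<open>The symmetric quantum integer
  \<open>\<kappa>^(k-1) + \<kappa>^(k-3) + ... + \<kappa>^(1-k)\<close>.\<close>

fun qn :: "complex \<Rightarrow> nat \<Rightarrow> complex" where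
  "qn \<kappa> 0 = 0" | "qn \<kappa> (Suc k) = \<kappa> ^ k + qn \<kappa> k / \<kappa>"

text \<open>Multiplication by \<open>\<kappa> ^ k\<close> leaves even powers of a real number, hence
  something positive, also when \<open>q\<close> is negative.\<close>

lemma qn_nonzero:
  assumes "\<kappa> = complex_of_real r" "r \<noteq> 0" shows "qn \<kappa> (Suc k) \<noteq> 0"
proof -
  have "\<exists>t>0. qn \<kappa> (Suc k) * \<kappa> ^ k = complex_of_real t"
  proof (induct k)
    case 0
    show ?case by (rule exI[of _ 1]) simp
  next
    case (Suc k)
    then obtain t where t: "t > 0" "qn \<kappa> (Suc k) * \<kappa> ^ k = complex_of_real t" by blast
    have "qn \<kappa> (Suc (Suc k)) * \<kappa> ^ Suc k = (\<kappa> ^ Suc k)\<^sup>2 + qn \<kappa> (Suc k) * \<kappa> ^ k"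
      unfolding qn.simps(2)[of \<kappa> "Suc k"] using assms by (simp add: field_simps power2_eq_square del: qn.simps)
    also have "\<dots> = complex_of_real ((r ^ Suc k)\<^sup>2 + t)" unfolding t(2) by (simp add: assms(1))
    finally have "qn \<kappa> (Suc (Suc k)) * \<kappa> ^ Suc k = complex_of_real ((r ^ Suc k)\<^sup>2 + t)" .
    moreover have "(r ^ Suc k)\<^sup>2 + t > 0" using t by (simp add: add_nonneg_pos)
    ultimately show ?case by blast
  qed
  then show ?thesis by (metis mult_zero_left of_real_eq_0_iff order_less_irrefl)
qed

lemma kap_flip: "kap q (flip x) = 1 / kap q x"
  by (cases x) auto

lemma kap_real: "\<exists>r. kap q x = complex_of_real r \<and> (q \<noteq> 0 \<longrightarrow> r \<noteq> 0)"
  by (cases x) (auto intro: exI[of _ q] exI[of _ "1 / q"])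

lemma RS_Cons:
  "y \<in> FS \<Longrightarrow> RS q s (fmul (delta [x]) y) =
     fscale (s x) (fmul (delta [flip x]) y) + fscale (kap q x) (fmul (delta [x]) (RS q s y))"
  by (simp add: RS_fmul fmul_scale_left)

text \<open>Iterated Leibniz rule. By the hypothesis on \<open>s\<close> an active letter is
  inactive after its flip, so \<open>x\<close> is hit at most once, and the \<open>k\<close>
  possible moments add up to a quantum integer. At \<open>k = 0\<close> the truncated
  \<open>k - 1\<close> is harmless because \<open>qn\<close> vanishes.\<close>

lemma RP_Cons:
  assumes q: "q \<noteq> 0" and y: "y \<in> FS" and s: "s x * s (flip x) = 0"
  shows "RP q s k (fmul (delta [x]) y) = fscale (kap q x ^ k) (fmul (delta [x]) (RP q s k y))
    + fscale (s x * qn (kap q x) k) (fmul (delta [flip x]) (RP q s (k - 1) y))"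
proof (induct k)
  case (Suc k)
  define Z where "Z = RP q s (k - 1) y"
  have Z: "k > 0 \<Longrightarrow> RS q s Z = RP q s k y" and ZF: "Z \<in> FS"
    unfolding Z_def by (cases k) (auto simp: y)
  have "RP q s (Suc k) (fmul (delta [x]) y) =
     fscale (kap q x ^ k) (RS q s (fmul (delta [x]) (RP q s k y)))
     + fscale (s x * qn (kap q x) k) (RS q s (fmul (delta [flip x]) Z))"
    using y ZF unfolding Z_def by (simp add: Suc RS_add RS_scale fmul_FS FS_closed)
  also have "fscale (s x * qn (kap q x) k) (RS q s (fmul (delta [flip x]) Z)) =
     fscale (s x * qn (kap q x) k / kap q x) (fmul (delta [flip x]) (RP q s k y))"
  proof (cases "k = 0")
    case False
    have "s x * qn (kap q x) k * s (flip x) = 0" using s by auto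
    moreover have "fscale (s x * qn (kap q x) k) (RS q s (fmul (delta [flip x]) Z)) =
      fscale (s x * qn (kap q x) k * s (flip x)) (fmul (delta [flip (flip x)]) Z)
      + fscale (s x * qn (kap q x) k * (1 / kap q x)) (fmul (delta [flip x]) (RP q s k y))"
      using Z[OF False[THEN neq0_conv[THEN iffD1]]]
      by (simp only: RS_Cons[OF ZF] fv.scale_right_distrib fv.scale_scale kap_flip)
    ultimately show ?thesis by simp
  qed simp
  also have "fscale (kap q x ^ k) (RS q s (fmul (delta [x]) (RP q s k y))) =
    fscale (s x * kap q x ^ k) (fmul (delta [flip x]) (RP q s k y))
    + fscale (kap q x ^ Suc k) (fmul (delta [x]) (RP q s (Suc k) y))"
    using y by (simp add: RS_Cons fv.scale_right_distrib mult_ac)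
  finally show ?case
    by (simp add: distrib_left fv.scale_left_distrib add_ac mult_ac)
qed simp

definition activ :: "(gen \<Rightarrow> complex) \<Rightarrow> gen list \<Rightarrow> nat" where
  "activ s w = length (filter (\<lambda>x. s x \<noteq> 0) w)"

text \<open>Each active letter is flipped once, so all are flipped after \<open>activ s w\<close>
  applications. The vanishing clause belongs to the induction: for a new active letter it removes
  the first term of \<open>RP_Cons\<close>.\<close>

lemma RP_full:
  assumes q: "q \<noteq> 0" and s: "\<And>x. s x * s (flip x) = 0"
  shows "(\<exists>C. C \<noteq> 0 \<and> RP q s (activ s w) (delta w) = fscale C (delta (map (\<lambda>x. if s x \<noteq> 0 then flip x else x) w)))
    \<and> RP q s (Suc (activ s w)) (delta w) = 0"
proof (induct w)
  case Nil
  show ?case by (auto simp: activ_def intro!: exI[of _ 1])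
next
  case (Cons x w)
  then obtain C where C: "C \<noteq> 0" "RP q s (activ s w) (delta w) = fscale C (delta (map (\<lambda>x. if s x \<noteq> 0 then flip x else x) w))"
    and Z: "RP q s (Suc (activ s w)) (delta w) = 0" by blast
  have cons: "RP q s k (delta (x # w)) = fscale (kap q x ^ k) (fmul (delta [x]) (RP q s k (delta w)))
    + fscale (s x * qn (kap q x) k) (fmul (delta [flip x]) (RP q s (k - 1) (delta w)))" for k
    using RP_Cons[of q "delta w" s x k, OF q delta_FS s] by simp
  obtain r where r: "kap q x = complex_of_real r" "r \<noteq> 0" using kap_real q by blast
  show ?case
  proof (cases "s x = 0")
    case True
    then have a: "activ s (x # w) = activ s w" by (simp add: activ_def)
    have "RP q s (activ s w) (delta (x # w)) = fscale (kap q x ^ activ s w * C)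
        (delta (map (\<lambda>x. if s x \<noteq> 0 then flip x else x) (x # w)))"
      using True C by (simp add: cons fmul_scale_right)
    moreover have "RP q s (Suc (activ s w)) (delta (x # w)) = 0"
      using True Z by (simp only: cons) simp
    moreover have "kap q x ^ activ s w * C \<noteq> 0" using C(1) r by simp
    ultimately show ?thesis unfolding a by blast
  next
    case False
    then have a: "activ s (x # w) = Suc (activ s w)" by (simp add: activ_def)
    have ZZ: "RP q s (Suc (Suc (activ s w))) (delta w) = 0"
      using Z RS_scale[of q s 0 0] by simp
    have "RP q s (Suc (activ s w)) (delta (x # w)) = fscale (s x * qn (kap q x) (Suc (activ s w)) * C)
        (delta (map (\<lambda>x. if s x \<noteq> 0 then flip x else x) (x # w)))"
      using False by (simp only: cons Z diff_Suc_1 C(2)) (simp add: fmul_scale_right)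
    moreover have "RP q s (Suc (Suc (activ s w))) (delta (x # w)) = 0"
      by (simp only: cons Z ZZ diff_Suc_1) simp
    moreover have "s x * qn (kap q x) (Suc (activ s w)) * C \<noteq> 0"
      using False C(1) qn_nonzero[OF r] by simp
    ultimately show ?thesis unfolding a by blast
  qed
qed

text \<open>The counit kills \<open>GC\<close> and \<open>GCs\<close>. With as many applications as
  there are \<open>GC\<close>, the only surviving term flips each \<open>GC\<close> to
  \<open>GAs\<close> and leaves each \<open>GA\<close> alone; its factors are powers of
  \<open>q\<close> and quantum integers.\<close>

lemma eps_RP_F:
  assumes q: "q \<noteq> 0" and "set v \<subseteq> {GA, GC}"
  shows "ev eps (RP q (sF q) (length (filter ((=) GC) v)) (delta v)) \<noteq> 0"
  using assms(2)
proof (induct v)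
  case (Cons x v)
  let ?i = "length (filter ((=) GC) v)"
  have s: "sF q x * sF q (flip x) = 0" for x by (cases x) auto
  have cons: "RP q (sF q) k (delta (x # v)) = fscale (kap q x ^ k) (fmul (delta [x]) (RP q (sF q) k (delta v)))
    + fscale (sF q x * qn (kap q x) k) (fmul (delta [flip x]) (RP q (sF q) (k - 1) (delta v)))" for k
    using RP_Cons[of q "delta v" "sF q" x k, OF q delta_FS s] by simp
  have e: "ev eps (fmul (delta [y]) z) = (if y \<in> {GA, GAs} then ev eps z else 0)" if "z \<in> FS" for y z
    using that by (auto simp: ev_fmul tor_Cons)
  have IH: "ev eps (RP q (sF q) ?i (delta v)) \<noteq> 0" using Cons by simp
  consider "x = GA" | "x = GC" using Cons.prems by auto
  then show ?case
  proof cases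
    case 1
    have "ev eps (RP q (sF q) ?i (delta (x # v))) = complex_of_real q ^ ?i * ev eps (RP q (sF q) ?i (delta v))"
      unfolding cons using 1 by (simp add: ev_FS_add ev_FS_diff FS_closed fmul_FS ev_fscale e)
    then show ?thesis using IH q 1 by simp
  next
    case 2
    have "ev eps (RP q (sF q) (Suc ?i) (delta (x # v))) = qn q (Suc ?i) * ev eps (RP q (sF q) ?i (delta v))"
      unfolding cons using 2 by (simp add: ev_FS_add FS_closed fmul_FS ev_fscale e del: funpow.simps qn.simps)
    then show ?thesis using IH q 2 qn_nonzero[of "complex_of_real q" q ?i] by simp
  qed
qed (simp add: ev_delta)

text \<open>The first stage flips every letter active for \<open>F\<close>, which leaves only
  \<open>GAs\<close> and \<open>GCs\<close>. Then all letters are active for \<open>E\<close>, and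
  the second stage flips them all to \<open>GC\<close> and \<open>GA\<close>, where
  \<open>eps_RP_F\<close> applies.\<close>

lemma om_delta_nonzero:
  assumes q: "q \<noteq> 0"
  shows "om q (length w) (length (filter (\<lambda>x. x \<in> {GC, GAs}) w)) (length (filter (\<lambda>x. x \<in> {GA, GC}) w)) (delta w) \<noteq> 0"
proof -
  let ?w1 = "map (\<lambda>x. if sF q x \<noteq> 0 then flip x else x) w"
  let ?w2 = "map (\<lambda>x. if sE q x \<noteq> 0 then flip x else x) ?w1"
  have sE: "sE q x * sE q (flip x) = 0" and sF: "sF q x * sF q (flip x) = 0" for x by (cases x; auto)+
  have f1: "sE q (if sF q x \<noteq> 0 then flip x else x) \<noteq> 0" for x using q by (cases x) auto
  have f2: "(if sE q (if sF q x \<noteq> 0 then flip x else x) \<noteq> 0 then flip (if sF q x \<noteq> 0 then flip x else x)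
      else (if sF q x \<noteq> 0 then flip x else x)) = (if x \<in> {GC, GAs} then GC else GA)" for x
    using q by (cases x) auto
  have f3: "sF q x \<noteq> 0 \<longleftrightarrow> x \<in> {GA, GC}" for x using q by (cases x) auto
  have aF: "activ (sF q) w = length (filter (\<lambda>x. x \<in> {GA, GC}) w)"
    unfolding activ_def f3 ..
  have aE: "activ (sE q) ?w1 = length w"
  proof -
    have "filter (\<lambda>x. sE q x \<noteq> 0) ?w1 = ?w1"
      unfolding filter_id_conv using f1 by (metis (no_types, lifting) image_iff list.set_map)
    then show ?thesis by (simp only: activ_def length_map)
  qed
  have w2: "?w2 = map (\<lambda>x. if x \<in> {GC, GAs} then GC else GA) w"
    unfolding map_map by (intro map_cong refl) (simp only: comp_def f2)
  have cnt: "length (filter ((=) GC) ?w2) = length (filter (\<lambda>x. x \<in> {GC, GAs}) w)"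
    unfolding w2 filter_map length_map by (rule arg_cong[of _ _ length], rule filter_cong) auto
  obtain C1 where C1: "C1 \<noteq> 0" "RP q (sF q) (activ (sF q) w) (delta w) = fscale C1 (delta ?w1)"
    using RP_full[of q "sF q" w, OF q sF] by blast
  obtain C2 where C2: "C2 \<noteq> 0" "RP q (sE q) (activ (sE q) ?w1) (delta ?w1) = fscale C2 (delta ?w2)"
    using RP_full[of q "sE q" ?w1, OF q sE] by blast
  have "set ?w2 \<subseteq> {GA, GC}" unfolding w2 by auto
  then have "ev eps (RP q (sF q) (length (filter ((=) GC) ?w2)) (delta ?w2)) \<noteq> 0"
    by (rule eps_RP_F[OF q])
  then show ?thesis
    unfolding om_def cnt using C1 C2 by (simp only: aF aE RP_scale ev_fscale) simp
qed

lemma word_counts: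
  "lw w = int (length w) - 2 * int (length (filter (\<lambda>x. x \<in> {GC, GAs}) w))"
  "wt w = 2 * int (length (filter (\<lambda>x. x \<in> {GA, GC}) w)) - int (length w)"
proof (induct w)
  case (Cons x w)
  {
    case 1
    then show ?case using Cons by (cases x) auto
  next
    case 2
    then show ?case using Cons by (cases x) auto
  }
qed auto

text \<open>In a normal monomial the sum of the two weights gives the exponent of the torus letter,
  its sign telling \<open>GA\<close> from \<open>GAs\<close>; the difference of the weights and the
  degree give the other two exponents.\<close>

lemma NF_unique:
  assumes "v \<in> NF N" "w \<in> NF N" "wt v = wt w" "lw v = lw w" shows "v = w"
proof -
  have rep: "wt (replicate m y) = int m * wt1 y" "lw (replicate m y) = int m * (if y \<in> {GA, GCs} then 1 else - 1)" for m y
    by (induct m; simp add: algebra_simps)+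
  obtain m j k g where v: "v = replicate m g @ replicate j GC @ replicate k GCs" "g \<in> {GA, GAs}" "m + j + k = N"
    using assms unfolding NF_def by blast
  obtain m' j' k' g' where w: "w = replicate m' g' @ replicate j' GC @ replicate k' GCs" "g' \<in> {GA, GAs}" "m' + j' + k' = N"
    using assms unfolding NF_def by blast
  have "m = m' \<and> j = j' \<and> k = k' \<and> (m = 0 \<or> g = g')"
    using v(2,3) w(2,3) assms(3,4) unfolding v(1) w(1) by (auto simp: rep)
  then show ?thesis using v w by auto
qed

text \<open>The functional attached to a normal monomial \<open>v\<close> of degree \<open>N\<close>
  is nonzero on \<open>v\<close> and zero on the others, since the pair of weights determines
  \<open>v\<close>. So every coefficient of the leading part of \<open>x\<close> vanishes.\<close>

lemma Gr_descend:
  assumes q: "q \<noteq> 0" and x: "x \<in> Gr q (Suc N)"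
    and van: "\<And>i j. i \<le> N \<Longrightarrow> j \<le> N \<Longrightarrow> om q N i j x = 0"
  shows "x \<in> Gr q N"
proof -
  obtain t where t: "x - (\<Sum>w\<in>NF N. fscale (t w) (delta w)) \<in> Gr q N"
    using Gr_Suc_NF[OF q x] by blast
  have "t v = 0" if v: "v \<in> NF N" for v
  proof -
    let ?i = "length (filter (\<lambda>x. x \<in> {GC, GAs}) v)" and ?j = "length (filter (\<lambda>x. x \<in> {GA, GC}) v)"
    have lv: "length v = N" by (rule NF_length[OF v])
    have "0 = om q N ?i ?j (x - (\<Sum>w\<in>NF N. fscale (t w) (delta w)))"
      using om_Gr[OF q t] by simp
    also have "\<dots> = om q N ?i ?j x - (\<Sum>w\<in>NF N. t w * om q N ?i ?j (delta w))"
      using Gr_FS[OF x] by (simp add: om_diff om_sum om_scale FS_closed)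
    also have "(\<Sum>w\<in>NF N. t w * om q N ?i ?j (delta w)) = (\<Sum>w\<in>{v}. t w * om q N ?i ?j (delta w))"
    proof (rule sum.mono_neutral_right)
      show "\<forall>w\<in>NF N - {v}. t w * om q N ?i ?j (delta w) = 0"
      proof (intro ballI, rule ccontr)
        fix w assume w: "w \<in> NF N - {v}" "t w * om q N ?i ?j (delta w) \<noteq> 0"
        then have "om q N ?i ?j (delta w) \<noteq> 0" by simp
        from om_support[OF this] w have "wt w = wt v \<and> lw w = lw v"
          using word_counts[of v] lv NF_length[of w N] by (auto simp: delta_def split: if_splits)
        then show False using NF_unique[of w N v] w v by auto
      qed
    qed (use v finite_NF in auto)
    finally have "t v * om q N ?i ?j (delta v) = om q N ?i ?j x" by simp
    also have "\<dots> = 0" using lv by (intro van) (auto intro: order.trans[OF length_filter_le])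
    finally show "t v = 0" using om_delta_nonzero[OF q, of v] lv by simp
  qed
  then have "(\<Sum>w\<in>NF N. fscale (t w) (delta w)) = 0" by simp
  then show ?thesis using t by simp
qed

lemma Gr_descend_to:
  assumes q: "q \<noteq> 0" and x: "x \<in> FS"
    and van: "\<And>N i j. M \<le> N \<Longrightarrow> i \<le> N \<Longrightarrow> j \<le> N \<Longrightarrow> om q N i j x = 0"
  shows "x \<in> Gr q M"
proof -
  obtain K where K: "x \<in> Gr q K" using FS_in_some_Gr[OF x] by blast
  have "x \<in> Gr q (M + k) \<Longrightarrow> x \<in> Gr q M" for k
    by (induct k) (use Gr_descend[OF q _ van] in auto)
  moreover have "x \<in> Gr q (M + K)" using Gr_mono[OF _ K] by simp
  ultimately show ?thesis by blast
qed

text \<open>Membership in an ideal given by generators becomes a test by countably many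
  functionals.\<close>

lemma om_separates:
  assumes "q \<noteq> 0" "x \<in> FS" "\<And>N i j. om q N i j x = 0" shows "x \<in> rel_ideal q"
  using Gr_descend_to[of q x 0] assms by (simp add: Gr_0)

section \<open>Corepresentations as modules over the skew derivations\<close>

definition inner_d :: "nat \<Rightarrow> (nat \<Rightarrow> complex) \<Rightarrow> (nat \<Rightarrow> complex) \<Rightarrow> complex" where
  "inner_d d v w = (\<Sum>i<d. cnj (v i) * w i)"

lemma inner_d_self: "inner_d d v v = complex_of_real (\<Sum>i<d. (cmod (v i))\<^sup>2)"
  unfolding inner_d_def of_real_sum
  by (intro sum.cong refl) (metis complex_norm_square mult.commute of_real_power)

lemma inner_d_self_eq_0:
  assumes "inner_d d v v = 0" "i < d" shows "v i = 0"
proof -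
  have "(\<Sum>i<d. (cmod (v i))\<^sup>2) = 0" using assms(1) by (simp only: inner_d_self of_real_eq_0_iff)
  then have "(cmod (v i))\<^sup>2 = 0" using assms(2) by (subst (asm) sum_nonneg_eq_0_iff) auto
  then show ?thesis by simp
qed

lemma gstar_gstar [simp]: "gstar (gstar x) = x" by (cases x) (auto simp: gstar_def)

lemma rev_map_gstar_invol [simp]: "rev (map gstar (rev (map gstar w))) = w"
  by (simp add: rev_map comp_def)

lemma fstar_FS [intro]: "x \<in> FS \<Longrightarrow> fstar x \<in> FS"
proof -
  assume "x \<in> FS"
  then have "finite ((\<lambda>w. rev (map gstar w)) ` {w. x w \<noteq> 0})" by (simp add: FS_def)
  moreover have "{w. fstar x w \<noteq> 0} \<subseteq> (\<lambda>w. rev (map gstar w)) ` {w. x w \<noteq> 0}"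
  proof
    fix w assume "w \<in> {w. fstar x w \<noteq> 0}"
    then show "w \<in> (\<lambda>w. rev (map gstar w)) ` {w. x w \<noteq> 0}"
      by (intro image_eqI[of _ _ "rev (map gstar w)"]) (auto simp: fstar_def)
  qed
  ultimately show ?thesis unfolding FS_def mem_Collect_eq by (rule rev_finite_subset)
qed

lemma wt_star: "wt (rev (map gstar w)) = - wt w"
proof (induct w)
  case (Cons x w)
  then show ?case by (cases x) (auto simp: gstar_def)
qed simp

lemma tor_star: "tor h (rev (map gstar w)) = tor (\<lambda>k. h (- k)) w"
proof -
  have "gstar x \<in> {GA, GAs} \<longleftrightarrow> x \<in> {GA, GAs}" for x by (cases x) (auto simp: gstar_def)
  then have "set (rev (map gstar w)) \<subseteq> {GA, GAs} \<longleftrightarrow> set w \<subseteq> {GA, GAs}" by auto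
  then show ?thesis by (simp add: tor_def wt_star)
qed

lemma ev_tor_fstar: "x \<in> FS \<Longrightarrow> ev (tor h) (fstar x) = cnj (ev (tor (\<lambda>k. cnj (h (- k)))) x)"
proof -
  assume x: "x \<in> FS"
  let ?st = "\<lambda>w. rev (map gstar w)"
  have "ev (tor h) (fstar x) = (\<Sum>w | fstar x w \<noteq> 0. fstar x w * tor h w)" by (simp add: ev_def)
  also have "\<dots> = (\<Sum>w | x w \<noteq> 0. fstar x (?st w) * tor h (?st w))"
    by (rule sum.reindex_bij_witness[of _ ?st ?st]) (auto simp: fstar_def simp del: rev_map)
  also have "\<dots> = (\<Sum>w | x w \<noteq> 0. cnj (x w * tor (\<lambda>k. cnj (h (- k))) w))"
    by (intro sum.cong refl) (simp add: fstar_def tor_star, simp add: tor_def)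
  also have "\<dots> = cnj (ev (tor (\<lambda>k. cnj (h (- k)))) x)" by (simp add: ev_def)
  finally show ?thesis .
qed

lemma ev_tor_power_mult:
  assumes "x \<in> FS" "y \<in> FS" "\<rho> \<noteq> 0"
  shows "ev (tor (\<lambda>k. \<rho> powi k)) (fmul x y) = ev (tor (\<lambda>k. \<rho> powi k)) x * ev (tor (\<lambda>k. \<rho> powi k)) y"
proof -
  have "tor (\<lambda>k. \<rho> powi k) (u @ v) = tor (\<lambda>k. \<rho> powi k) u * tor (\<lambda>k. \<rho> powi k) v" for u v
    using assms(3) by (auto simp: tor_def power_int_add)
  then show ?thesis
    using assms by (simp add: ev_fmul ev_functional_scale ev_functional_scale_right)
qed

lemma ev_sum_lessThan: "\<forall>l<d. F l \<in> FS \<Longrightarrow> ev \<omega> (\<Sum>l<d. F l) = (\<Sum>l<d. ev \<omega> (F l))"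
  by (rule ev_FS_sum) auto

lemma RS_sum_lessThan: "\<forall>l<d. F l \<in> FS \<Longrightarrow> RS q s (\<Sum>l<d. F l) = (\<Sum>l<d. RS q s (F l))"
  by (rule RS_sum) auto

lemma sum_lessThan_FS: "\<forall>l<d. F l \<in> FS \<Longrightarrow> (\<Sum>l<d. F l) \<in> FS"
  by (rule FS_closed) auto

lemma sum_unit_mult:
  fixes f :: "nat \<Rightarrow> complex"
  shows "i < d \<Longrightarrow> (\<Sum>l<d. (if i = l then 1 else 0) * f l) = f i"
    "i < d \<Longrightarrow> (\<Sum>l<d. f l * (if l = i then 1 else 0)) = f i"
  by (simp_all add: if_distrib[of "\<lambda>x. x * _"] if_distrib[of "\<lambda>x. _ * x"] cong: if_cong)

locale corep =
  fixes q :: real and d :: nat and U :: "nat \<Rightarrow> nat \<Rightarrow> fa"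
  assumes q0: "q \<noteq> 0" and qm: "-1 < q" and qp: "q < 1" and uc: "unitary_corep q d U"
begin

lemma q2: "q\<^sup>2 \<noteq> 1" "0 < q\<^sup>2" "q\<^sup>2 < 1"
proof -
  show "q\<^sup>2 < 1" using qm qp by (metis abs_less_iff abs_square_less_1 minus_less_iff)
  then show "q\<^sup>2 \<noteq> 1" "0 < q\<^sup>2" using q0 by auto
qed

lemma U_FS [simp]: "i < d \<Longrightarrow> j < d \<Longrightarrow> U i j \<in> FS"
  using uc by (simp add: unitary_corep_def)

lemma corep_slice:
  assumes kills: "\<And>x. x \<in> rel_ideal q \<Longrightarrow> ev \<omega> x = 0" and ij: "i < d" "j < d"
  shows "sl \<omega> (Delta q (U i j)) - (\<Sum>k<d. fscale (ev \<omega> (U k j)) (U i k)) \<in> rel_ideal q"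
proof -
  have "Delta q (U i j) - (\<Sum>k<d. tens (U i k) (U k j)) \<in> tens_ideal q"
    using uc ij by (simp add: unitary_corep_def fsub2_eq fsum2_eq)
  from sl_tens_ideal[OF kills this]
  have mem: "sl \<omega> (Delta q (U i j) - (\<Sum>k<d. tens (U i k) (U k j))) \<in> rel_ideal q" by simp
  have ts: "tens (U i k) (U k j) \<in> fsupp" if "k \<in> {..<d}" for k using that ij by (simp add: ev_tens(1))
  have "sl \<omega> (Delta q (U i j) - (\<Sum>k<d. tens (U i k) (U k j)))
      = sl \<omega> (Delta q (U i j)) - (\<Sum>k<d. sl \<omega> (tens (U i k) (U k j)))"
    by (subst sl_diff[OF Delta_fsupp fsupp_sum], rule ts, assumption, subst sl_sum) (use ts in auto)
  also have "(\<Sum>k<d. sl \<omega> (tens (U i k) (U k j))) = (\<Sum>k<d. fscale (ev \<omega> (U k j)) (U i k))"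
    using ij by (intro sum.cong refl) (simp add: sl_tens)
  finally show ?thesis using mem by simp
qed

text \<open>Vectors are continued by \<open>0\<close> beyond \<open>d\<close>, so that operator
  identities are equalities of functions.\<close>

definition act :: "(gen list \<Rightarrow> complex) \<Rightarrow> (nat \<Rightarrow> complex) \<Rightarrow> nat \<Rightarrow> complex" where
  "act \<omega> v = (\<lambda>i. if i < d then \<Sum>k<d. ev \<omega> (U i k) * v k else 0)"

lemma conv_mat:
  assumes "\<And>x. x \<in> rel_ideal q \<Longrightarrow> ev \<omega> x = 0" "\<And>x. x \<in> rel_ideal q \<Longrightarrow> ev \<eta> x = 0" "i < d" "j < d"
  shows "ev \<eta> (sl \<omega> (Delta q (U i j))) = (\<Sum>k<d. ev \<eta> (U i k) * ev \<omega> (U k j))"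
proof -
  have "ev \<eta> (sl \<omega> (Delta q (U i j)) - (\<Sum>k<d. fscale (ev \<omega> (U k j)) (U i k))) = 0"
    by (intro assms(2) corep_slice assms)
  then show ?thesis
    using assms(3,4) by (simp add: ev_FS_diff ev_sum_lessThan sum_lessThan_FS FS_closed(3) ev_fscale mult.commute)
qed

text \<open>\<open>\<psi>\<close> is the convolution of \<open>\<eta>\<close> and
  \<open>\<omega>\<close>: a corepresentation is a module over the functionals that kill the
  ideal.\<close>

lemma act_act:
  assumes "\<And>x. x \<in> rel_ideal q \<Longrightarrow> ev \<omega> x = 0" "\<And>x. x \<in> rel_ideal q \<Longrightarrow> ev \<eta> x = 0"
    and "\<And>x. ev \<eta> (sl \<omega> (Delta q x)) = ev \<psi> x"
  shows "act \<eta> (act \<omega> v) = act \<psi> v"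
proof
  fix i
  have "(\<Sum>k<d. ev \<eta> (U i k) * (\<Sum>l<d. ev \<omega> (U k l) * v l)) = (\<Sum>l<d. ev \<psi> (U i l) * v l)" if "i < d"
  proof -
    have "(\<Sum>k<d. ev \<eta> (U i k) * (\<Sum>l<d. ev \<omega> (U k l) * v l))
      = (\<Sum>l<d. (\<Sum>k<d. ev \<eta> (U i k) * ev \<omega> (U k l)) * v l)"
      unfolding sum_distrib_left sum_distrib_right by (subst sum.swap) (simp add: mult.assoc)
    also have "\<dots> = (\<Sum>l<d. ev \<psi> (U i l) * v l)"
      using that by (intro sum.cong refl) (simp add: conv_mat[OF assms(1,2), symmetric] assms(3))
    finally show ?thesis .
  qed
  then show "act \<eta> (act \<omega> v) i = act \<psi> v i" by (simp add: act_def)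
qed

abbreviation actE where "actE \<equiv> act (skf q (sE q))"
abbreviation actF where "actF \<equiv> act (skf q (sF q))"

lemmas killsE = skf_kills[OF q0, of "sE q", simplified]
lemmas killsF = skf_kills[OF q0, of "sF q", simplified]

lemma act_tor_tor: "act (tor h) (act (tor h') v) = act (tor (\<lambda>k. h k * h' k)) v"
proof (rule act_act)
  have "h' (wt w) * tor h w = tor (\<lambda>k. h k * h' k) w" for w by (simp add: tor_def)
  then show "ev (tor h) (sl (tor h') (Delta q x)) = ev (tor (\<lambda>k. h k * h' k)) x" for x
    by (simp add: ev_sl_Delta_tor)
qed (auto intro: tor_kills)

text \<open>Both sides are the action of a single functional, because \<open>E\<close> raises the
  right weight by \<open>2\<close>.\<close>

lemma act_tor_E: "act (tor h) (actE v) = actE (act (tor (\<lambda>k. h (k + 2))) v)"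
proof -
  have "act (tor h) (actE v) = act (\<lambda>w. h (wt w + 2) * skf q (sE q) w) v"
    by (rule act_act) (auto intro: tor_kills killsE simp: sl_Delta_skf ev_RS ev_tor_skw)
  also have "\<dots> = actE (act (tor (\<lambda>k. h (k + 2))) v)"
    by (rule act_act[symmetric]) (auto intro: tor_kills killsE simp: ev_sl_Delta_tor)
  finally show ?thesis .
qed

lemma act_tor_F: "act (tor h) (actF v) = actF (act (tor (\<lambda>k. h (k - 2))) v)"
proof -
  have "act (tor h) (actF v) = act (\<lambda>w. h (wt w - 2) * skf q (sF q) w) v"
    by (rule act_act) (auto intro: tor_kills killsF simp: sl_Delta_skf ev_RS ev_tor_skw)
  also have "\<dots> = actF (act (tor (\<lambda>k. h (k - 2))) v)"
    by (rule act_act[symmetric]) (auto intro: tor_kills killsF simp: ev_sl_Delta_tor)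
  finally show ?thesis .
qed

lemma act_scale: "act \<omega> (\<lambda>i. c * v i) = (\<lambda>i. c * act \<omega> v i)"
  by (auto simp: act_def sum_distrib_left mult_ac)

lemma act_zero [simp]: "act \<omega> (\<lambda>i. 0) = (\<lambda>i. 0)"
  by (auto simp: act_def)

lemma act_sum: "act \<omega> (\<lambda>i. \<Sum>k\<in>K. v k i) = (\<lambda>i. \<Sum>k\<in>K. act \<omega> (v k) i)"
proof
  fix i
  have "(\<Sum>j<d. ev \<omega> (U i j) * (\<Sum>k\<in>K. v k j)) = (\<Sum>k\<in>K. \<Sum>j<d. ev \<omega> (U i j) * v k j)"
    unfolding sum_distrib_left by (rule sum.swap)
  then show "act \<omega> (\<lambda>i. \<Sum>k\<in>K. v k i) i = (\<Sum>k\<in>K. act \<omega> (v k) i)" by (simp add: act_def)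
qed

lemma act_functional:
  "act (\<lambda>w. c * f w) v = (\<lambda>i. c * act f v i)"
  "act (\<lambda>w. f w - g w) v = (\<lambda>i. act f v i - act g v i)"
  by (auto simp: act_def ev_functional_scale ev_functional_diff sum_distrib_left
      left_diff_distrib sum_subtractf mult.assoc)

lemma act_EF:
  "actE (actF v) = (\<lambda>i. actF (actE v) i / q\<^sup>2 +
     q / (1 - q\<^sup>2) * (act (tor (\<lambda>k. complex_of_real (q\<^sup>2) powi k)) v i - act eps v i))"
proof -
  have "actE (actF v) = act (\<lambda>w. ev (skf q (sE q)) (skw q (sF q) w)) v"
    by (rule act_act) (auto intro: killsE killsF simp: sl_Delta_skf ev_RS)
  moreover have "actF (actE v) = act (\<lambda>w. ev (skf q (sF q)) (skw q (sE q) w)) v"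
    by (rule act_act) (auto intro: killsE killsF simp: sl_Delta_skf ev_RS)
  moreover have "(\<lambda>w. ev (skf q (sE q)) (skw q (sF q) w) - 1 / q\<^sup>2 * ev (skf q (sF q)) (skw q (sE q) w))
     = (\<lambda>w. q / (1 - q\<^sup>2) * (tor (\<lambda>k. complex_of_real (q\<^sup>2) powi k) w - eps w))"
    using skf_commutation[OF q0 q2(1)] by (auto simp: fun_eq_iff)
  then have "act (\<lambda>w. ev (skf q (sE q)) (skw q (sF q) w) - 1 / q\<^sup>2 * ev (skf q (sF q)) (skw q (sE q) w)) v
     = act (\<lambda>w. q / (1 - q\<^sup>2) * (tor (\<lambda>k. complex_of_real (q\<^sup>2) powi k) w - eps w)) v" by simp
  ultimately show ?thesis
    unfolding act_functional by (auto simp: fun_eq_iff algebra_simps)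
qed

definition T :: "real \<Rightarrow> nat \<Rightarrow> nat \<Rightarrow> complex" where
  "T \<rho> i j = ev (tor (\<lambda>k. complex_of_real \<rho> powi k)) (U i j)"

text \<open>The torus character at real \<open>\<rho>\<close> takes on \<open>fstar x\<close> the
  conjugate of the value at \<open>1 / \<rho>\<close> on \<open>x\<close>, which explains the two
  parameters.\<close>

lemma T_unitary:
  assumes "\<rho> \<noteq> 0" "i < d" "j < d"
  shows "(\<Sum>k<d. cnj (T (1 / \<rho>) k i) * T \<rho> k j) = (if i = j then 1 else 0)"
proof -
  let ?\<phi> = "tor (\<lambda>k. complex_of_real \<rho> powi k)"
  have "(\<Sum>k<d. fmul (fstar (U k i)) (U k j)) - (if i = j then delta [] else (\<lambda>w. 0)) \<in> rel_ideal q"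
    using uc assms by (simp add: unitary_corep_def fsub_eq fsum_eq)
  from tor_kills[OF this, of "\<lambda>k. complex_of_real \<rho> powi k"]
  have "ev ?\<phi> ((\<Sum>k<d. fmul (fstar (U k i)) (U k j)) - (if i = j then delta [] else 0)) = 0"
    by (simp only: zero_fun_def)
  moreover have "(if i = j then delta [] else 0) \<in> FS" by (auto simp: FS_closed)
  moreover have "(\<Sum>k<d. fmul (fstar (U k i)) (U k j)) \<in> FS" using assms by (intro FS_closed fmul_FS fstar_FS) auto
  ultimately have "ev ?\<phi> (\<Sum>k<d. fmul (fstar (U k i)) (U k j)) = ev ?\<phi> (if i = j then delta [] else 0)"
    by (simp add: ev_FS_diff)
  also have "\<dots> = (if i = j then 1 else 0)" by simp
  also have "ev ?\<phi> (\<Sum>k<d. fmul (fstar (U k i)) (U k j)) = (\<Sum>k<d. ev ?\<phi> (fstar (U k i)) * ev ?\<phi> (U k j))"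
    using assms by (simp add: ev_sum_lessThan fmul_FS fstar_FS ev_tor_power_mult)
  also have "\<dots> = (\<Sum>k<d. cnj (T (1 / \<rho>) k i) * T \<rho> k j)"
  proof (intro sum.cong refl)
    fix k assume "k \<in> {..<d}"
    have "(\<lambda>k. cnj (complex_of_real \<rho> powi - k)) = (\<lambda>k. complex_of_real (1 / \<rho>) powi k)"
      by (auto simp: fun_eq_iff power_int_minus power_int_divide_distrib inverse_eq_divide)
    then show "ev ?\<phi> (fstar (U k i)) * ev ?\<phi> (U k j) = cnj (T (1 / \<rho>) k i) * T \<rho> k j"
      using \<open>k \<in> {..<d}\<close> assms by (simp add: ev_tor_fstar T_def)
  qed
  finally show ?thesis .
qed

lemma T_mult: "i < d \<Longrightarrow> j < d \<Longrightarrow> (\<Sum>k<d. T \<rho> i k * T \<sigma> k j) = T (\<rho> * \<sigma>) i j"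
  unfolding T_def
proof (subst conv_mat[symmetric])
  have "complex_of_real \<sigma> powi wt w * tor (\<lambda>k. complex_of_real \<rho> powi k) w
    = tor (\<lambda>k. complex_of_real (\<rho> * \<sigma>) powi k) w" for w
    by (simp add: tor_def power_int_mult_distrib)
  then show "ev (tor (\<lambda>k. complex_of_real \<rho> powi k)) (sl (tor (\<lambda>k. complex_of_real \<sigma> powi k)) (Delta q (U i j)))
    = ev (tor (\<lambda>k. complex_of_real (\<rho> * \<sigma>) powi k)) (U i j)"
    by (simp add: ev_sl_Delta_tor)
qed (auto intro: tor_kills)

text \<open>The counit axiom is derived: \<open>T 1\<close> is idempotent by \<open>T_mult\<close>
  and isometric by \<open>T_unitary\<close>, hence the identity.\<close>

lemma T_one:
  assumes "i < d" "j < d" shows "T 1 i j = (if i = j then 1 else 0)"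
proof -
  have u: "(\<Sum>k<d. cnj (T 1 k i) * T 1 k l) = (if i = l then 1 else 0)" if "l < d" for l
    using T_unitary[of 1 i l] assms that by simp
  have "T 1 i j = (\<Sum>l<d. (if i = l then 1 else 0) * T 1 l j)" using assms by (simp add: sum_unit_mult)
  also have "\<dots> = (\<Sum>l<d. (\<Sum>k<d. cnj (T 1 k i) * T 1 k l) * T 1 l j)" using u by (intro sum.cong) auto
  also have "\<dots> = (\<Sum>k<d. cnj (T 1 k i) * (\<Sum>l<d. T 1 k l * T 1 l j))"
    unfolding sum_distrib_left sum_distrib_right by (subst sum.swap) (simp add: mult.assoc)
  also have "\<dots> = (\<Sum>k<d. cnj (T 1 k i) * T 1 k j)" using assms by (simp add: T_mult)
  also have "\<dots> = (if i = j then 1 else 0)" by (rule u[OF assms(2)])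
  finally show ?thesis .
qed

text \<open>Unitarity reads \<open>T(1/\<rho>)\<^sup>* = T(\<rho>)\<^sup>-\<^sup>1 = T(1/\<rho>)\<close> for real \<open>\<rho>\<close>, which makes different weight spaces orthogonal.\<close>
lemma T_hermitian:
  assumes "\<sigma> \<noteq> 0" "i < d" "j < d" shows "cnj (T \<sigma> j i) = T \<sigma> i j"
proof -
  have u: "(\<Sum>k<d. cnj (T \<sigma> k i) * T (1 / \<sigma>) k l) = (if i = l then 1 else 0)" if "l < d" for l
    using T_unitary[of "1 / \<sigma>" i l] assms that by simp
  have "T \<sigma> i j = (\<Sum>l<d. (if i = l then 1 else 0) * T \<sigma> l j)" using assms by (simp add: sum_unit_mult)
  also have "\<dots> = (\<Sum>l<d. (\<Sum>k<d. cnj (T \<sigma> k i) * T (1 / \<sigma>) k l) * T \<sigma> l j)" using u by (intro sum.cong) auto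
  also have "\<dots> = (\<Sum>k<d. cnj (T \<sigma> k i) * (\<Sum>l<d. T (1 / \<sigma>) k l * T \<sigma> l j))"
    unfolding sum_distrib_left sum_distrib_right by (subst sum.swap) (simp add: mult.assoc)
  also have "\<dots> = (\<Sum>k<d. cnj (T \<sigma> k i) * T 1 k j)" using assms by (simp add: T_mult)
  also have "\<dots> = (\<Sum>k<d. cnj (T \<sigma> k i) * (if k = j then 1 else 0))"
    using assms by (intro sum.cong) (auto simp: T_one)
  also have "\<dots> = cnj (T \<sigma> j i)" using assms by (simp add: sum_unit_mult)
  finally show ?thesis by simp
qed

lemma act_eps: "i < d \<Longrightarrow> act eps v i = v i"
proof -
  assume i: "i < d"
  have "ev eps (U i k) = (if i = k then 1 else 0)" if "k < d" for k
    using T_one[OF i that] by (simp add: T_def)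
  then have "act eps v i = (\<Sum>k<d. (if i = k then 1 else 0) * v k)" using i by (simp add: act_def)
  also have "\<dots> = v i" using i by (simp add: sum_unit_mult)
  finally show ?thesis .
qed

lemma inner_act_power:
  assumes "\<sigma> \<noteq> 0"
  shows "inner_d d (act (tor (\<lambda>k. complex_of_real \<sigma> powi k)) v) w
    = inner_d d v (act (tor (\<lambda>k. complex_of_real \<sigma> powi k)) w)"
proof -
  have "inner_d d (act (tor (\<lambda>k. complex_of_real \<sigma> powi k)) v) w
    = (\<Sum>i<d. \<Sum>k<d. cnj (T \<sigma> i k) * cnj (v k) * w i)"
    by (simp add: inner_d_def act_def T_def sum_distrib_right)
  also have "\<dots> = (\<Sum>k<d. \<Sum>i<d. cnj (T \<sigma> i k) * cnj (v k) * w i)" by (rule sum.swap)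
  also have "\<dots> = (\<Sum>k<d. \<Sum>i<d. cnj (v k) * (T \<sigma> k i * w i))"
    using assms by (intro sum.cong refl) (simp add: T_hermitian mult_ac)
  also have "\<dots> = inner_d d v (act (tor (\<lambda>k. complex_of_real \<sigma> powi k)) w)"
    by (simp add: inner_d_def act_def T_def sum_distrib_left)
  finally show ?thesis .
qed

definition Uv :: "(nat \<Rightarrow> complex) \<Rightarrow> nat \<Rightarrow> fa" where
  "Uv v k = (\<Sum>l<d. fscale (v l) (U k l))"

lemma Uv_FS [simp, intro]: "k < d \<Longrightarrow> Uv v k \<in> FS"
  unfolding Uv_def by (auto intro!: FS_closed)

lemma ev_Uv: "k < d \<Longrightarrow> ev \<omega> (Uv v k) = act \<omega> v k"
  by (simp add: Uv_def ev_sum_lessThan FS_closed(3) ev_fscale act_def mult.commute)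

lemma RS_Uv:
  assumes s: "s = sE q \<or> s = sF q" and k: "k < d"
  shows "RS q s (Uv v k) - Uv (act (skf q s) v) k \<in> rel_ideal q"
proof -
  have "Uv (act (skf q s) v) k = (\<Sum>m<d. \<Sum>l<d. fscale (v l) (fscale (ev (skf q s) (U m l)) (U k m)))"
    by (simp add: Uv_def act_def fv.scale_sum_left mult.commute)
  also have "\<dots> = (\<Sum>l<d. fscale (v l) (\<Sum>m<d. fscale (ev (skf q s) (U m l)) (U k m)))"
    unfolding fv.scale_sum_right by (rule sum.swap)
  finally have "RS q s (Uv v k) - Uv (act (skf q s) v) k =
    (\<Sum>l<d. fscale (v l) (RS q s (U k l) - (\<Sum>m<d. fscale (ev (skf q s) (U m l)) (U k m))))"
    using k by (simp add: Uv_def RS_sum_lessThan RS_scale FS_closed(3) fv.scale_right_diff_distrib sum_subtractf)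
  also have "\<dots> \<in> rel_ideal q"
  proof (intro rel_ideal_closed(3,4))
    fix l assume "l \<in> {..<d}"
    then show "RS q s (U k l) - (\<Sum>m<d. fscale (ev (skf q s) (U m l)) (U k m)) \<in> rel_ideal q"
      using corep_slice[of "skf q s" k l] skf_kills[OF q0 s] k by (simp add: sl_Delta_skf[OF s])
  qed
  finally show ?thesis .
qed

lemma RP_Uv:
  assumes s: "s = sE q \<or> s = sF q" and k: "k < d" and x: "x \<in> FS" "x - Uv v k \<in> rel_ideal q"
  shows "RP q s n x - Uv ((act (skf q s) ^^ n) v) k \<in> rel_ideal q"
proof (induct n)
  case (Suc n)
  let ?y = "RP q s n x" and ?w = "(act (skf q s) ^^ n) v"
  have "RS q s (?y - Uv ?w k) \<in> rel_ideal q" by (rule RS_ideal[OF q0 s Suc])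
  then have "RS q s ?y - RS q s (Uv ?w k) \<in> rel_ideal q" using x k by (simp add: RS_diff)
  from rel_ideal_closed(1)[OF this RS_Uv[OF s k, of ?w]] show ?case by simp
qed (use x in simp)

text \<open>Turns statements about matrix coefficients modulo the ideal into linear algebra with the
  operators \<open>actE\<close> and \<open>actF\<close>.\<close>

lemma om_Uv:
  assumes k: "k < d"
  shows "om q N i j (Uv v k) = (actF ^^ i) ((actE ^^ N) ((actF ^^ j) v)) k"
proof -
  have 1: "RP q (sF q) j (Uv v k) - Uv ((actF ^^ j) v) k \<in> rel_ideal q"
    using k by (intro RP_Uv) (auto simp: rel_ideal_closed(5))
  have 2: "RP q (sE q) N (RP q (sF q) j (Uv v k)) - Uv ((actE ^^ N) ((actF ^^ j) v)) k \<in> rel_ideal q"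
    using k by (intro RP_Uv 1) auto
  have 3: "RP q (sF q) i (RP q (sE q) N (RP q (sF q) j (Uv v k)))
      - Uv ((actF ^^ i) ((actE ^^ N) ((actF ^^ j) v))) k \<in> rel_ideal q"
    using k by (intro RP_Uv 2) auto
  have "om q N i j (Uv v k) = ev eps (Uv ((actF ^^ i) ((actE ^^ N) ((actF ^^ j) v))) k)"
    unfolding om_def using tor_kills[OF 3, of "\<lambda>k. 1"] k by (simp add: ev_FS_diff)
  then show ?thesis using k by (simp add: ev_Uv act_eps)
qed

end

section \<open>Highest weight theory\<close>

lemma power_int_eq_one:
  fixes Q :: real
  assumes "0 < Q" "Q < 1" "Q powi k = 1" shows "k = 0"
proof (rule ccontr)
  assume "k \<noteq> 0"
  then consider "k > 0" | "k < 0" by linarith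
  then show False
  proof cases
    case 1
    then have "Q powi k = Q ^ nat k" by (simp add: power_int_def)
    moreover have "Q ^ nat k < 1" using power_strict_decreasing[of 0 "nat k" Q] assms 1 by simp
    ultimately show ?thesis using assms by simp
  next
    case 2
    then have "Q powi k = inverse (Q ^ nat (- k))" by (simp add: power_int_def power_inverse)
    moreover have "Q ^ nat (- k) < 1" using power_strict_decreasing[of 0 "nat (- k)" Q] assms 2 by simp
    ultimately show ?thesis using assms by (metis inverse_eq_1_iff less_irrefl)
  qed
qed

context corep
begin

abbreviation pm :: "int \<Rightarrow> int \<Rightarrow> complex" where
  "pm m \<equiv> (\<lambda>k. if k = m then 1 else 0)"

definition supp_wts :: "int set" where
  "supp_wts = wt ` (\<Union>i<d. \<Union>j<d. {w. U i j w \<noteq> 0})"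

lemma finite_supp_wts: "finite supp_wts"
proof -
  have "finite {w. U i j w \<noteq> 0}" if "i < d" "j < d" for i j using U_FS[OF that] by (simp add: FS_def)
  then show ?thesis unfolding supp_wts_def by (intro finite_imageI finite_UN_I) auto
qed

lemma finite_weights: "finite {m. \<exists>v i. act (tor (pm m)) v i \<noteq> 0}"
proof -
  have "m \<in> supp_wts" if "act (tor (pm m)) v i \<noteq> 0" for m v i
  proof (rule ccontr)
    assume m: "m \<notin> supp_wts"
    have "ev (tor (pm m)) (U i j) = 0" if "i < d" "j < d" for i j
    proof -
      have "ev (tor (pm m)) (U i j) = ev (\<lambda>w. 0) (U i j)"
        by (rule ev_cong) (use m that in \<open>auto simp: tor_def supp_wts_def\<close>)
      then show ?thesis by simp
    qed
    then have "act (tor (pm m)) v i = 0" by (simp add: act_def)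
    then show False using that by simp
  qed
  then show ?thesis using finite_supp_wts by (auto intro: finite_subset[of _ supp_wts])
qed

text \<open>On the finitely many words occurring in \<open>U\<close> the weight projections add up
  to the counit, which acts as the identity.\<close>

lemma ex_weight:
  assumes d: "0 < d" shows "{m. \<exists>v i. act (tor (pm m)) v i \<noteq> 0} \<noteq> {}"
proof
  assume e: "{m. \<exists>v i. act (tor (pm m)) v i \<noteq> 0} = {}"
  define v :: "nat \<Rightarrow> complex" where "v = (\<lambda>i. if i = 0 then 1 else 0)"
  have "ev eps (U i j) = (\<Sum>m\<in>supp_wts. ev (tor (pm m)) (U i j))" if "i < d" "j < d" for i j
  proof -
    have "(\<Sum>m\<in>supp_wts. ev (tor (pm m)) (U i j)) = ev (\<lambda>w. \<Sum>m\<in>supp_wts. tor (pm m) w) (U i j)"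
      unfolding ev_def sum_distrib_left by (rule sum.swap)
    also have "\<dots> = ev eps (U i j)"
    proof (rule ev_cong)
      fix w assume "U i j w \<noteq> 0"
      then have w: "wt w \<in> supp_wts" using that by (auto simp: supp_wts_def)
      have "(\<Sum>m\<in>supp_wts. tor (pm m) w) = (\<Sum>m\<in>supp_wts. if m = wt w then eps w else 0)"
        by (intro sum.cong) (auto simp: tor_def)
      then show "(\<Sum>m\<in>supp_wts. tor (pm m) w) = eps w" using w finite_supp_wts by simp
    qed
    finally show ?thesis by simp
  qed
  then have "act eps v 0 = (\<Sum>k<d. \<Sum>m\<in>supp_wts. ev (tor (pm m)) (U 0 k) * v k)"
    using d by (simp add: act_def sum_distrib_right)
  also have "\<dots> = (\<Sum>m\<in>supp_wts. act (tor (pm m)) v 0)"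
    using d by (subst sum.swap) (simp add: act_def)
  also have "\<dots> = 0" using e by (intro sum.neutral) auto
  finally show False using d act_eps[of 0 v] by (simp add: v_def)
qed

text \<open>A nonzero vector of maximal weight \<open>M\<close> works, since \<open>E\<close> would
  move it to the absent weight \<open>M + 2\<close>.\<close>

lemma ex_highest_weight_vector:
  assumes d: "0 < d"
  obtains M v where "\<exists>i<d. v i \<noteq> 0" "\<And>i. i \<ge> d \<Longrightarrow> v i = 0"
    "\<And>h. act (tor h) v = (\<lambda>i. h M * v i)" "actE v = (\<lambda>i. 0)"
proof -
  let ?S = "{m. \<exists>v i. act (tor (pm m)) v i \<noteq> 0}"
  define M where "M = Max ?S"
  have "M \<in> ?S" unfolding M_def by (rule Max_in[OF finite_weights ex_weight[OF d]])
  then obtain u i where ui: "act (tor (pm M)) u i \<noteq> 0" by blast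
  define v where "v = act (tor (pm M)) u"
  have "M + 2 \<notin> ?S" using Max_ge[OF finite_weights, of "M + 2"] unfolding M_def[symmetric] by auto
  then have z: "act (tor (pm (M + 2))) w i = 0" for w i by blast
  show ?thesis
  proof (rule that[of v M])
    show "\<exists>i<d. v i \<noteq> 0" using ui unfolding v_def by (auto simp: act_def split: if_splits)
    show "v i = 0" if "i \<ge> d" for i using that by (simp add: v_def act_def)
    show "act (tor h) v = (\<lambda>i. h M * v i)" for h
    proof -
      have "tor (\<lambda>k. h k * pm M k) = (\<lambda>w. h M * tor (pm M) w)" by (auto simp: tor_def)
      then show ?thesis unfolding v_def act_tor_tor by (simp only: act_functional)
    qed
    have "(\<lambda>k. pm (M + 2) (k + 2)) = pm M" by auto
    then have "actE v = act (tor (pm (M + 2))) (actE u)" unfolding v_def act_tor_E by simp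
    then show "actE v = (\<lambda>i. 0)" using z by auto
  qed
qed

text \<open>Closed form of the scalar \<open>g_j\<close> in \<open>E v_j = g_j v_(j-1)\<close> for
  \<open>v_j = F^j v_0\<close> and \<open>v_0\<close> of highest weight \<open>M\<close>;
  \<open>act_EF\<close> yields the recursion \<open>geig_Suc\<close>.\<close>

definition geig :: "int \<Rightarrow> nat \<Rightarrow> complex" where
  "geig M j = q / (1 - q\<^sup>2) * complex_of_real (q\<^sup>2) powi (1 - int j) * ((1 - complex_of_real (q\<^sup>2) ^ j) / (1 - q\<^sup>2))
     * (complex_of_real (q\<^sup>2) powi (M - int j + 1) - 1)"

lemma geig_0: "geig M 0 = 0"
  by (simp add: geig_def)

lemma geig_Suc: "geig M (Suc j) = geig M j / q\<^sup>2 + q / (1 - q\<^sup>2) * (complex_of_real (q\<^sup>2) powi (M - 2 * int j) - 1)"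
proof -
  define Q where "Q = complex_of_real (q\<^sup>2)"
  define X Y where "X = Q powi (M - int j)" and "Y = Q ^ j"
  have "complex_of_real (1 - q\<^sup>2) \<noteq> 0" using q2(1) unfolding of_real_eq_0_iff by simp
  then have Q: "Q \<noteq> 0" "1 - Q \<noteq> 0" using q0 unfolding Q_def by simp_all
  have Y: "Y \<noteq> 0" using Q by (simp add: Y_def)
  have 1: "Q powi (M - int j + 1) = X * Q" using Q by (simp add: X_def power_int_add_1)
  have 2: "Q powi (M - 2 * int j) = X / Y"
    using Q power_int_diff[of Q "M - int j" "int j"] by (simp add: X_def Y_def algebra_simps)
  have 3: "Q powi (1 - int j) = Q / Y" using Q power_int_diff[of Q 1 "int j"] by (simp add: Y_def)
  have 4: "Q powi (1 - int (Suc j)) = 1 / Y" using Q by (simp add: Y_def power_int_minus inverse_eq_divide)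
  have 5: "Q powi (M - int (Suc j) + 1) = X" by (simp add: X_def)
  have 6: "Q ^ Suc j = Q * Y" by (simp add: Y_def)
  have "geig M (Suc j) = q / (1 - Q) * (1 / Y) * ((1 - Q * Y) / (1 - Q)) * (X - 1)"
    unfolding geig_def Q_def[symmetric] 4 5 6 by (simp add: Q_def)
  also have "\<dots> = q / (1 - Q) * (Q / Y) * ((1 - Y) / (1 - Q)) * (X * Q - 1) / Q + q / (1 - Q) * (X / Y - 1)"
    using Q Y by (simp add: divide_simps) (simp add: algebra_simps)
  also have "\<dots> = geig M j / q\<^sup>2 + q / (1 - q\<^sup>2) * (Q powi (M - 2 * int j) - 1)"
    unfolding geig_def Q_def[symmetric] 1 2 3 Y_def[symmetric] by (simp add: Q_def)
  finally show ?thesis by (simp add: Q_def)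
qed

text \<open>Since \<open>0 < q^2 < 1\<close>, only the last factor can vanish, and only for exponent
  \<open>0\<close>. Hence a finite chain from highest weight \<open>M\<close> has exactly
  \<open>M + 1\<close> nonzero vectors.\<close>

lemma geig_eq_0: "geig M (Suc j) = 0 \<longleftrightarrow> M = int j"
proof -
  have ne: "1 - complex_of_real (q\<^sup>2) ^ Suc j \<noteq> 0"
  proof -
    have "(q\<^sup>2) ^ Suc j < 1" using q2 by (intro power_Suc_less_one) auto
    then have "1 - (q\<^sup>2) ^ Suc j \<noteq> 0" by simp
    then have "complex_of_real (1 - (q\<^sup>2) ^ Suc j) \<noteq> 0" by (simp only: of_real_eq_0_iff not_False_eq_True)
    then show ?thesis by simp
  qed
  have q': "complex_of_real q \<noteq> 0" "1 - (complex_of_real q)\<^sup>2 \<noteq> 0"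
    using q0 q2(1) by (auto simp flip: of_real_power)
  have "geig M (Suc j) = 0 \<longleftrightarrow> complex_of_real (q\<^sup>2) powi (M - int j) = 1"
    using ne q' unfolding geig_def by simp
  also have "\<dots> \<longleftrightarrow> (q\<^sup>2) powi (M - int j) = 1"
    by (simp flip: of_real_power of_real_power_int add: of_real_eq_1_iff)
  also have "\<dots> \<longleftrightarrow> M = int j" using power_int_eq_one[OF q2(2,3), of "M - int j"] by auto
  finally show ?thesis .
qed

end

text \<open>The vectors are orthogonal but not normalised, so that \<open>F\<close> is a pure shift.
  At \<open>j = 0\<close> the truncated \<open>j - 1\<close> is harmless because \<open>geig\<close>
  vanishes there.\<close>

definition (in corep) weight_basis :: "nat \<Rightarrow> (nat \<Rightarrow> nat \<Rightarrow> complex) \<Rightarrow> bool" where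
  "weight_basis n v \<longleftrightarrow>
     (\<forall>j k. j \<le> n \<longrightarrow> k \<le> n \<longrightarrow> (inner_d d (v j) (v k) = 0 \<longleftrightarrow> j \<noteq> k)) \<and>
     (\<forall>j\<le>n. \<forall>i\<ge>d. v j i = 0) \<and>
     (\<forall>h. \<forall>j\<le>n. act (tor h) (v j) = (\<lambda>i. h (int n - 2 * int j) * v j i)) \<and>
     (\<forall>j. actF (v j) = v (Suc j)) \<and> (\<forall>j>n. v j = (\<lambda>i. 0)) \<and>
     (\<forall>j. actE (v j) = (\<lambda>i. geig (int n) j * v (j - 1) i))"

context corep
begin

lemma ex_weight_basis:
  assumes d: "0 < d"
  obtains n v where "weight_basis n v"
proof -
  obtain M v0 where v0: "\<exists>i<d. v0 i \<noteq> 0" "\<And>i. i \<ge> d \<Longrightarrow> v0 i = 0"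
    "\<And>h. act (tor h) v0 = (\<lambda>i. h M * v0 i)" "actE v0 = (\<lambda>i. 0)"
    by (rule ex_highest_weight_vector[OF d]) (rule that)
  define v where "v j = (actF ^^ j) v0" for j
  have v_0: "v 0 = v0" and v_Suc: "v (Suc j) = actF (v j)" for j by (simp_all add: v_def)
  have vd: "v j i = 0" if "i \<ge> d" for j i
    using that v0(2) by (cases j) (simp_all add: v_0 v_Suc act_def)
  have tv: "act (tor h) (v j) = (\<lambda>i. h (M - 2 * int j) * v j i)" for h j
  proof (induct j arbitrary: h)
    case (Suc j)
    have "act (tor h) (v (Suc j)) = (\<lambda>i. h (M - 2 * int j - 2) * v (Suc j) i)"
      unfolding v_Suc act_tor_F Suc act_scale ..
    then show ?case by (simp add: diff_diff_eq add.commute)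
  qed (simp add: v_0 v0)
  have ev: "actE (v j) = (\<lambda>i. geig M j * v (j - 1) i)" for j
  proof (induct j)
    case 0
    then show ?case by (simp add: v_0 v0 geig_0)
  next
    case (Suc j)
    have 1: "actF (actE (v j)) = (\<lambda>i. geig M j * v j i)"
    proof (cases j)
      case 0
      then show ?thesis unfolding Suc by (simp add: geig_0)
    next
      case (Suc l)
      then show ?thesis unfolding \<open>actE (v j) = _\<close> act_scale by (simp add: v_Suc)
    qed
    show ?case
      unfolding v_Suc act_EF 1 tv geig_Suc by (auto simp: fun_eq_iff algebra_simps)
  qed
  \<comment> \<open>Nonzero vectors of the chain have different weights, of which there are only
    finitely many.\<close>
  have fin: "finite {j. \<exists>i. v j i \<noteq> 0}"
  proof (rule finite_imageD[of "\<lambda>j. M - 2 * int j"])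
    have pv: "act (tor (pm (M - 2 * int j))) (v j) = v j" for j unfolding tv by simp
    have "(\<lambda>j. M - 2 * int j) ` {j. \<exists>i. v j i \<noteq> 0} \<subseteq> {m. \<exists>v i. act (tor (pm m)) v i \<noteq> 0}"
    proof (intro image_subsetI CollectI)
      fix j assume "j \<in> {j. \<exists>i. v j i \<noteq> 0}"
      then obtain i where "v j i \<noteq> 0" by blast
      then have "act (tor (pm (M - 2 * int j))) (v j) i \<noteq> 0" by (simp only: pv not_False_eq_True)
      then show "\<exists>v i. act (tor (pm (M - 2 * int j))) v i \<noteq> 0" by blast
    qed
    then show "finite ((\<lambda>j. M - 2 * int j) ` {j. \<exists>i. v j i \<noteq> 0})"
      by (rule finite_subset) (rule finite_weights)
  qed (simp add: inj_on_def)
  have "\<exists>j. v j = (\<lambda>i. 0)"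
  proof (rule ccontr)
    assume "\<not> ?thesis"
    then have "{j. \<exists>i. v j i \<noteq> 0} = UNIV" by (auto simp: fun_eq_iff)
    then show False using fin infinite_UNIV_nat by simp
  qed
  define N where "N = (LEAST j. v j = (\<lambda>i. 0))"
  have vN: "v N = (\<lambda>i. 0)" unfolding N_def using \<open>\<exists>j. v j = (\<lambda>i. 0)\<close> by (rule LeastI_ex)
  have vne: "v j \<noteq> (\<lambda>i. 0)" if "j < N" for j using that not_less_Least unfolding N_def by blast
  have "N \<noteq> 0"
  proof
    assume "N = 0"
    then have "v0 = (\<lambda>i. 0)" using vN v_0 by simp
    then show False using v0(1) by simp
  qed
  then obtain n where n: "N = Suc n" by (cases N) auto
  \<comment> \<open>\<open>E\<close> kills the first zero vector of the chain, but
    \<open>v n\<close> is nonzero, so its coefficient vanishes and identifies the highest weight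
    with \<open>n\<close>.\<close>
  have "actE (v N) = (\<lambda>i. 0)" unfolding vN by simp
  then have "(\<lambda>i. geig M N * v n i) = (\<lambda>i. 0)" using ev[of N] n by simp
  moreover have "v n \<noteq> (\<lambda>i. 0)" using vne n by simp
  ultimately have "geig M (Suc n) = 0" unfolding n by (auto simp: fun_eq_iff)
  then have M: "M = int n" by (simp add: geig_eq_0)
  have vz: "v (N + k) = (\<lambda>i. 0)" for k by (induct k) (simp_all add: vN v_Suc)
  have ne: "inner_d d (v j) (v j) \<noteq> 0" if "j \<le> n" for j
  proof
    assume "inner_d d (v j) (v j) = 0"
    then have "v j i = 0" for i using inner_d_self_eq_0[of d "v j" i] vd[of i j] by (cases "i < d") auto
    then show False using vne[of j] that n by auto
  qed
  have orth: "inner_d d (v j) (v k) = 0" if "j \<noteq> k" for j k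
  proof -
    \<comment> \<open>The torus element at \<open>2\<close> acts hermitian, with pairwise distinct
      real eigenvalues along the chain.\<close>
    let ?c = "\<lambda>j. complex_of_real 2 powi (M - 2 * int j)"
    have "cnj (?c j) * inner_d d (v j) (v k) = inner_d d (act (tor (\<lambda>k. complex_of_real 2 powi k)) (v j)) (v k)"
      unfolding tv inner_d_def sum_distrib_left by (intro sum.cong refl) (simp add: mult_ac)
    also have "\<dots> = inner_d d (v j) (act (tor (\<lambda>k. complex_of_real 2 powi k)) (v k))"
      by (rule inner_act_power) simp
    also have "\<dots> = ?c k * inner_d d (v j) (v k)"
      unfolding tv inner_d_def sum_distrib_left by (intro sum.cong refl) (simp add: mult_ac)
    finally have "(cnj (?c j) - ?c k) * inner_d d (v j) (v k) = 0" by (simp add: algebra_simps)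
    moreover have "cnj (?c j) \<noteq> ?c k"
    proof
      assume "cnj (?c j) = ?c k"
      then have "complex_of_real (2 powi (M - 2 * int j)) = complex_of_real (2 powi (M - 2 * int k))" by simp
      then have "(2::real) powi (M - 2 * int j) = 2 powi (M - 2 * int k)" by (simp only: of_real_eq_iff)
      then have "(1 / 2 :: real) powi (2 * int j - 2 * int k) = 1"
        using power_int_diff[of "2::real" "M - 2 * int j" "M - 2 * int k"]
        by (simp add: power_int_divide_distrib power_int_minus power_int_diff)
      then have "2 * int j - 2 * int k = 0" by (intro power_int_eq_one[of "1/2"]) auto
      then show False using that by simp
    qed
    ultimately show ?thesis by simp
  qed
  have "weight_basis n v"
    unfolding weight_basis_def
  proof (intro conjI allI impI)
    show "(inner_d d (v j) (v k) = 0) = (j \<noteq> k)" if "j \<le> n" "k \<le> n" for j k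
      using ne orth that by auto
    show "v j = (\<lambda>i. 0)" if "n < j" for j using vz[of "j - N"] that n by simp
    show "actE (v j) = (\<lambda>i. geig (int n) j * v (j - 1) i)" for j using ev M by simp
  qed (use vd tv M v_Suc in auto)
  then show ?thesis by (rule that)
qed

end

section \<open>Irreducible corepresentations\<close>

locale weighted_corep = corep +
  fixes n :: nat and v :: "nat \<Rightarrow> nat \<Rightarrow> complex"
  assumes wb: "weight_basis n v"
begin

lemma inner_v: "j \<le> n \<Longrightarrow> k \<le> n \<Longrightarrow> inner_d d (v j) (v k) = 0 \<longleftrightarrow> j \<noteq> k"
  and tor_v: "j \<le> n \<Longrightarrow> act (tor h) (v j) = (\<lambda>i. h (int n - 2 * int j) * v j i)"
  and F_v: "actF (v j) = v (Suc j)"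
  and v_zero: "n < j \<Longrightarrow> v j = (\<lambda>i. 0)"
  and E_v: "actE (v j) = (\<lambda>i. geig (int n) j * v (j - 1) i)"
  using wb unfolding weight_basis_def by blast+

definition nn :: "nat \<Rightarrow> complex" where
  "nn k = inner_d d (v k) (v k)"

lemma nn_nonzero: "k \<le> n \<Longrightarrow> nn k \<noteq> 0"
  using inner_v[of k k] by (simp add: nn_def)

lemma cnj_nn [simp]: "cnj (nn k) = nn k"
  unfolding nn_def inner_d_self by (rule complex_cnj_complex_of_real)

definition proj :: "(nat \<Rightarrow> complex) \<Rightarrow> nat \<Rightarrow> complex" where
  "proj w = (\<lambda>i. \<Sum>k\<le>n. inner_d d (v k) w / nn k * v k i)"

lemma inner_sum: "inner_d d u (\<lambda>i. \<Sum>k\<in>K. c k * w k i) = (\<Sum>k\<in>K. c k * inner_d d u (w k))"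
proof -
  have "inner_d d u (\<lambda>i. \<Sum>k\<in>K. c k * w k i) = (\<Sum>i<d. \<Sum>k\<in>K. c k * (cnj (u i) * w k i))"
    unfolding inner_d_def sum_distrib_left by (intro sum.cong refl) (simp add: mult_ac)
  also have "\<dots> = (\<Sum>k\<in>K. c k * inner_d d u (w k))"
    unfolding inner_d_def sum_distrib_left by (rule sum.swap)
  finally show ?thesis .
qed

lemma proj_sum: "proj (\<lambda>i. \<Sum>k\<in>K. c k * w k i) = (\<lambda>i. \<Sum>k\<in>K. c k * proj (w k) i)"
proof
  fix i
  have "proj (\<lambda>i. \<Sum>k\<in>K. c k * w k i) i = (\<Sum>l\<le>n. \<Sum>k\<in>K. c k * (inner_d d (v l) (w k) / nn l * v l i))"
    unfolding proj_def inner_sum sum_divide_distrib sum_distrib_right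
    by (intro sum.cong refl) (simp add: mult_ac)
  also have "\<dots> = (\<Sum>k\<in>K. c k * proj (w k) i)"
    unfolding proj_def sum_distrib_left by (rule sum.swap)
  finally show "proj (\<lambda>i. \<Sum>k\<in>K. c k * w k i) i = (\<Sum>k\<in>K. c k * proj (w k) i)" .
qed

lemma proj_v: "proj (v j) = v j"
proof (cases "j \<le> n")
  case True
  have "proj (v j) i = (\<Sum>k\<le>n. if k = j then v j i else 0)" for i
    unfolding proj_def using True inner_v nn_nonzero
    by (intro sum.cong refl) (auto simp: nn_def)
  then show ?thesis using True by auto
next
  case False
  then show ?thesis by (simp add: v_zero proj_def inner_d_def)
qed

lemma proj_F: assumes "proj w = w" shows "proj (actF w) = actF w"
proof -
  have w: "w = (\<lambda>i. \<Sum>k\<le>n. inner_d d (v k) w / nn k * v k i)" using assms unfolding proj_def by simp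
  have "actF w = (\<lambda>i. \<Sum>k\<le>n. inner_d d (v k) w / nn k * v (Suc k) i)"
    by (subst w) (simp only: act_sum act_scale F_v)
  then show ?thesis by (simp only: proj_sum proj_v)
qed

lemma proj_E: assumes "proj w = w" shows "proj (actE w) = actE w"
proof -
  have w: "w = (\<lambda>i. \<Sum>k\<le>n. inner_d d (v k) w / nn k * v k i)" using assms unfolding proj_def by simp
  have "actE w = (\<lambda>i. \<Sum>k\<le>n. (inner_d d (v k) w / nn k * geig (int n) k) * v (k - 1) i)"
    by (subst w) (simp only: act_sum act_scale E_v mult.assoc)
  then show ?thesis by (simp only: proj_sum proj_v)
qed

lemma proj_iter:
  assumes "proj w = w"
  shows "proj ((actF ^^ i) ((actE ^^ N) ((actF ^^ j) w))) = (actF ^^ i) ((actE ^^ N) ((actF ^^ j) w))"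
proof -
  have "proj ((actF ^^ j) w) = (actF ^^ j) w" if "proj w = w" for j w
    using that by (induct j) (simp_all add: proj_F)
  moreover have "proj ((actE ^^ j) w) = (actE ^^ j) w" if "proj w = w" for j w
    using that by (induct j) (simp_all add: proj_E)
  ultimately show ?thesis using assms by blast
qed

definition Pm :: "nat \<Rightarrow> nat \<Rightarrow> complex" where
  "Pm i j = (\<Sum>k\<le>n. cnj (v k j) / nn k * v k i)"

lemma Pm_mult: "(\<Sum>j<d. Pm i j * w j) = proj w i"
proof -
  have "(\<Sum>j<d. Pm i j * w j) = (\<Sum>j<d. \<Sum>k\<le>n. cnj (v k j) * w j / nn k * v k i)"
    unfolding Pm_def sum_distrib_right by (intro sum.cong refl) (simp add: mult_ac)
  also have "\<dots> = proj w i"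
    unfolding proj_def inner_d_def sum_divide_distrib sum_distrib_right by (rule sum.swap)
  finally show ?thesis .
qed

lemma proj_column: "proj (\<lambda>i. Pm i j) = (\<lambda>i. Pm i j)"
  unfolding Pm_def proj_sum proj_v ..

lemma orth_proj_Pm: "orth_proj d Pm"
  unfolding orth_proj_def
proof (intro allI impI conjI)
  fix i j
  show "Pm i j = cnj (Pm j i)" by (simp add: Pm_def mult_ac)
  show "(\<Sum>k<d. Pm i k * Pm k j) = Pm i j" unfolding Pm_mult proj_column ..
qed

text \<open>Each functional \<open>om\<close> turns an entry of \<open>(1 - P) U P\<close> into an
  entry of \<open>1 - P\<close> applied to iterated \<open>E\<close> and \<open>F\<close> on a
  column of \<open>P\<close>. The span of the weight vectors is stable under both, so this is
  zero.\<close>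

lemma invariant_Pm: "invariant_proj q d U Pm"
  unfolding invariant_proj_def
proof (intro allI impI)
  fix i j assume ij: "i < d" "j < d"
  define x where "x = (\<Sum>k<d. fscale ((if i = k then 1 else 0) - Pm i k) (Uv (\<lambda>l. Pm l j) k))"
  have "fsum ({..<d} \<times> {..<d}) (\<lambda>(k, l). fscale (((if i = k then 1 else 0) - Pm i k) * Pm l j) (U k l)) = x"
    unfolding x_def Uv_def fsum_eq fv.scale_sum_right sum.cartesian_product fv.scale_scale ..
  moreover have "x \<in> rel_ideal q"
  proof (rule om_separates[OF q0])
    show "x \<in> FS" unfolding x_def by (intro FS_closed Uv_FS) auto
    fix N a b
    define W where "W = (actF ^^ a) ((actE ^^ N) ((actF ^^ b) (\<lambda>l. Pm l j)))"
    have "om q N a b x = (\<Sum>k<d. om q N a b (fscale ((if i = k then 1 else 0) - Pm i k) (Uv (\<lambda>l. Pm l j) k)))"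
      unfolding x_def by (rule om_sum) (intro FS_closed(3) Uv_FS, simp)
    also have "\<dots> = (\<Sum>k<d. (if i = k then 1 else 0) * W k - Pm i k * W k)"
      by (intro sum.cong refl) (simp add: om_scale om_Uv W_def left_diff_distrib)
    also have "\<dots> = W i - proj W i" using ij by (simp add: sum_subtractf sum_unit_mult Pm_mult)
    also have "\<dots> = 0" unfolding W_def proj_iter[OF proj_column] by simp
    finally show "om q N a b x = 0" .
  qed
  ultimately show "fsum ({..<d} \<times> {..<d}) (\<lambda>(k, l). fscale (((if i = k then 1 else 0) - Pm i k) * Pm l j) (U k l)) \<in> rel_ideal q"
    by simp
qed

text \<open>\<open>Pm\<close> fixes the nonzero vector \<open>v 0\<close>, so irreducibility makes
  it the identity; comparing traces gives the dimension.\<close>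

lemma irreducible_Pm:
  assumes "irreducible_unitary_corep q d U"
  shows "\<And>i j. i < d \<Longrightarrow> j < d \<Longrightarrow> Pm i j = (if i = j then 1 else 0)" "d = Suc n"
proof -
  have "(\<forall>i<d. \<forall>j<d. Pm i j = 0) \<or> (\<forall>i<d. \<forall>j<d. Pm i j = (if i = j then 1 else 0))"
    using assms orth_proj_Pm invariant_Pm unfolding irreducible_unitary_corep_def by blast
  moreover have "\<not> (\<forall>i<d. \<forall>j<d. Pm i j = 0)"
  proof
    assume z: "\<forall>i<d. \<forall>j<d. Pm i j = 0"
    have "v 0 i = 0" if "i < d" for i
    proof -
      have "v 0 i = (\<Sum>j<d. Pm i j * v 0 j)" by (simp add: Pm_mult proj_v)
      also have "\<dots> = 0" using z that by (intro sum.neutral) auto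
      finally show ?thesis .
    qed
    then have "nn 0 = 0" by (simp add: nn_def inner_d_def)
    then show False using nn_nonzero[of 0] by simp
  qed
  ultimately have P1: "\<And>i j. i < d \<Longrightarrow> j < d \<Longrightarrow> Pm i j = (if i = j then 1 else 0)" by blast
  then show "\<And>i j. i < d \<Longrightarrow> j < d \<Longrightarrow> Pm i j = (if i = j then 1 else 0)" .
  have "of_nat d = (\<Sum>i<d. Pm i i)" using P1 by simp
  also have "\<dots> = (\<Sum>i<d. \<Sum>k\<le>n. cnj (v k i) * v k i / nn k)" by (simp add: Pm_def)
  also have "\<dots> = (\<Sum>k\<le>n. (\<Sum>i<d. cnj (v k i) * v k i) / nn k)"
    unfolding sum_divide_distrib by (rule sum.swap)
  also have "\<dots> = (\<Sum>k\<le>n. 1)" by (intro sum.cong refl) (use nn_nonzero in \<open>auto simp: nn_def inner_d_def\<close>)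
  also have "\<dots> = of_nat (Suc n)" by simp
  finally show "d = Suc n" using of_nat_eq_iff by blast
qed

section \<open>Matrix coefficients and the separating functionals\<close>

lemma F_iter: "(actF ^^ j) (v k) = v (k + j)"
  by (induct j) (simp_all add: F_v)

lemma iter_scale:
  "(actE ^^ t) (\<lambda>i. c * w i) = (\<lambda>i. c * (actE ^^ t) w i)"
  "(actF ^^ t) (\<lambda>i. c * w i) = (\<lambda>i. c * (actF ^^ t) w i)"
  by (induct t) (simp_all add: act_scale)

lemma E_iter: "(actE ^^ t) (v m) = (if t \<le> m then (\<lambda>i. (\<Prod>s<t. geig (int n) (m - s)) * v (m - t) i) else (\<lambda>i. 0))"
proof (induct t)
  case (Suc t)
  consider "Suc t \<le> m" | "t = m" | "t > m" by linarith
  then show ?case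
  proof cases
    case 1
    then show ?thesis using Suc by (simp add: act_scale E_v mult.assoc)
  next
    case 2
    then show ?thesis using Suc by (simp add: act_scale E_v geig_0)
  next
    case 3
    then show ?thesis using Suc by simp
  qed
qed simp

definition Gam :: complex where
  "Gam = (\<Prod>s<n. geig (int n) (n - s))"

lemma Gam_nonzero: "Gam \<noteq> 0"
proof -
  have "geig (int n) (n - s) \<noteq> 0" if "s < n" for s
    using that geig_eq_0[of "int n" "n - s - 1"] by (auto simp: Suc_diff_Suc)
  then show ?thesis by (simp add: Gam_def)
qed

text \<open>\<open>E^n\<close> annihilates every \<open>v m\<close> except the lowest,
  \<open>v n\<close>, which it carries to \<open>v 0\<close> with the factor
  \<open>Gam\<close>.\<close>

lemma FEF_v: "(actF ^^ i) ((actE ^^ n) ((actF ^^ j) (v k))) = (if k + j = n then (\<lambda>l. Gam * v i l) else (\<lambda>l. 0))"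
proof -
  have "(actE ^^ n) (v (k + j)) = (if k + j = n then (\<lambda>l. Gam * v 0 l) else (\<lambda>l. 0))"
  proof (cases "k + j > n")
    case True
    have "(actE ^^ n) (\<lambda>l. 0) = (\<lambda>l. 0)" using iter_scale(1)[of n 0 "\<lambda>l. 0"] by simp
    then show ?thesis using True by (simp add: v_zero)
  next
    case False
    then show ?thesis by (auto simp: E_iter Gam_def)
  qed
  moreover have "(actF ^^ i) (\<lambda>l. 0) = (\<lambda>l. 0)" using iter_scale(2)[of i 0 "\<lambda>l. 0"] by simp
  ultimately show ?thesis by (simp add: F_iter iter_scale(2))
qed

lemma FEF_v_high:
  assumes "N > n" shows "(actF ^^ i) ((actE ^^ N) ((actF ^^ j) (v k))) = (\<lambda>l. 0)"
proof -
  have "(actE ^^ N) (v (k + j)) = (\<lambda>l. 0)"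
  proof (cases "k + j > n")
    case True
    have "(actE ^^ N) (\<lambda>l. 0) = (\<lambda>l. 0)" using iter_scale(1)[of N 0 "\<lambda>l. 0"] by simp
    then show ?thesis using True by (simp add: v_zero)
  next
    case False
    then show ?thesis using assms by (auto simp: E_iter)
  qed
  moreover have "(actF ^^ i) (\<lambda>l. 0) = (\<lambda>l. 0)" using iter_scale(2)[of i 0 "\<lambda>l. 0"] by simp
  ultimately show ?thesis by (simp add: F_iter)
qed

text \<open>The matrix coefficient of the pair \<open>(v l, v k)\<close>; these are dual to the functionals \<open>om\<close>.\<close>
definition coef :: "nat \<Rightarrow> nat \<Rightarrow> fa" where
  "coef l k = (\<Sum>i<d. fscale (cnj (v l i) / nn l) (Uv (v k) i))"

lemma coef_FS [simp]: "coef l k \<in> FS"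
  unfolding coef_def by (intro FS_closed Uv_FS) auto

lemma om_coef:
  "om q N i j (coef l k) = inner_d d (v l) ((actF ^^ i) ((actE ^^ N) ((actF ^^ j) (v k)))) / nn l"
proof -
  have "om q N i j (coef l k) = (\<Sum>a<d. om q N i j (fscale (cnj (v l a) / nn l) (Uv (v k) a)))"
    unfolding coef_def by (rule om_sum) (auto intro!: FS_closed)
  also have "\<dots> = (\<Sum>a<d. cnj (v l a) * (actF ^^ i) ((actE ^^ N) ((actF ^^ j) (v k))) a / nn l)"
    by (intro sum.cong refl) (simp add: om_scale om_Uv)
  finally show ?thesis by (simp add: inner_d_def sum_divide_distrib)
qed

lemma om_coef_top:
  assumes "l \<le> n" "i \<le> n" "k \<le> n" "j \<le> n"
  shows "om q n i j (coef l k) = (if l = i \<and> k + j = n then Gam else 0)"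
proof -
  have "inner_d d (v l) (\<lambda>a. Gam * v i a) = Gam * inner_d d (v l) (v i)"
    by (simp add: inner_d_def sum_distrib_left mult_ac)
  then show ?thesis
    unfolding om_coef FEF_v using inner_v[OF assms(1,2)] nn_nonzero[OF assms(1)]
    by (auto simp: inner_d_def[of d _ "\<lambda>l. 0"] nn_def)
qed

text \<open>All functionals of degree above \<open>n\<close> vanish, because \<open>E\<close> can
  climb the chain at most \<open>n\<close> times.\<close>

lemma coef_Gr: "coef l k \<in> Gr q (Suc n)"
  by (rule Gr_descend_to[OF q0 coef_FS]) (simp add: om_coef FEF_v_high inner_d_def)

text \<open>Up to the factor \<open>Gam\<close>, \<open>coef i (n - j)\<close> is dual to
  \<open>om q n i j\<close>. Subtracting the matching combination kills all functionals of degree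
  \<open>n\<close>, and \<open>Gr_descend\<close> lowers the degree.\<close>

lemma Gr_top_coef:
  assumes "x \<in> Gr q (Suc n)"
  shows "\<exists>A. x - (\<Sum>i<d. \<Sum>j<d. fscale (A i j) (U i j)) \<in> Gr q n"
proof -
  define t where "t l m = om q n l m x / Gam" for l m
  define y where "y = (\<Sum>l\<le>n. \<Sum>m\<le>n. fscale (t l m) (coef l (n - m)))"
  have yG: "y \<in> Gr q (Suc n)" unfolding y_def by (intro Gr_closed(4) Gr_closed(3) coef_Gr)
  have "om q n i j y = om q n i j x" if "i \<le> n" "j \<le> n" for i j
  proof -
    have "om q n i j y = (\<Sum>l\<le>n. \<Sum>m\<le>n. t l m * om q n i j (coef l (n - m)))"
      unfolding y_def by (subst om_sum, (intro FS_closed coef_FS), intro sum.cong refl, subst om_sum)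
        (auto intro!: FS_closed simp: om_scale)
    also have "\<dots> = (\<Sum>l\<le>n. \<Sum>m\<le>n. if m = j then (if l = i then t l m * Gam else 0) else 0)"
      using that by (intro sum.cong refl) (auto simp: om_coef_top)
    also have "\<dots> = t i j * Gam" using that by (simp add: sum.delta)
    finally show ?thesis by (simp add: t_def Gam_nonzero)
  qed
  then have "x - y \<in> Gr q n"
    using Gr_FS[OF assms] Gr_FS[OF yG]
    by (intro Gr_descend[OF q0 Gr_closed(2)[OF assms yG]]) (simp add: om_diff)
  moreover have "y = (\<Sum>i<d. \<Sum>j<d. fscale (\<Sum>l\<le>n. \<Sum>m\<le>n. t l m * (cnj (v l i) / nn l) * v (n - m) j) (U i j))"
  proof -
    have "y = (\<Sum>l\<le>n. \<Sum>m\<le>n. \<Sum>i<d. \<Sum>j<d. fscale (t l m * (cnj (v l i) / nn l) * v (n - m) j) (U i j))"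
      unfolding y_def coef_def Uv_def fv.scale_sum_right fv.scale_scale by (simp only: mult.assoc)
    also have "\<dots> = (\<Sum>l\<le>n. \<Sum>i<d. \<Sum>j<d. \<Sum>m\<le>n. fscale (t l m * (cnj (v l i) / nn l) * v (n - m) j) (U i j))"
      by (rule sum.cong[OF refl], rule sum_swap3)
    also have "\<dots> = (\<Sum>i<d. \<Sum>j<d. \<Sum>l\<le>n. \<Sum>m\<le>n. fscale (t l m * (cnj (v l i) / nn l) * v (n - m) j) (U i j))"
      by (rule sum_swap3)
    finally show ?thesis by (simp only: fv.scale_sum_left)
  qed
  ultimately show ?thesis
    by (intro exI[of _ "\<lambda>i j. \<Sum>l\<le>n. \<Sum>m\<le>n. t l m * (cnj (v l i) / nn l) * v (n - m) j"]) simp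
qed

end

lemma irreducible_weighted:
  assumes "-1 < q" "q < 1" "q \<noteq> 0" "irreducible_unitary_corep q (n + 1) U"
  obtains v where "weighted_corep q (n + 1) U n v"
proof -
  interpret corep q "n + 1" U
    using assms by unfold_locales (auto simp: irreducible_unitary_corep_def)
  obtain m v where "weight_basis m v" using ex_weight_basis by auto
  then interpret weighted_corep q "n + 1" U m v by unfold_locales
  have "m = n" using irreducible_Pm(2)[OF assms(4)] by simp
  then show ?thesis using that weighted_corep_axioms by blast
qed

lemma coefficients_span:
  fixes u :: "nat \<Rightarrow> nat \<Rightarrow> nat \<Rightarrow> fa"
  assumes q: "-1 < q" "q < 1" "q \<noteq> 0" and irr: "\<And>n. irreducible_unitary_corep q (n + 1) (u n)"
  shows "x \<in> Gr q N \<Longrightarrow> \<exists>A. x - (\<Sum>n<N. \<Sum>i\<le>n. \<Sum>j\<le>n. fscale (A n i j) (u n i j)) \<in> rel_ideal q"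
proof (induct N arbitrary: x)
  case 0
  then show ?case by (simp add: Gr_0)
next
  case (Suc N)
  obtain v where "weighted_corep q (N + 1) (u N) N v" by (rule irreducible_weighted[OF q irr])
  then interpret weighted_corep q "N + 1" "u N" N v .
  obtain B where B: "x - (\<Sum>i<N + 1. \<Sum>j<N + 1. fscale (B i j) (u N i j)) \<in> Gr q N"
    using Gr_top_coef[OF Suc.prems] by blast
  obtain A where A: "x - (\<Sum>i<N + 1. \<Sum>j<N + 1. fscale (B i j) (u N i j))
      - (\<Sum>n<N. \<Sum>i\<le>n. \<Sum>j\<le>n. fscale (A n i j) (u n i j)) \<in> rel_ideal q"
    using Suc.hyps[OF B] by blast
  have "(\<Sum>n<Suc N. \<Sum>i\<le>n. \<Sum>j\<le>n. fscale ((A(N := B)) n i j) (u n i j))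
    = (\<Sum>n<N. \<Sum>i\<le>n. \<Sum>j\<le>n. fscale (A n i j) (u n i j)) + (\<Sum>i<N + 1. \<Sum>j<N + 1. fscale (B i j) (u N i j))"
    unfolding sum.lessThan_Suc by (intro arg_cong2[of _ _ _ _ "(+)"] sum.cong) (auto simp: lessThan_Suc_atMost)
  then have "x - (\<Sum>n<Suc N. \<Sum>i\<le>n. \<Sum>j\<le>n. fscale ((A(N := B)) n i j) (u n i j)) \<in> rel_ideal q"
    using A by (simp only: diff_diff_eq add.commute)
  then show ?case by blast
qed

section \<open>Characters of the polynomial algebra\<close>

abbreviation phi_w :: "complex \<Rightarrow> gen list \<Rightarrow> complex" where
  "phi_w \<rho> \<equiv> tor (\<lambda>k. \<rho> powi k)"

definition phi :: "complex \<Rightarrow> fa \<Rightarrow> complex" where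
  "phi \<rho> = restrict (ev (phi_w \<rho>)) FS"

lemma phi_apply: "x \<in> FS \<Longrightarrow> phi \<rho> x = ev (phi_w \<rho>) x"
  by (simp add: phi_def)

lemma phi_GA [simp]: "phi \<rho> (delta [GA]) = \<rho>"
  by (simp add: phi_apply tor_def)

lemma phi_SpecPol:
  assumes "\<rho> \<noteq> 0" shows "phi \<rho> \<in> SpecPol q"
  unfolding SpecPol_def mem_Collect_eq
proof (intro conjI ballI allI)
  show "phi \<rho> \<in> extensional FS" by (simp add: phi_def)
  show "\<exists>f\<in>FS. phi \<rho> f \<noteq> 0" by (rule bexI[of _ "delta [GA]"]) (use assms in auto)
  show "phi \<rho> f = 0" if "f \<in> rel_ideal q" for f
    using that tor_kills[OF that] by (simp add: phi_apply rel_ideal_FS)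
qed (auto simp: phi_apply fadd_eq FS_closed fmul_FS ev_FS_add ev_fscale ev_tor_power_mult assms)

lemma SpecPol_eq_phi:
  assumes q: "-1 < q" "q < 1" "q \<noteq> 0" and \<phi>: "\<phi> \<in> SpecPol q"
  shows "\<phi> (delta [GA]) \<noteq> 0" "\<phi> = phi (\<phi> (delta [GA]))"
proof -
  have add: "\<phi> (x + y) = \<phi> x + \<phi> y" if "x \<in> FS" "y \<in> FS" for x y
    using \<phi> that by (simp add: SpecPol_def fadd_eq)
  have scale: "\<phi> (fscale z x) = z * \<phi> x" if "x \<in> FS" for x z
    using \<phi> that by (simp add: SpecPol_def)
  have mult: "\<phi> (fmul x y) = \<phi> x * \<phi> y" if "x \<in> FS" "y \<in> FS" for x y
    using \<phi> that by (simp add: SpecPol_def)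
  have kill: "\<phi> x = 0" if "x \<in> rel_ideal q" for x using \<phi> that by (simp add: SpecPol_def)
  have diff: "\<phi> (x - y) = \<phi> x - \<phi> y" if "x \<in> FS" "y \<in> FS" for x y
    using add[of "x - y" y] that by (simp add: FS_closed)
  have app: "\<phi> (delta (u @ v)) = \<phi> (delta u) * \<phi> (delta v)" for u v
    using mult[of "delta u" "delta v"] by simp
  have phi_Cons: "\<phi> (delta (x # w)) = \<phi> (delta [x]) * \<phi> (delta w)" for x w
    using app[of "[x]" w] by simp
  obtain f where f: "f \<in> FS" "\<phi> f \<noteq> 0" using \<phi> by (auto simp: SpecPol_def)
  have one: "\<phi> (delta []) = 1" using mult[OF f(1) delta_FS[of "[]"]] f by simp
  define a as c cs where "a = \<phi> (delta [GA])" and "as = \<phi> (delta [GAs])"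
    and "c = \<phi> (delta [GC])" and "cs = \<phi> (delta [GCs])"
  have two: "\<phi> (delta [x, y]) = \<phi> (delta [x]) * \<phi> (delta [y])" for x y by (rule phi_Cons)
  note rel = relator_mem[THEN kill]
  have r1: "as * a + cs * c = 1"
    using rel(1) by (simp add: diff add scale FS_closed two one a_def as_def c_def cs_def)
  have r2: "a * as + q\<^sup>2 * (cs * c) = 1"
    using rel(2) by (simp add: diff add scale FS_closed two one a_def as_def c_def cs_def)
  have r4: "a * c = q * (c * a)"
    using rel(4) by (simp add: diff add scale FS_closed two one a_def as_def c_def cs_def)
  have r6: "a * cs = q * (cs * a)"
    using rel(6) by (simp add: diff add scale FS_closed two one a_def as_def c_def cs_def)
  have q1: "complex_of_real q \<noteq> 1" using q by (simp add: complex_eq_iff)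
  have "q\<^sup>2 < 1" using q by (simp add: abs_square_less_1)
  then have q2: "complex_of_real (q\<^sup>2) \<noteq> 1" by (metis less_irrefl of_real_eq_1_iff)
  \<comment> \<open>Values of a character commute, so the first two relations differ only in the
    coefficient of \<open>cs * c\<close>.\<close>
  have "(1 - complex_of_real (q\<^sup>2)) * (cs * c) = (as * a + cs * c) - (a * as + q\<^sup>2 * (cs * c))"
    by (simp add: algebra_simps)
  then have "(1 - complex_of_real (q\<^sup>2)) * (cs * c) = 0" unfolding r1 r2 by simp
  then have cc: "cs * c = 0" using q2 by simp
  have aas: "a * as = 1" using r2 unfolding cc by simp
  then have a0: "a \<noteq> 0" by auto
  have "(1 - complex_of_real q) * (a * c) = 0" using r4 by (simp add: algebra_simps)
  then have c0: "c = 0" using a0 q1 by simp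
  have "(1 - complex_of_real q) * (a * cs) = 0" using r6 by (simp add: algebra_simps)
  then have cs0: "cs = 0" using a0 q1 by simp
  have as: "as = inverse a" using aas by (simp add: inverse_unique)
  have word: "\<phi> (delta w) = phi_w a w" for w
  proof (induct w)
    case (Cons x w)
    have shift: "tor (\<lambda>k. a powi (m + k)) w = a powi m * phi_w a w" for m
      using a0 by (simp add: tor_def power_int_add)
    have "\<phi> (delta (x # w)) = \<phi> (delta [x]) * phi_w a w" using phi_Cons[of x w] Cons by simp
    then show ?case
      by (cases x) (simp_all add: tor_Cons shift del: power_int_add_1 flip: a_def as_def c_def cs_def,
        simp_all add: c0 cs0 as shift[of 1, simplified] shift[of "-1", simplified] power_int_minus)
  qed (simp add: one)
  show "\<phi> (delta [GA]) \<noteq> 0" using a0 by (simp add: a_def)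
  show "\<phi> = phi (\<phi> (delta [GA]))"
  proof
    fix x
    show "\<phi> x = phi (\<phi> (delta [GA])) x"
    proof (cases "x \<in> FS")
      case True
      have z: "\<phi> 0 = 0" using scale[of 0 0] by (simp add: FS_closed)
      have sum: "\<phi> (sum F I) = (\<Sum>i\<in>I. \<phi> (F i))" if "\<And>i. i \<in> I \<Longrightarrow> F i \<in> FS" for F and I :: "gen list set"
        using that by (induct I rule: infinite_finite_induct) (auto simp: z add FS_closed(5))
      have "\<phi> x = (\<Sum>w | x w \<noteq> 0. \<phi> (fscale (x w) (delta w)))"
        by (subst FS_expand[OF True], rule sum) (auto intro: FS_closed)
      also have "\<dots> = ev (phi_w a) x" by (simp add: scale word ev_def)
      finally show ?thesis using True by (simp add: phi_apply a_def)
    next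
      case False
      then show ?thesis using \<phi> by (simp add: SpecPol_def phi_def extensional_def)
    qed
  qed
qed

lemma conv_phi: "conv q (phi \<rho>) (phi \<sigma>) = phi (\<rho> * \<sigma>)"
proof
  fix x
  show "conv q (phi \<rho>) (phi \<sigma>) x = phi (\<rho> * \<sigma>) x"
  proof (cases "x \<in> FS")
    case True
    have "tens_functional (phi \<rho>) (phi \<sigma>) (Delta q x) = ev (\<lambda>p. phi_w \<sigma> (snd p) * phi_w \<rho> (fst p)) (Delta q x)"
      by (simp add: tens_functional_def ev_def[of _ "Delta q x"] phi_apply mult_ac)
    also have "\<dots> = ev (\<lambda>w. \<sigma> powi wt w * phi_w \<rho> w) x"
      by (simp only: ev_sl[symmetric] ev_sl_Delta_tor)
    also have "\<dots> = ev (phi_w (\<rho> * \<sigma>)) x"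
      by (rule ev_cong) (simp add: tor_def power_int_mult_distrib)
    finally show ?thesis using True by (simp add: conv_def phi_apply)
  qed (simp add: conv_def phi_def)
qed

lemma continuous_phi: "x \<in> FS \<Longrightarrow> 0 \<notin> S \<Longrightarrow> continuous_on S (\<lambda>\<rho>. phi \<rho> x)"
proof -
  assume x: "x \<in> FS" and S: "0 \<notin> S"
  have "continuous_on S (\<lambda>\<rho>. phi_w \<rho> w)" for w
    unfolding tor_def using S by (cases "set w \<subseteq> {GA, GAs}") (auto intro!: continuous_intros)
  then show ?thesis using x unfolding phi_apply[OF x] ev_def by (intro continuous_intros)
qed

lemma continuous_map_phi:
  assumes "0 \<notin> S"
  shows "continuous_map (top_of_set S) (product_topology (\<lambda>_. euclidean) FS) phi"
  unfolding continuous_map_componentwise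
  using assms continuous_phi by (auto simp: phi_def[abs_def] continuous_map_iff_continuous)

lemma homeomorphic_SpecPol:
  assumes q: "-1 < q" "q < 1" "q \<noteq> 0"
  shows "homeomorphic_map (SpecPol_top q) (subtopology euclidean (UNIV - {0})) (\<lambda>\<phi>. \<phi> (delta [GA]))"
  unfolding homeomorphic_map_maps
proof (rule exI[of _ phi], unfold homeomorphic_maps_def, intro conjI ballI)
  have ts: "topspace (SpecPol_top q) = SpecPol q"
    by (auto simp: SpecPol_top_def topspace_product_topology SpecPol_def PiE_def)
  show "continuous_map (SpecPol_top q) (top_of_set (UNIV - {0})) (\<lambda>\<phi>. \<phi> (delta [GA]))"
    unfolding continuous_map_in_subtopology
  proof
    show "continuous_map (SpecPol_top q) euclidean (\<lambda>\<phi>. \<phi> (delta [GA]))"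
      unfolding SpecPol_top_def
      by (rule continuous_map_from_subtopology[OF continuous_map_product_projection]) simp
    show "(\<lambda>\<phi>. \<phi> (delta [GA])) \<in> topspace (SpecPol_top q) \<rightarrow> UNIV - {0}"
      unfolding ts using SpecPol_eq_phi(1)[OF q] by auto
  qed
  show "continuous_map (top_of_set (UNIV - {0})) (SpecPol_top q) phi"
    unfolding SpecPol_top_def continuous_map_in_subtopology
    using continuous_map_phi[of "UNIV - {0}"] phi_SpecPol by auto
  show "phi (\<phi> (delta [GA])) = \<phi>" if "\<phi> \<in> topspace (SpecPol_top q)" for \<phi>
    using that SpecPol_eq_phi(2)[OF q] unfolding ts by metis
qed simp

lemma bij_SpecPol:
  assumes q: "-1 < q" "q < 1" "q \<noteq> 0"
  shows "bij_betw (\<lambda>\<phi>. \<phi> (delta [GA])) (SpecPol q) (UNIV - {0})"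
proof (rule bij_betw_byWitness[of _ phi])
  show "\<forall>\<phi>\<in>SpecPol q. phi (\<phi> (delta [GA])) = \<phi>" using SpecPol_eq_phi(2)[OF q] by metis
  show "(\<lambda>\<phi>. \<phi> (delta [GA])) ` SpecPol q \<subseteq> UNIV - {0}" using SpecPol_eq_phi(1)[OF q] by auto
  show "phi ` (UNIV - {0}) \<subseteq> SpecPol q" using phi_SpecPol by auto
qed simp

section \<open>The weighted norm\<close>

text \<open>The columns of \<open>V\<close> are the normalised weight vectors; one unitary matrix
  diagonalises all torus functionals at once.\<close>

lemma irreducible_diagonal:
  assumes "-1 < q" "q < 1" "q \<noteq> 0" "irreducible_unitary_corep q (n + 1) U"
  obtains V where "unitary_mat (n + 1) V"
    "\<And>h i j. i \<le> n \<Longrightarrow> j \<le> n \<Longrightarrow>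
      ev (tor h) (U i j) = (\<Sum>k<n + 1. V i k * h (int n - 2 * int k) * cnj (V j k))"
proof -
  obtain v where "weighted_corep q (n + 1) U n v" by (rule irreducible_weighted[OF assms])
  then interpret weighted_corep q "n + 1" U n v .
  define rn where "rn k = sqrt (\<Sum>i<n + 1. (cmod (v k i))\<^sup>2)" for k
  have nn: "nn k = complex_of_real (rn k) * complex_of_real (rn k)" for k
    unfolding nn_def inner_d_self rn_def of_real_mult[symmetric]
    by (subst real_sqrt_mult_self) (simp add: sum_nonneg)
  have rn0: "complex_of_real (rn k) \<noteq> 0" if "k \<le> n" for k using nn_nonzero[OF that] nn[of k] by auto
  define V where "V i k = v k i / complex_of_real (rn k)" for i k
  show ?thesis
  proof (rule that[of V])
    show "unitary_mat (n + 1) V" unfolding unitary_mat_def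
    proof (intro allI impI)
      fix i j assume ij: "i < n + 1" "j < n + 1"
      have "(\<Sum>k<n + 1. cnj (V k i) * V k j) = inner_d (n + 1) (v i) (v j) / (rn i * rn j)"
        unfolding inner_d_def sum_divide_distrib by (intro sum.cong refl) (simp add: V_def)
      also have "\<dots> = (if i = j then 1 else 0)"
      proof (cases "i = j")
        case True
        have "inner_d (n + 1) (v i) (v i) = complex_of_real (rn i) * complex_of_real (rn i)"
          using nn[of i] by (simp only: nn_def)
        then have "inner_d (n + 1) (v i) (v i) / (rn i * rn i) = 1" using rn0[of i] ij(1) by simp
        then show ?thesis using True by simp
      next
        case False
        then have "inner_d (n + 1) (v i) (v j) = 0" using inner_v[of i j] ij by simp
        then show ?thesis using False by simp
      qed
      finally show "(\<Sum>k<n + 1. cnj (V k i) * V k j) = (if i = j then 1 else 0)" .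
    qed
    fix h i j assume ij: "i \<le> n" "j \<le> n"
    \<comment> \<open>Inserting \<open>Pm\<close>, the identity by irreducibility, expands the
      standard basis in weight vectors.\<close>
    have "ev (tor h) (U i j) = (\<Sum>l<n + 1. ev (tor h) (U i l) * Pm l j)"
    proof -
      have "(\<Sum>l<n + 1. ev (tor h) (U i l) * Pm l j) = (\<Sum>l<n + 1. ev (tor h) (U i l) * (if l = j then 1 else 0))"
        using ij irreducible_Pm(1)[OF assms(4)] by (intro sum.cong refl) auto
      then show ?thesis using ij by (simp only: sum_unit_mult(2)[of j "n + 1"])
    qed
    also have "\<dots> = (\<Sum>l<n + 1. \<Sum>k\<le>n. cnj (v k j) / nn k * (ev (tor h) (U i l) * v k l))"
      unfolding Pm_def sum_distrib_left by (intro sum.cong refl) (simp add: mult_ac)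
    also have "\<dots> = (\<Sum>k\<le>n. cnj (v k j) / nn k * (\<Sum>l<n + 1. ev (tor h) (U i l) * v k l))"
      unfolding sum_distrib_left by (rule sum.swap)
    also have "\<dots> = (\<Sum>k\<le>n. cnj (v k j) / nn k * act (tor h) (v k) i)"
      using ij unfolding act_def by (simp only: Suc_eq_plus1[symmetric] less_Suc_eq_le if_True)
    also have "\<dots> = (\<Sum>k\<le>n. V i k * h (int n - 2 * int k) * cnj (V j k))"
    proof (intro sum.cong refl)
      fix k assume "k \<in> {..n}"
      then have tv: "act (tor h) (v k) i = h (int n - 2 * int k) * v k i" by (simp only: tor_v atMost_iff)
      show "cnj (v k j) / nn k * act (tor h) (v k) i = V i k * h (int n - 2 * int k) * cnj (V j k)"
        unfolding tv nn V_def by simp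
    qed
    finally show "ev (tor h) (U i j) = (\<Sum>k<n + 1. V i k * h (int n - 2 * int k) * cnj (V j k))"
      by (simp add: lessThan_Suc_atMost)
  qed
qed

lemma trace_norm_nonneg: "trace_norm d A \<ge> 0"
proof -
  obtain X Y \<sigma> where s: "is_svd d A X Y \<sigma>" using ex_svd by blast
  then show ?thesis using trace_norm_eq[OF s] by (auto simp: is_svd_def intro!: sum_nonneg)
qed

lemma trace_norm_zero: "trace_norm d (\<lambda>i j. 0) = 0"
proof -
  have "is_svd d (\<lambda>i j. 0) (\<lambda>i j. if i = j then 1 else 0) (\<lambda>i j. if i = j then 1 else 0) (\<lambda>k. 0)"
    by (simp add: is_svd_def unitary_mat_id)
  from trace_norm_eq[OF this] show ?thesis by simp
qed

lemma trace_norm_rank_one: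
  assumes V: "unitary_mat d V" and k: "k < d"
  shows "trace_norm d (\<lambda>i j. cnj (V i k) * V j k) = 1"
proof -
  have "is_svd d (\<lambda>i j. cnj (V i k) * V j k) (\<lambda>i l. cnj (V i l)) (\<lambda>l j. V j l) (\<lambda>l. if l = k then 1 else 0)"
    unfolding is_svd_def
  proof (intro conjI allI impI)
    fix i j
    have "(\<Sum>l<d. cnj (V i l) * complex_of_real (if l = k then 1 else 0) * V j l) = (\<Sum>l<d. if l = k then cnj (V i l) * V j l else 0)"
      by (intro sum.cong refl) auto
    then show "cnj (V i k) * V j k = (\<Sum>l<d. cnj (V i l) * complex_of_real (if l = k then 1 else 0) * V j l)"
      using k by simp
  qed (use V in \<open>auto intro: unitary_mat_cnj unitary_mat_transpose\<close>)
  from trace_norm_eq[OF this] show ?thesis using k by simp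
qed

lemma power_int_annulus_bound:
  assumes "\<beta> \<ge> 1" "\<rho> \<noteq> 0" "1 / \<beta> \<le> cmod \<rho>" "cmod \<rho> \<le> \<beta>" "\<bar>m\<bar> \<le> int n"
  shows "cmod (\<rho> powi m) \<le> \<beta> ^ n"
proof (cases "m \<ge> 0")
  case True
  then have "cmod (\<rho> powi m) = cmod \<rho> ^ nat m" by (simp add: power_int_def norm_power)
  also have "\<dots> \<le> \<beta> ^ nat m" using assms by (intro power_mono) auto
  also have "\<dots> \<le> \<beta> ^ n" using assms True by (intro power_increasing) auto
  finally show ?thesis .
next
  case False
  have "inverse (cmod \<rho>) \<le> \<beta>" using assms by (simp add: field_simps)
  have "cmod (\<rho> powi m) = inverse (cmod \<rho>) ^ nat (- m)"
    using False by (simp add: power_int_def norm_power norm_inverse)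
  also have "\<dots> \<le> \<beta> ^ nat (- m)" using \<open>inverse (cmod \<rho>) \<le> \<beta>\<close> by (intro power_mono) auto
  also have "\<dots> \<le> \<beta> ^ n" using assms False by (intro power_increasing) auto
  finally show ?thesis .
qed

definition expansion :: "(nat \<Rightarrow> nat \<Rightarrow> nat \<Rightarrow> fa) \<Rightarrow> nat \<Rightarrow> (nat \<Rightarrow> nat \<Rightarrow> nat \<Rightarrow> complex) \<Rightarrow> fa" where
  "expansion u N A = (\<Sum>n\<le>N. \<Sum>i\<le>n. \<Sum>j\<le>n. fscale (A n i j) (u n i j))"

lemma expansion_eq:
  "fsum (SIGMA n:{..N}. {..n} \<times> {..n}) (\<lambda>(n, i, j). fscale (A n i j) (u n i j)) = expansion u N A"
proof -
  have "expansion u N A = (\<Sum>n\<le>N. \<Sum>(i, j)\<in>{..n} \<times> {..n}. fscale (A n i j) (u n i j))"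
    by (simp only: expansion_def sum.cartesian_product)
  also have "\<dots> = (\<Sum>(n, p)\<in>(SIGMA n:{..N}. {..n} \<times> {..n}). case p of (i, j) \<Rightarrow> fscale (A n i j) (u n i j))"
    by (rule sum.Sigma) auto
  finally show ?thesis by (simp add: fsum_eq)
qed

section \<open>Characters bounded for the weighted norm\<close>

locale irreducible_family =
  fixes q \<beta> :: real and u :: "nat \<Rightarrow> nat \<Rightarrow> nat \<Rightarrow> fa"
  assumes q: "-1 < q" "q < 1" "q \<noteq> 0" and beta: "\<beta> \<ge> 1"
    and irr: "\<And>n. irreducible_unitary_corep q (n + 1) (u n)"
begin

abbreviation norm_w :: "fa \<Rightarrow> real" where
  "norm_w \<equiv> wnorm q u (w_beta \<beta>)"

definition annulus :: "complex set" where
  "annulus = {\<rho>. \<rho> \<noteq> 0 \<and> 1 / \<beta> \<le> cmod \<rho> \<and> cmod \<rho> \<le> \<beta>}"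

lemma u_FS: "i \<le> n \<Longrightarrow> j \<le> n \<Longrightarrow> u n i j \<in> FS"
  using irr[of n] by (simp add: irreducible_unitary_corep_def unitary_corep_def)

lemma expansion_FS: "expansion u N A \<in> FS"
  unfolding expansion_def by (intro FS_closed u_FS) auto

lemma ev_expansion: "ev \<omega> (expansion u N A) = (\<Sum>n\<le>N. \<Sum>i\<le>n. \<Sum>j\<le>n. A n i j * ev \<omega> (u n i j))"
proof -
  have "ev \<omega> (expansion u N A) = (\<Sum>n\<le>N. ev \<omega> (\<Sum>i\<le>n. \<Sum>j\<le>n. fscale (A n i j) (u n i j)))"
    unfolding expansion_def by (rule ev_FS_sum) (intro FS_closed u_FS, auto)
  also have "\<dots> = (\<Sum>n\<le>N. \<Sum>i\<le>n. ev \<omega> (\<Sum>j\<le>n. fscale (A n i j) (u n i j)))"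
    by (intro sum.cong refl ev_FS_sum FS_closed u_FS) auto
  also have "\<dots> = (\<Sum>n\<le>N. \<Sum>i\<le>n. \<Sum>j\<le>n. ev \<omega> (fscale (A n i j) (u n i j)))"
    by (intro sum.cong refl ev_FS_sum FS_closed u_FS) auto
  finally show ?thesis by (simp add: ev_fscale)
qed

definition norm_set :: "fa \<Rightarrow> real set" where
  "norm_set f = {(\<Sum>n\<le>N. w_beta \<beta> n * trace_norm (n + 1) (A n)) | N A. f - expansion u N A \<in> rel_ideal q}"

lemma norm_w_eq: "norm_w f = Inf (norm_set f)"
  by (simp add: wnorm_def norm_set_def expansion_eq fsub_eq)

lemma norm_set_nonneg: "t \<in> norm_set f \<Longrightarrow> 0 \<le> t"
  unfolding norm_set_def w_beta_def using beta
  by (auto intro!: sum_nonneg mult_nonneg_nonneg trace_norm_nonneg)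

text \<open>Spanning by matrix coefficients enters here; it makes the infimum one over a nonempty
  set.\<close>

lemma norm_set_nonempty:
  assumes "f \<in> FS" shows "norm_set f \<noteq> {}"
proof -
  obtain N where N: "f \<in> Gr q N" using FS_in_some_Gr[OF assms] by blast
  \<comment> \<open>\<open>coefficients_span\<close> sums over \<open>n < N\<close> and
    \<open>expansion\<close> over \<open>n \<le> N\<close>, hence the shift by one.\<close>
  then have "f \<in> Gr q (Suc N)" by (rule Gr_mono[rotated]) simp
  from coefficients_span[OF q irr this] obtain A
    where "f - (\<Sum>n<Suc N. \<Sum>i\<le>n. \<Sum>j\<le>n. fscale (A n i j) (u n i j)) \<in> rel_ideal q" by blast
  then have "f - expansion u N A \<in> rel_ideal q" by (simp only: expansion_def lessThan_Suc_atMost)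
  then show ?thesis unfolding norm_set_def by blast
qed

lemma norm_w_le: "t \<in> norm_set f \<Longrightarrow> norm_w f \<le> t"
  unfolding norm_w_eq using norm_set_nonneg by (intro cInf_lower bdd_belowI[of _ 0]) auto

text \<open>In the basis \<open>V\<close> the character is diagonal with entries
  \<open>\<rho> powi (n - 2 k)\<close>, bounded by the weight \<open>\<beta> ^ n\<close>, and trace
  duality applies. The constant \<open>1\<close> is uniform over the annulus, which
  \<open>continuous_limit\<close> relies on.\<close>

lemma phi_bound:
  assumes \<rho>: "\<rho> \<in> annulus" and f: "f \<in> FS"
  shows "cmod (phi \<rho> f) \<le> norm_w f"
  unfolding norm_w_eq
proof (rule cInf_greatest[OF norm_set_nonempty[OF f]])
  fix t assume "t \<in> norm_set f"
  then obtain N A where t: "t = (\<Sum>n\<le>N. w_beta \<beta> n * trace_norm (n + 1) (A n))"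
    and fA: "f - expansion u N A \<in> rel_ideal q" unfolding norm_set_def by blast
  have "phi \<rho> f = ev (phi_w \<rho>) (expansion u N A)"
    using tor_kills[OF fA, of "\<lambda>k. \<rho> powi k"] f expansion_FS by (simp add: ev_FS_diff phi_apply)
  also have "\<dots> = (\<Sum>n\<le>N. \<Sum>i\<le>n. \<Sum>j\<le>n. A n i j * ev (phi_w \<rho>) (u n i j))" by (rule ev_expansion)
  also have "cmod \<dots> \<le> (\<Sum>n\<le>N. w_beta \<beta> n * trace_norm (n + 1) (A n))"
  proof (rule sum_norm_le)
    fix n
    obtain V where V: "unitary_mat (n + 1) V"
      "\<And>h i j. i \<le> n \<Longrightarrow> j \<le> n \<Longrightarrow>
        ev (tor h) (u n i j) = (\<Sum>k<n + 1. V i k * h (int n - 2 * int k) * cnj (V j k))"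
      by (rule irreducible_diagonal[OF q irr]) (rule that)
    obtain X Y \<sigma> where s: "is_svd (n + 1) (A n) X Y \<sigma>" using ex_svd by blast
    have "(\<Sum>i\<le>n. \<Sum>j\<le>n. A n i j * ev (phi_w \<rho>) (u n i j))
      = (\<Sum>i<n + 1. \<Sum>j<n + 1. A n i j * (\<Sum>k<n + 1. V i k * \<rho> powi (int n - 2 * int k) * cnj (V j k)))"
      unfolding Suc_eq_plus1[symmetric] lessThan_Suc_atMost
      by (intro sum.cong refl) (simp add: V(2) lessThan_Suc_atMost del: sum.lessThan_Suc)
    also have "cmod \<dots> \<le> \<beta> ^ n * (\<Sum>k<n + 1. \<sigma> k)"
    proof (rule svd_pairing_bound[OF s V(1), of "\<lambda>k j. cnj (V j k)"])
      show "unitary_mat (n + 1) (\<lambda>k j. cnj (V j k))" by (rule unitary_mat_cnj[OF unitary_mat_transpose[OF V(1)]])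
      show "cmod (\<rho> powi (int n - 2 * int k)) \<le> \<beta> ^ n" if "k < n + 1" for k
        using \<rho> that beta by (intro power_int_annulus_bound) (auto simp: annulus_def)
    qed
    finally show "cmod (\<Sum>i\<le>n. \<Sum>j\<le>n. A n i j * ev (phi_w \<rho>) (u n i j)) \<le> w_beta \<beta> n * trace_norm (n + 1) (A n)"
      by (simp only: trace_norm_eq[OF s] w_beta_def)
  qed
  finally show "cmod (phi \<rho> f) \<le> t" unfolding t .
qed

text \<open>The only nonzero coefficient matrix is a rank one matrix built from the weight vector
  number \<open>k\<close>. Its trace norm is \<open>1\<close>, and orthonormality lets a character
  see only the weight \<open>n - 2 k\<close>.\<close>

lemma ex_peak:
  assumes "k \<le> n"
  shows "\<exists>f\<in>FS. norm_w f \<le> \<beta> ^ n \<and> (\<forall>\<rho>. phi \<rho> f = \<rho> powi (int n - 2 * int k))"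
proof -
  obtain V where V: "unitary_mat (n + 1) V"
    "\<And>h i j. i \<le> n \<Longrightarrow> j \<le> n \<Longrightarrow>
      ev (tor h) (u n i j) = (\<Sum>k<n + 1. V i k * h (int n - 2 * int k) * cnj (V j k))"
    by (rule irreducible_diagonal[OF q irr]) (rule that)
  define A where "A m = (if m = n then (\<lambda>i j. cnj (V i k) * V j k) else (\<lambda>i j. 0))" for m
  define f where "f = expansion u n A"
  have fF: "f \<in> FS" unfolding f_def by (rule expansion_FS)
  have "(\<Sum>m\<le>n. w_beta \<beta> m * trace_norm (m + 1) (A m)) = (\<Sum>m\<le>n. if m = n then \<beta> ^ n else 0)"
    using trace_norm_rank_one[OF V(1), of k] assms
    by (intro sum.cong refl) (auto simp: A_def trace_norm_zero w_beta_def)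
  then have "(\<Sum>m\<le>n. w_beta \<beta> m * trace_norm (m + 1) (A m)) = \<beta> ^ n" by simp
  moreover have "f - expansion u n A \<in> rel_ideal q" by (simp add: f_def rel_ideal_closed(5))
  ultimately have "\<beta> ^ n \<in> norm_set f" unfolding norm_set_def mem_Collect_eq by metis
  then have "norm_w f \<le> \<beta> ^ n" by (rule norm_w_le)
  moreover have "phi \<rho> f = \<rho> powi (int n - 2 * int k)" for \<rho>
  proof -
    define h where "h l = \<rho> powi (int n - 2 * int l)" for l
    have "phi \<rho> f = (\<Sum>m\<le>n. if m = n then (\<Sum>i\<le>n. \<Sum>j\<le>n. cnj (V i k) * V j k * ev (phi_w \<rho>) (u n i j)) else 0)"
      unfolding phi_apply[OF fF] unfolding f_def ev_expansion by (intro sum.cong refl) (auto simp: A_def)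
    also have "\<dots> = (\<Sum>i\<le>n. \<Sum>j\<le>n. cnj (V i k) * V j k * ev (phi_w \<rho>) (u n i j))" by simp
    also have "\<dots> = (\<Sum>i<n + 1. \<Sum>j<n + 1. \<Sum>l<n + 1. h l * ((cnj (V i k) * V i l) * (cnj (V j l) * V j k)))"
      unfolding Suc_eq_plus1[symmetric] lessThan_Suc_atMost
      by (intro sum.cong refl) (simp add: V(2) h_def lessThan_Suc_atMost sum_distrib_left mult_ac del: sum.lessThan_Suc)
    also have "\<dots> = (\<Sum>l<n + 1. \<Sum>i<n + 1. \<Sum>j<n + 1. h l * ((cnj (V i k) * V i l) * (cnj (V j l) * V j k)))"
      by (rule sum_swap3[symmetric])
    also have "\<dots> = (\<Sum>l<n + 1. h l * ((\<Sum>i<n + 1. cnj (V i k) * V i l) * (\<Sum>j<n + 1. cnj (V j l) * V j k)))"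
      by (simp only: sum_product) (simp only: sum_distrib_left)
    also have "\<dots> = (\<Sum>l<n + 1. h l * (if l = k then 1 else 0))"
      using V(1) assms unfolding unitary_mat_def by (intro sum.cong refl arg_cong2[of _ _ _ _ "(*)"]) auto
    also have "\<dots> = h k" using assms by (intro sum_unit_mult(2)) simp
    finally show ?thesis by (simp add: h_def)
  qed
  ultimately show ?thesis using fF by blast
qed

text \<open>The extreme weights \<open>n\<close> and \<open>-n\<close> bound the powers of
  \<open>cmod \<rho>\<close> and of its inverse by a constant times \<open>\<beta> ^ n\<close>;
  comparing growth in \<open>n\<close> removes the constant.\<close>

lemma annulus_if_bounded:
  assumes \<rho>: "\<rho> \<noteq> 0" and C: "\<And>f. f \<in> FS \<Longrightarrow> cmod (phi \<rho> f) \<le> C * norm_w f"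
  shows "\<rho> \<in> annulus"
proof -
  have key: "x \<le> \<beta>" if x: "\<And>n. x ^ n \<le> \<bar>C\<bar> * \<beta> ^ n" for x :: real
  proof (rule ccontr)
    assume "\<not> x \<le> \<beta>"
    then have "1 < x / \<beta>" using beta by simp
    then obtain n where "\<bar>C\<bar> < (x / \<beta>) ^ n" using real_arch_pow by blast
    then have "\<bar>C\<bar> * \<beta> ^ n < x ^ n" using beta by (simp add: power_divide field_simps)
    then show False using x[of n] by simp
  qed
  have bound: "cmod (\<rho> powi (int n - 2 * int k)) \<le> \<bar>C\<bar> * \<beta> ^ n" if kn: "k \<le> n" for n k
  proof -
    obtain f where f: "f \<in> FS" "norm_w f \<le> \<beta> ^ n" "phi \<rho> f = \<rho> powi (int n - 2 * int k)"
      using ex_peak[OF kn] by blast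
    have "0 \<le> norm_w f" unfolding norm_w_eq
      using norm_set_nonneg by (intro cInf_greatest norm_set_nonempty f(1)) auto
    then have "C * norm_w f \<le> \<bar>C\<bar> * \<beta> ^ n" using f(2) by (intro mult_mono) auto
    then show ?thesis using C[OF f(1)] f(3) by simp
  qed
  have "cmod \<rho> ^ n \<le> \<bar>C\<bar> * \<beta> ^ n" for n using bound[of 0 n] by (simp add: norm_power)
  then have 1: "cmod \<rho> \<le> \<beta>" by (rule key)
  have "inverse (cmod \<rho>) ^ n \<le> \<bar>C\<bar> * \<beta> ^ n" for n
    using bound[of n n] by (simp add: power_int_minus norm_inverse norm_power power_inverse)
  then have "inverse (cmod \<rho>) \<le> \<beta>" by (rule key)
  then have "1 / \<beta> \<le> cmod \<rho>" using \<rho> beta by (simp add: field_simps)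
  then show ?thesis using 1 \<rho> by (simp add: annulus_def)
qed

lemma SpecA_eq: "SpecA q u (w_beta \<beta>) = phi ` annulus"
proof (intro equalityI subsetI)
  fix \<phi> assume "\<phi> \<in> SpecA q u (w_beta \<beta>)"
  then obtain C where \<phi>: "\<phi> \<in> SpecPol q" and C: "\<And>f. f \<in> FS \<Longrightarrow> cmod (\<phi> f) \<le> C * norm_w f"
    unfolding SpecA_def by blast
  define \<rho> where "\<rho> = \<phi> (delta [GA])"
  have \<rho>: "\<rho> \<noteq> 0" "\<phi> = phi \<rho>" using SpecPol_eq_phi[OF q \<phi>] by (simp_all add: \<rho>_def)
  then have "\<rho> \<in> annulus" using C by (intro annulus_if_bounded) auto
  then show "\<phi> \<in> phi ` annulus" using \<rho> by blast
next
  fix \<phi> assume "\<phi> \<in> phi ` annulus"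
  then obtain \<rho> where \<rho>: "\<rho> \<in> annulus" "\<phi> = phi \<rho>" by blast
  then have "\<phi> \<in> SpecPol q" using phi_SpecPol by (simp add: annulus_def)
  moreover have "cmod (\<phi> f) \<le> 1 * norm_w f" if "f \<in> FS" for f using phi_bound \<rho> that by simp
  ultimately show "\<phi> \<in> SpecA q u (w_beta \<beta>)" unfolding SpecA_def by blast
qed

lemma const_wcauchy: "x \<in> FS \<Longrightarrow> (\<lambda>k. x) \<in> wcauchy q u (w_beta \<beta>)"
proof -
  assume x: "x \<in> FS"
  have "expansion u 0 (\<lambda>n i j. 0) = 0" by (simp add: expansion_def)
  then have "(x - x) - expansion u 0 (\<lambda>n i j. 0) \<in> rel_ideal q" by (simp add: rel_ideal_closed(5))
  then have "(\<Sum>n\<le>0. w_beta \<beta> n * trace_norm (n + 1) (\<lambda>i j. 0)) \<in> norm_set (x - x)"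
    unfolding norm_set_def mem_Collect_eq by (intro exI[of _ 0] exI[of _ "\<lambda>n i j. 0"] conjI refl)
  then have "norm_w (x - x) \<le> 0" using norm_w_le by (force simp: trace_norm_zero)
  then show ?thesis using x by (auto simp: wcauchy_def fsub_eq intro: le_less_trans)
qed

text \<open>The norm dominates all characters of the annulus at once, so a Cauchy sequence in norm
  is uniformly Cauchy there and its limit is continuous.\<close>

lemma continuous_limit:
  assumes \<sigma>: "\<sigma> \<in> wcauchy q u (w_beta \<beta>)"
  shows "continuous_on annulus (\<lambda>\<rho>. lim (\<lambda>k. phi \<rho> (\<sigma> k)))"
proof -
  have \<sigma>F: "\<sigma> k \<in> FS" for k using \<sigma> by (simp add: wcauchy_def)
  have "uniformly_Cauchy_on annulus (\<lambda>k \<rho>. phi \<rho> (\<sigma> k))"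
  proof (rule uniformly_Cauchy_onI)
    fix e :: real assume "e > 0"
    then obtain N where N: "\<And>m n. m \<ge> N \<Longrightarrow> n \<ge> N \<Longrightarrow> norm_w (fsub (\<sigma> m) (\<sigma> n)) < e"
      using \<sigma> unfolding wcauchy_def by blast
    have "dist (phi \<rho> (\<sigma> m)) (phi \<rho> (\<sigma> n)) < e" if "\<rho> \<in> annulus" "m \<ge> N" "n \<ge> N" for \<rho> m n
    proof -
      have "phi \<rho> (\<sigma> m) - phi \<rho> (\<sigma> n) = phi \<rho> (\<sigma> m - \<sigma> n)"
        using \<sigma>F by (simp add: phi_apply FS_closed ev_FS_diff)
      then have "dist (phi \<rho> (\<sigma> m)) (phi \<rho> (\<sigma> n)) \<le> norm_w (\<sigma> m - \<sigma> n)"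
        using phi_bound[OF that(1), of "\<sigma> m - \<sigma> n"] \<sigma>F by (simp add: dist_norm FS_closed)
      also have "\<dots> < e" using N[OF that(2,3)] by (simp add: fsub_eq)
      finally show ?thesis .
    qed
    then show "\<exists>M. \<forall>x\<in>annulus. \<forall>m\<ge>M. \<forall>n\<ge>M. dist (phi x (\<sigma> m)) (phi x (\<sigma> n)) < e" by blast
  qed
  then have "uniformly_convergent_on annulus (\<lambda>k \<rho>. phi \<rho> (\<sigma> k))" by (rule Cauchy_uniformly_convergent)
  then have "uniform_limit annulus (\<lambda>k \<rho>. phi \<rho> (\<sigma> k)) (\<lambda>\<rho>. lim (\<lambda>k. phi \<rho> (\<sigma> k))) sequentially"
    by (simp add: uniformly_convergent_uniform_limit_iff)
  moreover have "\<forall>\<^sub>F k in sequentially. continuous_on annulus (\<lambda>\<rho>. phi \<rho> (\<sigma> k))"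
    using \<sigma>F by (intro always_eventually allI continuous_phi) (auto simp: annulus_def)
  ultimately show ?thesis by (intro uniform_limit_theorem) auto
qed

lemma homeomorphic_SpecA:
  "homeomorphic_map (SpecA_top q u (w_beta \<beta>)) (top_of_set annulus) (\<lambda>\<phi>. \<phi> (delta [GA]))"
  unfolding homeomorphic_map_maps
proof (rule exI[of _ phi], unfold homeomorphic_maps_def, intro conjI ballI)
  let ?W = "wcauchy q u (w_beta \<beta>)"
  let ?g = "\<lambda>\<phi>. restrict (\<lambda>\<sigma>. lim (\<lambda>k. \<phi> (\<sigma> k))) ?W"
  have ts: "topspace (SpecA_top q u (w_beta \<beta>)) = phi ` annulus"
    by (auto simp: SpecA_top_def topspace_pullback_topology SpecA_eq)
  \<comment> \<open>Evaluation at \<open>GA\<close> is a coordinate of the Gelfand topology, the one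
    of this constant sequence. Continuity of the inverse is \<open>continuous_limit\<close> in each
    coordinate.\<close>
  have c: "(\<lambda>k. delta [GA]) \<in> ?W" by (rule const_wcauchy) simp
  show "continuous_map (SpecA_top q u (w_beta \<beta>)) (top_of_set annulus) (\<lambda>\<phi>. \<phi> (delta [GA]))"
    unfolding continuous_map_in_subtopology
  proof
    have cm: "continuous_map (SpecA_top q u (w_beta \<beta>)) euclidean ((\<lambda>y. y (\<lambda>k. delta [GA])) \<circ> ?g)"
      unfolding SpecA_top_def
      by (intro continuous_map_pullback continuous_map_product_projection[OF c])
    have eq: "(\<lambda>y. y (\<lambda>k. delta [GA])) \<circ> ?g = (\<lambda>\<phi>. \<phi> (delta [GA]))"
      using c by (auto simp: fun_eq_iff)
    show "continuous_map (SpecA_top q u (w_beta \<beta>)) euclidean (\<lambda>\<phi>. \<phi> (delta [GA]))"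
      using cm unfolding eq .
    show "(\<lambda>\<phi>. \<phi> (delta [GA])) \<in> topspace (SpecA_top q u (w_beta \<beta>)) \<rightarrow> annulus"
      unfolding ts by auto
  qed
  show "continuous_map (top_of_set annulus) (SpecA_top q u (w_beta \<beta>)) phi"
    unfolding SpecA_top_def
  proof (rule continuous_map_pullback')
    show "topspace (top_of_set annulus) \<subseteq> phi -` SpecA q u (w_beta \<beta>)" by (auto simp: SpecA_eq)
    show "continuous_map (top_of_set annulus) (product_topology (\<lambda>_. euclidean) ?W) (?g \<circ> phi)"
      unfolding continuous_map_componentwise
      using continuous_limit by (auto simp: continuous_map_iff_continuous)
  qed
  show "phi (\<phi> (delta [GA])) = \<phi>" if "\<phi> \<in> topspace (SpecA_top q u (w_beta \<beta>))" for \<phi>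
    using that unfolding ts by auto
qed simp

end

section \<open>Diagonal matrices and the operator norm\<close>

lemma diag2_mult: "(diag2 \<rho> *v x) $ i = (if i = 1 then \<rho> else inverse \<rho>) * x $ i" for i :: 2
  by (simp add: matrix_vector_mult_def diag2_def sum_2) (metis exhaust_2)

text \<open>Coordinate vectors show that both diagonal entries are at most the norm; the converse
  estimate is componentwise.\<close>

lemma onorm_diag2_le:
  assumes "\<beta> \<ge> 1" "\<rho> \<noteq> 0"
  shows "onorm (\<lambda>x. diag2 \<rho> *v x) \<le> \<beta> \<longleftrightarrow> 1 / \<beta> \<le> cmod \<rho> \<and> cmod \<rho> \<le> \<beta>"
proof -
  have inv: "inverse (cmod \<rho>) \<le> \<beta> \<longleftrightarrow> 1 / \<beta> \<le> cmod \<rho>" using assms by (auto simp: field_simps)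
  have bl: "bounded_linear (\<lambda>x. diag2 \<rho> *v x)" by simp
  have lower: "cmod (if i = 1 then \<rho> else inverse \<rho>) \<le> onorm (\<lambda>x. diag2 \<rho> *v x)" for i :: 2
  proof -
    have "cmod (if i = 1 then \<rho> else inverse \<rho>) = norm ((diag2 \<rho> *v axis i 1) $ i)"
      by (simp add: diag2_mult)
    also have "\<dots> \<le> norm (diag2 \<rho> *v axis i 1)" by (rule Finite_Cartesian_Product.norm_nth_le)
    also have "\<dots> \<le> onorm (\<lambda>x. diag2 \<rho> *v x) * norm (axis i (1 :: complex) :: complex^2)"
      by (rule onorm[OF bl])
    finally show ?thesis by simp
  qed
  show ?thesis
  proof
    assume "onorm (\<lambda>x. diag2 \<rho> *v x) \<le> \<beta>"
    then show "1 / \<beta> \<le> cmod \<rho> \<and> cmod \<rho> \<le> \<beta>"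
      using lower[of 1] lower[of 2] inv by (simp add: norm_inverse)
  next
    assume *: "1 / \<beta> \<le> cmod \<rho> \<and> cmod \<rho> \<le> \<beta>"
    show "onorm (\<lambda>x. diag2 \<rho> *v x) \<le> \<beta>"
    proof (rule onorm_bound)
      fix x :: "complex^2"
      have "norm (diag2 \<rho> *v x) \<le> norm (\<beta> *\<^sub>R x)"
      proof (rule norm_le_componentwise_cart)
        fix i :: 2
        have "cmod (if i = 1 then \<rho> else inverse \<rho>) \<le> \<beta>" using * inv by (simp add: norm_inverse)
        then show "norm ((diag2 \<rho> *v x) $ i) \<le> norm ((\<beta> *\<^sub>R x) $ i)"
          unfolding diag2_mult norm_mult using assms by (simp add: mult_right_mono)
      qed
      then show "norm (diag2 \<rho> *v x) \<le> \<beta> * norm x" using assms by simp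
    qed (use assms in simp)
  qed
qed

lemma homeomorphic_diag2:
  assumes "\<beta> \<ge> 1"
  shows "homeomorphic_map
        (subtopology euclidean {\<rho>. \<rho> \<noteq> 0 \<and> 1 / \<beta> \<le> cmod \<rho> \<and> cmod \<rho> \<le> \<beta>})
        (subtopology euclidean {V. \<exists>\<rho>. \<rho> \<noteq> 0 \<and> V = diag2 \<rho> \<and> onorm (\<lambda>x. V *v x) \<le> \<beta>})
        diag2" (is "homeomorphic_map (top_of_set ?S) (top_of_set ?D) diag2")
  unfolding homeomorphic_map_maps
proof (rule exI[of _ "\<lambda>V. V $ 1 $ 1"], unfold homeomorphic_maps_def, intro conjI ballI)
  have D: "?D = diag2 ` ?S" using onorm_diag2_le[OF assms] by auto
  have d11: "diag2 \<rho> $ 1 $ 1 = \<rho>" for \<rho> by (simp add: diag2_def)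
  have "continuous_on ?S (\<lambda>\<rho>. if i = j then (if i = 1 then \<rho> else inverse \<rho>) else 0)" for i j :: 2
    by (cases "i = j"; cases "i = 1") (auto intro!: continuous_intros)
  then have "continuous_on ?S diag2" unfolding diag2_def[abs_def] by (intro continuous_on_vec_lambda)
  then show "continuous_map (top_of_set ?S) (top_of_set ?D) diag2"
    unfolding D by (auto simp: continuous_map_in_subtopology)
  have "continuous_on ?D (\<lambda>V. V $ 1 $ 1)" by (intro continuous_intros)
  then show "continuous_map (top_of_set ?D) (top_of_set ?S) (\<lambda>V. V $ 1 $ 1)"
    unfolding D by (auto simp: continuous_map_in_subtopology d11)
  show "diag2 \<rho> $ 1 $ 1 = \<rho>" for \<rho> by (rule d11)
  show "diag2 (V $ 1 $ 1) = V" if "V \<in> topspace (top_of_set ?D)" for V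
    using that by (auto simp: d11)
qed

theorem theorem4p9:
  fixes q \<beta> :: real and u :: "nat \<Rightarrow> nat \<Rightarrow> nat \<Rightarrow> fa"
  assumes "-1 < q" and "q < 1" and "q \<noteq> 0" and "\<beta> \<ge> 1"
    and "\<And>n. irreducible_unitary_corep q (n + 1) (u n)"
  shows "bij_betw (\<lambda>\<phi>. \<phi> (delta [GA])) (SpecPol q) (UNIV - {0})
    \<and> (\<forall>\<phi>\<in>SpecPol q. \<forall>\<psi>\<in>SpecPol q. conv q \<phi> \<psi> \<in> SpecPol q
          \<and> conv q \<phi> \<psi> (delta [GA]) = \<phi> (delta [GA]) * \<psi> (delta [GA]))
    \<and> homeomorphic_map (SpecPol_top q) (subtopology euclidean (UNIV - {0})) (\<lambda>\<phi>. \<phi> (delta [GA]))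
    \<and> homeomorphic_map (SpecA_top q u (w_beta \<beta>))
        (subtopology euclidean {\<rho>. \<rho> \<noteq> 0 \<and> 1 / \<beta> \<le> cmod \<rho> \<and> cmod \<rho> \<le> \<beta>})
        (\<lambda>\<phi>. \<phi> (delta [GA]))
    \<and> homeomorphic_map
        (subtopology euclidean {\<rho>. \<rho> \<noteq> 0 \<and> 1 / \<beta> \<le> cmod \<rho> \<and> cmod \<rho> \<le> \<beta>})
        (subtopology euclidean {V. \<exists>\<rho>. \<rho> \<noteq> 0 \<and> V = diag2 \<rho> \<and> onorm (\<lambda>x. V *v x) \<le> \<beta>})
        diag2"
proof -
  interpret irreducible_family q \<beta> u using assms by unfold_locales
  have "conv q \<phi> \<psi> \<in> SpecPol q \<and> conv q \<phi> \<psi> (delta [GA]) = \<phi> (delta [GA]) * \<psi> (delta [GA])"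
    if "\<phi> \<in> SpecPol q" "\<psi> \<in> SpecPol q" for \<phi> \<psi>
  proof -
    define \<rho> \<sigma> where "\<rho> = \<phi> (delta [GA])" and "\<sigma> = \<psi> (delta [GA])"
    have "\<rho> \<noteq> 0" "\<sigma> \<noteq> 0" "\<phi> = phi \<rho>" "\<psi> = phi \<sigma>"
      using SpecPol_eq_phi[OF q that(1)] SpecPol_eq_phi[OF q that(2)] by (simp_all add: \<rho>_def \<sigma>_def)
    then show ?thesis by (simp add: conv_phi phi_SpecPol)
  qed
  then show ?thesis
    using bij_SpecPol[OF q] homeomorphic_SpecPol[OF q] homeomorphic_SpecA homeomorphic_diag2[OF beta]
    unfolding annulus_def by blast
qed

end
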